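(* Let $(X,\omega_X)$ be a compact connected Kähler manifold of dimension $n$, and let $(\mathcal{E}_1,\mathcal{E}_2,\Phi)$ be a holomorphic family of stable triples over a reduced complex space $S$, with Hermitian metrics $h^\nu$ on $\mathcal{E}_\nu$ ($\nu=1,2$) of class $C^\infty$ on $X\times S$ whose restrictions to all fibers $X\times\{s\}$ solve the coupled vortex equations with real constants $\tau_1,\tau_2$. Denote by $\Omega^\nu$ the curvature form of $(\mathcal{E}_\nu,h^\nu)$ over $X\times S$. Then the vortex--moduli form satisfies $$\omega^{VM}=\sum_{\nu=1,2}\left(\frac12\int_X\mathrm{tr}(\Omega^\nu\wedge\Omega^\nu)\wedge\frac{\omega_X^{n-1}}{(n-1)!}+\tau_\nu\int_X\mathrm{tr}(\sqrt{-1}\,\Omega^\nu)\wedge\frac{\omega_X^n}{n!}\right)+\sqrt{-1}\,\partial\bar\partial\int_X\mathrm{tr}(\Phi\Phi^* )\frac{\omega_X^n}{n!},$$ where $\int_X$ denotes integration along the fibers of $X\times S\to S$.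
   Context: $\omega_X=\sqrt{-1}\,g_{\alpha\bar\beta}dz^\alpha\wedge dz^{\bar\beta}$, total volume normalized to $2\pi$, $g\,dV=\omega_X^n/n!$, $(g^{\bar\beta\alpha})$ inverse of $(g_{\alpha\bar\beta})$; $\omega_X$ is also used for its pull-back to $X\times S$; summation convention. A holomorphic family of triples over $S$ consists of holomorphic vector bundles $\mathcal{E}_1,\mathcal{E}_2$ on $X\times S$ and a holomorphic homomorphism $\Phi:\mathcal{E}_2\to\mathcal{E}_1$. The coupled vortex equations on a fiber triple $(E_1,E_2,\phi)$ with metrics $h^1,h^2$ are $\sqrt{-1}\Lambda_X\Omega^1+\phi\phi^*=\tau_1\mathrm{Id}_{E_1}$, $\sqrt{-1}\Lambda_X\Omega^2-\phi^*\phi=\tau_2\mathrm{Id}_{E_2}$ ($\Omega^\nu$ the Chern curvature on the fiber, $\Lambda_X$ the adjoint of exterior multiplication with $\omega_X$). Stable means $\alpha$-stable with $\alpha=\tau_1-\tau_2$: with $\mu_\alpha(T)=(\deg E_1+\deg E_2+\alpha\,\mathrm{rk}\,E_2)/(\mathrm{rk}\,E_1+\mathrm{rk}\,E_2)$, $\deg=\int_X c_1\wedge\omega_X^{n-1}/(n-1)!$, one has $\mu_\alpha(T')<\mu_\alpha(T)$ for every nonzero proper sub-triple $T'=(E_1',E_2',\phi|_{E_2'})$ ($E_i'\subset E_i$ coherent torsionfree, $\phi(E_2')\subset E_1'$) of smaller total rank. Let $s^i$ be local holomorphic coordinates on $S$ (or on a smooth ambient space into which $S$ is locally minimally embedded).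 $\Omega^\nu$ is the curvature form $\bar\partial(\partial h^\nu\cdot(h^\nu)^{-1})$ of the Chern connection, with components $R^\nu_{\alpha\bar\beta}$, $R^\nu_{i\bar\beta}$, $R^\nu_{\alpha\bar\jmath}$, $R^\nu_{i\bar\jmath}$ (coefficients of $dz^\alpha\wedge dz^{\bar\beta}$, $ds^i\wedge dz^{\bar\beta}$, $dz^\alpha\wedge ds^{\bar\jmath}$, $ds^i\wedge ds^{\bar\jmath}$). $\Phi_{;i}$ is the covariant derivative of $\Phi$ along $\partial/\partial s^i$ for the Chern connection on $Hom(\mathcal{E}_2,\mathcal{E}_1)$ and $\Phi^*_{;\bar\jmath}=(\Phi_{;j})^*$. The vortex--moduli form is $\omega^{VM}=\sqrt{-1}\,G^{VM}_{i\bar\jmath}\,ds^i\wedge ds^{\bar\jmath}$ with $$G^{VM}_{i\bar\jmath}(s)=\int_{X\times\{s\}}\mathrm{tr}(\Phi_{;i}\Phi^*_{;\bar\jmath})g\,dV+\sum_{\nu=1,2}\int_{X\times\{s\}}\mathrm{tr}(g^{\bar\beta\alpha}R^\nu_{i\bar\beta}R^\nu_{\alpha\bar\jmath})g\,dV.$$ Fiber integration of an $(n+1,n+1)$-form gives a $(1,1)$-form on $S$ (on singular $S$, in the sense of local restrictions from a smooth ambient space). *)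

theory Defs
  imports "HOL-Analysis.Analysis"
begin

section \<open>Functions of several complex variables\<close>

text \<open>
  Points of a complex coordinate space are functions from an index type to the complex numbers,
  with a set \<open>I\<close> of active coordinates; all other coordinates vanish.  Three cases occur:
  charts of \<open>X\<close> (index type \<open>'n\<close>, all coordinates active), charts of \<open>S\<close> (index type \<open>nat\<close>,
  active coordinates \<open>{..<N}\<close>, so that the embedding dimension \<open>N\<close> may change from chart to chart)
  and their products (index type \<open>'n + nat\<close>).
\<close>

definition coord_space :: "'k set \<Rightarrow> ('k \<Rightarrow> complex) set" where
  "coord_space I = {p. \<forall>k. k \<notin> I \<longrightarrow> p k = 0}"

definition copen :: "'k set \<Rightarrow> ('k \<Rightarrow> complex) set \<Rightarrow> bool" where
  "copen I \<Omega> \<longleftrightarrow> openin (top_of_set (coord_space I)) \<Omega>"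

definition line_in :: "complex \<Rightarrow> 'k \<Rightarrow> ('k \<Rightarrow> complex) \<Rightarrow> real \<Rightarrow> 'k \<Rightarrow> complex" where
  "line_in c k p t = p(k := p k + of_real t * c)"

text \<open>Real partial derivatives: \<open>c = 1\<close> is the direction of the real part, \<open>c = \<i>\<close> that of the
  imaginary part of the \<open>k\<close>-th coordinate.\<close>

definition pd :: "complex \<Rightarrow> 'k \<Rightarrow> (('k \<Rightarrow> complex) \<Rightarrow> complex) \<Rightarrow> ('k \<Rightarrow> complex) \<Rightarrow> complex" where
  "pd c k f p = vector_derivative (\<lambda>t. f (line_in c k p t)) (at 0)"

definition dd :: "'k \<Rightarrow> (('k \<Rightarrow> complex) \<Rightarrow> complex) \<Rightarrow> ('k \<Rightarrow> complex) \<Rightarrow> complex" where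
  "dd k f p = (pd 1 k f p - \<i> * pd \<i> k f p) / 2"

definition ddbar :: "'k \<Rightarrow> (('k \<Rightarrow> complex) \<Rightarrow> complex) \<Rightarrow> ('k \<Rightarrow> complex) \<Rightarrow> complex" where
  "ddbar k f p = (pd 1 k f p + \<i> * pd \<i> k f p) / 2"

primrec Ck :: "'k set \<Rightarrow> nat \<Rightarrow> ('k \<Rightarrow> complex) set \<Rightarrow> (('k \<Rightarrow> complex) \<Rightarrow> complex) \<Rightarrow> bool" where
  "Ck I 0 \<Omega> f \<longleftrightarrow> continuous_on \<Omega> f"
| "Ck I (Suc m) \<Omega> f \<longleftrightarrow> continuous_on \<Omega> f \<and>
     (\<forall>k\<in>I. \<forall>c\<in>{1, \<i>}.
        (\<forall>p\<in>\<Omega>. (\<lambda>t. f (line_in c k p t)) differentiable (at 0)) \<and> Ck I m \<Omega> (pd c k f))"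

definition smooth :: "'k set \<Rightarrow> ('k \<Rightarrow> complex) set \<Rightarrow> (('k \<Rightarrow> complex) \<Rightarrow> complex) \<Rightarrow> bool" where
  "smooth I \<Omega> f \<longleftrightarrow> (\<forall>m. Ck I m \<Omega> f)"

definition hol :: "'k set \<Rightarrow> ('k \<Rightarrow> complex) set \<Rightarrow> (('k \<Rightarrow> complex) \<Rightarrow> complex) \<Rightarrow> bool" where
  "hol I \<Omega> f \<longleftrightarrow> smooth I \<Omega> f \<and> (\<forall>k\<in>I. \<forall>p\<in>\<Omega>. ddbar k f p = 0)"


section \<open>Matrices\<close>

definition cadj :: "complex^'c^'d \<Rightarrow> complex^'d^'c" where
  "cadj M = (\<chi> i j. cnj (M $ j $ i))"

definition csm :: "complex \<Rightarrow> complex^'c^'d \<Rightarrow> complex^'c^'d" where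
  "csm c M = (\<chi> i j. c * M $ i $ j)"

definition hermitian_pd :: "complex^'r^'r \<Rightarrow> bool" where
  "hermitian_pd M \<longleftrightarrow> cadj M = M \<and>
     (\<forall>v::complex^'r. v \<noteq> 0 \<longrightarrow> 0 < Re (\<Sum>i\<in>UNIV. \<Sum>j\<in>UNIV. cnj (v $ i) * M $ i $ j * v $ j))"

definition mat_dd :: "'k \<Rightarrow> (('k \<Rightarrow> complex) \<Rightarrow> complex^'c^'d) \<Rightarrow> ('k \<Rightarrow> complex) \<Rightarrow> complex^'c^'d" where
  "mat_dd k M p = (\<chi> i j. dd k (\<lambda>q. M q $ i $ j) p)"

definition mat_ddbar :: "'k \<Rightarrow> (('k \<Rightarrow> complex) \<Rightarrow> complex^'c^'d) \<Rightarrow> ('k \<Rightarrow> complex) \<Rightarrow> complex^'c^'d" where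
  "mat_ddbar k M p = (\<chi> i j. ddbar k (\<lambda>q. M q $ i $ j) p)"


section \<open>Differential forms at a point\<close>

text \<open>
  A form at a point is an alternating function of lists of (real) tangent vectors, which are given
  by their complex components; a \<open>k\<close>-form vanishes on lists of length other than \<open>k\<close>.  The wedge
  product is the sum over shuffles without a factorial factor, so that
  \<open>(\<alpha> \<and> \<beta>)(v,w) = \<alpha>(v)\<beta>(w) - \<alpha>(w)\<beta>(v)\<close> for 1-forms.  The argument \<open>mul\<close> is the product of the
  coefficients (for instance the product of matrices).
\<close>

definition shuffle_sign :: "nat \<Rightarrow> nat set \<Rightarrow> real" where
  "shuffle_sign m I = (-1) ^ card {(i, j). i \<in> I \<and> j \<in> {..<m} - I \<and> j < i}"

definition wedge_by :: "('b \<Rightarrow> 'c \<Rightarrow> 'd::real_vector) \<Rightarrow> ('v list \<Rightarrow> 'b) \<Rightarrow> ('v list \<Rightarrow> 'c) \<Rightarrow> 'v list \<Rightarrow> 'd" where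
  "wedge_by mul \<alpha> \<beta> vs =
     (\<Sum>I\<in>Pow {..<length vs}. shuffle_sign (length vs) I *\<^sub>R mul (\<alpha> (nths vs I)) (\<beta> (nths vs (- I))))"

abbreviation wedge :: "('v list \<Rightarrow> complex) \<Rightarrow> ('v list \<Rightarrow> complex) \<Rightarrow> 'v list \<Rightarrow> complex" where
  "wedge \<equiv> wedge_by (*)"

primrec wedge_pow :: "('v list \<Rightarrow> complex) \<Rightarrow> nat \<Rightarrow> 'v list \<Rightarrow> complex" where
  "wedge_pow \<omega> 0 = (\<lambda>vs. if vs = [] then 1 else 0)"
| "wedge_pow \<omega> (Suc m) = wedge \<omega> (wedge_pow \<omega> m)"

definition dz :: "'k \<Rightarrow> ('k \<Rightarrow> complex) list \<Rightarrow> complex" where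
  "dz k vs = (if length vs = 1 then hd vs k else 0)"

definition dzbar :: "'k \<Rightarrow> ('k \<Rightarrow> complex) list \<Rightarrow> complex" where
  "dzbar k vs = (if length vs = 1 then cnj (hd vs k) else 0)"

text \<open>The form \<open>\<i> \<Sum> g\<^bsub>\<alpha>\<beta>\<^esub> dz\<^bsup>\<alpha>\<^esup> \<and> dzbar\<^bsup>\<beta>\<^esup>\<close>; with \<open>\<iota> = Inl\<close> it is the pull-back to a product.\<close>

definition kaehler_form :: "('n \<Rightarrow> 'k) \<Rightarrow> complex^'n^'n \<Rightarrow> ('k \<Rightarrow> complex) list \<Rightarrow> complex" where
  "kaehler_form \<iota> G vs =
     (\<Sum>\<alpha>\<in>UNIV. \<Sum>\<beta>\<in>UNIV. \<i> * G $ \<alpha> $ \<beta> * wedge (dz (\<iota> \<alpha>)) (dzbar (\<iota> \<beta>)) vs)"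

text \<open>\<open>\<omega>\<^bsup>m\<^esup> / m!\<close>\<close>

definition kaehler_pow :: "('n::finite \<Rightarrow> 'k) \<Rightarrow> complex^'n^'n \<Rightarrow> nat \<Rightarrow> ('k \<Rightarrow> complex) list \<Rightarrow> complex" where
  "kaehler_pow \<iota> G m vs = wedge_pow (kaehler_form \<iota> G) m vs / fact m"

definition del_delbar :: "nat \<Rightarrow> ((nat \<Rightarrow> complex) \<Rightarrow> complex) \<Rightarrow> (nat \<Rightarrow> complex) \<Rightarrow> (nat \<Rightarrow> complex) list \<Rightarrow> complex" where
  "del_delbar N f y vs = (\<Sum>i<N. \<Sum>j<N. dd i (ddbar j f) y * wedge (dz i) (dzbar j) vs)"


section \<open>Chern connection and curvature\<close>

text \<open>
  The matrix \<open>H\<close> of a Hermitian metric in a holomorphic frame \<open>e\<^sub>1, \<dots>, e\<^sub>r\<close> is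
  \<open>H $ i $ j = \<langle>e\<^sub>j, e\<^sub>i\<rangle>\<close>, so that \<open>\<langle>\<xi>, \<eta>\<rangle> = \<eta>\<^sup>* H \<xi>\<close> for coordinate columns.  Homomorphisms act on
  columns from the left.  In this convention the connection form is \<open>H\<^bsup>-1\<^esup> \<partial>H\<close>; for the transposed
  matrix \<open>h = H\<^sup>T\<close>, which belongs to coordinate rows, it becomes the transpose of \<open>\<partial>h h\<^bsup>-1\<^esup>\<close>.  Both
  describe the same \<open>End\<close>-valued curvature form.
\<close>

definition conn :: "(('k \<Rightarrow> complex) \<Rightarrow> complex^'r^'r) \<Rightarrow> 'k \<Rightarrow> ('k \<Rightarrow> complex) \<Rightarrow> complex^'r^'r" where
  "conn H k p = matrix_inv (H p) ** mat_dd k H p"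

text \<open>\<open>\<Omega> = \<partial>bar (\<Sum>\<^sub>k A\<^sub>k d\<zeta>\<^sup>k) = \<Sum>\<^sub>k\<^sub>l (\<partial>bar\<^sub>l A\<^sub>k) d\<zeta>bar\<^sup>l \<and> d\<zeta>\<^sup>k\<close> with \<open>A\<^sub>k = conn H k\<close>\<close>

definition curvature_form ::
  "'k set \<Rightarrow> (('k \<Rightarrow> complex) \<Rightarrow> complex^'r^'r) \<Rightarrow> ('k \<Rightarrow> complex) \<Rightarrow> ('k \<Rightarrow> complex) list \<Rightarrow> complex^'r^'r" where
  "curvature_form I H p vs =
     (\<Sum>k\<in>I. \<Sum>l\<in>I. csm (wedge (dzbar l) (dz k) vs) (mat_ddbar l (conn H k) p))"

text \<open>The component \<open>R\<^sub>k\<^sub>l\<close>, i.e. the coefficient of \<open>d\<zeta>\<^sup>k \<and> d\<zeta>bar\<^sup>l\<close> in the curvature form; the sign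
  comes from \<open>d\<zeta>bar\<^sup>l \<and> d\<zeta>\<^sup>k = - d\<zeta>\<^sup>k \<and> d\<zeta>bar\<^sup>l\<close>.\<close>

definition curv_coeff :: "(('k \<Rightarrow> complex) \<Rightarrow> complex^'r^'r) \<Rightarrow> 'k \<Rightarrow> 'k \<Rightarrow> ('k \<Rightarrow> complex) \<Rightarrow> complex^'r^'r" where
  "curv_coeff H k l p = - mat_ddbar l (conn H k) p"

text \<open>The adjoint of \<open>F : E\<^sub>2 \<rightarrow> E\<^sub>1\<close> with respect to metrics \<open>H1\<close>, \<open>H2\<close>.\<close>

definition metric_adj :: "complex^'r1^'r1 \<Rightarrow> complex^'r2^'r2 \<Rightarrow> complex^'r2^'r1 \<Rightarrow> complex^'r1^'r2" where
  "metric_adj H1 H2 F = matrix_inv H2 ** cadj F ** H1"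

text \<open>Covariant derivative of a section of \<open>Hom(E\<^sub>2, E\<^sub>1)\<close> along \<open>\<partial>/\<partial>\<zeta>\<^sup>k\<close>.\<close>

definition hom_cov ::
  "(('k \<Rightarrow> complex) \<Rightarrow> complex^'r1^'r1) \<Rightarrow> (('k \<Rightarrow> complex) \<Rightarrow> complex^'r2^'r2) \<Rightarrow>
   (('k \<Rightarrow> complex) \<Rightarrow> complex^'r2^'r1) \<Rightarrow> 'k \<Rightarrow> ('k \<Rightarrow> complex) \<Rightarrow> complex^'r2^'r1" where
  "hom_cov H1 H2 F k p = mat_dd k F p + conn H1 k p ** F p - F p ** conn H2 k p"

text \<open>
  Pointwise Hermitian inner product of the (1,1)-forms with coefficients \<open>a\<close>, \<open>b\<close> with respect to
  \<open>dz\<^bsup>\<alpha>\<^esup> \<and> dzbar\<^bsup>\<beta>\<^esup>\<close>.  Note \<open>matrix_inv G $ \<beta> $ \<alpha> = g\<^bsup>\<beta>bar \<alpha>\<^esup>\<close>.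
\<close>

definition inner11 :: "complex^'n^'n \<Rightarrow> complex^'n^'n \<Rightarrow> complex^'n^'n \<Rightarrow> complex" where
  "inner11 G a b = (\<Sum>\<alpha>\<in>UNIV. \<Sum>\<beta>\<in>UNIV. \<Sum>\<gamma>\<in>UNIV. \<Sum>\<delta>\<in>UNIV.
     matrix_inv G $ \<gamma> $ \<alpha> * matrix_inv G $ \<beta> $ \<delta> * a $ \<alpha> $ \<beta> * cnj (b $ \<gamma> $ \<delta>))"

text \<open>\<open>\<Lambda>\<close> on (1,1)-forms: the pointwise adjoint of \<open>f \<mapsto> f \<cdot> \<omega>\<close>, where \<open>\<omega>\<close> has coefficients \<open>\<i> G\<close>.\<close>

definition Lambda11 :: "complex^'n^'n \<Rightarrow> complex^'n^'n \<Rightarrow> complex" where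
  "Lambda11 G a = (THE c. \<forall>f. inner11 G (csm (f * \<i>) G) a = f * cnj c)"

definition Lambda_mat :: "complex^'n^'n \<Rightarrow> ('n \<Rightarrow> 'n \<Rightarrow> complex^'r^'r) \<Rightarrow> complex^'r^'r" where
  "Lambda_mat G R = (\<chi> i j. Lambda11 G (\<chi> \<alpha> \<beta>. R \<alpha> \<beta> $ i $ j))"


section \<open>Complex manifolds, Kaehler metrics and integration\<close>

type_synonym ('x, 'n) chart = "'x set \<times> ('x \<Rightarrow> 'n \<Rightarrow> complex)"

definition chart_inv :: "('x, 'n) chart \<Rightarrow> ('n \<Rightarrow> complex) \<Rightarrow> 'x" where
  "chart_inv C = inv_into (fst C) (snd C)"

definition complex_manifold :: "('x::topological_space, 'n) chart set \<Rightarrow> bool" where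
  "complex_manifold AX \<longleftrightarrow>
     (\<forall>C\<in>AX. open (fst C) \<and> copen UNIV (snd C ` fst C) \<and>
        homeomorphism (fst C) (snd C ` fst C) (snd C) (chart_inv C)) \<and>
     (\<Union>C\<in>AX. fst C) = UNIV \<and>
     (\<forall>C\<in>AX. \<forall>C'\<in>AX. \<forall>\<alpha>.
        hol UNIV (snd C ` (fst C \<inter> fst C')) (\<lambda>z. snd C' (chart_inv C z) \<alpha>))"

definition holo_X :: "('x, 'n) chart set \<Rightarrow> 'x set \<Rightarrow> ('x \<Rightarrow> complex) \<Rightarrow> bool" where
  "holo_X AX U f \<longleftrightarrow> (\<forall>C\<in>AX. hol UNIV (snd C ` (fst C \<inter> U)) (\<lambda>z. f (chart_inv C z)))"

definition smooth_X :: "('x, 'n) chart set \<Rightarrow> 'x set \<Rightarrow> ('x \<Rightarrow> complex) \<Rightarrow> bool" where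
  "smooth_X AX U f \<longleftrightarrow> (\<forall>C\<in>AX. smooth UNIV (snd C ` (fst C \<inter> U)) (\<lambda>z. f (chart_inv C z)))"

text \<open>
  \<open>g C z $ \<alpha> $ \<beta>\<close> is the component \<open>g\<^bsub>\<alpha>\<beta>bar\<^esub>\<close> with respect to the chart \<open>C\<close> at the point with
  coordinates \<open>z\<close>.  The last condition is \<open>d\<omega> = 0\<close>; since \<open>g\<close> is Hermitian, \<open>\<partial>\<omega> = 0\<close> suffices.
\<close>

definition kaehler_metric ::
  "('x, 'n::finite) chart set \<Rightarrow> (('x, 'n) chart \<Rightarrow> ('n \<Rightarrow> complex) \<Rightarrow> complex^'n^'n) \<Rightarrow> bool" where
  "kaehler_metric AX g \<longleftrightarrow>
     (\<forall>C\<in>AX. \<forall>\<alpha> \<beta>. smooth UNIV (snd C ` fst C) (\<lambda>z. g C z $ \<alpha> $ \<beta>)) \<and>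
     (\<forall>C\<in>AX. \<forall>z\<in>snd C ` fst C. hermitian_pd (g C z)) \<and>
     (\<forall>C\<in>AX. \<forall>C'\<in>AX. \<forall>x\<in>fst C \<inter> fst C'. \<forall>\<alpha> \<beta>.
        g C (snd C x) $ \<alpha> $ \<beta> =
          (\<Sum>\<gamma>\<in>UNIV. \<Sum>\<delta>\<in>UNIV. g C' (snd C' x) $ \<gamma> $ \<delta> *
             dd \<alpha> (\<lambda>z. snd C' (chart_inv C z) \<gamma>) (snd C x) *
             cnj (dd \<beta> (\<lambda>z. snd C' (chart_inv C z) \<delta>) (snd C x)))) \<and>
     (\<forall>C\<in>AX. \<forall>z\<in>snd C ` fst C. \<forall>\<alpha> \<beta> \<gamma>.
        dd \<gamma> (\<lambda>w. g C w $ \<alpha> $ \<beta>) z = dd \<alpha> (\<lambda>w. g C w $ \<gamma> $ \<beta>) z)"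

text \<open>A positively oriented real frame \<open>\<partial>/\<partial>x\<^sup>1, \<partial>/\<partial>y\<^sup>1, \<partial>/\<partial>x\<^sup>2, \<dots>\<close> of the coordinate space; the order of
  the complex coordinates does not affect the orientation.\<close>

definition coord_list :: "'n::finite list" where
  "coord_list = (SOME l. distinct l \<and> set l = UNIV)"

definition frame_X :: "('n::finite \<Rightarrow> complex) list" where
  "frame_X = concat (map (\<lambda>\<alpha>. [(\<lambda>_. 0)(\<alpha> := 1), (\<lambda>_. 0)(\<alpha> := \<i>)]) coord_list)"

text \<open>Lebesgue integral of \<open>\<rho> f\<close> over the image of \<open>P\<close> in the chart \<open>C\<close>.\<close>

definition chart_integral ::
  "('x, 'n::finite) chart \<Rightarrow> 'x set \<Rightarrow> ('x \<Rightarrow> real) \<Rightarrow> (('n \<Rightarrow> complex) \<Rightarrow> complex) \<Rightarrow> complex" where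
  "chart_integral C P \<rho> f =
     (LINT z:{z::complex^'n. ($) z \<in> snd C ` P}|lborel. of_real (\<rho> (chart_inv C (($) z))) * f (($) z))"

text \<open>A finite partition of unity \<open>\<rho>\<close> with supports inside the coordinate domains \<open>P k\<close>.\<close>

definition partition_of_unity ::
  "('x::topological_space, 'n) chart set \<Rightarrow> nat \<Rightarrow> (nat \<Rightarrow> ('x, 'n) chart) \<Rightarrow> (nat \<Rightarrow> 'x set) \<Rightarrow> (nat \<Rightarrow> 'x \<Rightarrow> real) \<Rightarrow> bool" where
  "partition_of_unity AX m C P \<rho> \<longleftrightarrow>
     (\<forall>k<m. C k \<in> AX \<and> open (P k) \<and> P k \<subseteq> fst (C k) \<and> continuous_on UNIV (\<rho> k) \<and>
        (\<forall>x. 0 \<le> \<rho> k x) \<and> closure {x. \<rho> k x \<noteq> 0} \<subseteq> P k) \<and>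
     (\<forall>x. (\<Sum>k<m. \<rho> k x) = 1)"

text \<open>The integral over a compact manifold of a form \<open>\<eta>\<close> of top degree, which is given in every chart
  and transforms accordingly; the value does not depend on the chosen partition of unity.\<close>

definition integral_X ::
  "('x::topological_space, 'n::finite) chart set \<Rightarrow>
   (('x, 'n) chart \<Rightarrow> ('n \<Rightarrow> complex) \<Rightarrow> ('n \<Rightarrow> complex) list \<Rightarrow> complex) \<Rightarrow> complex" where
  "integral_X AX \<eta> =
     (let (m, C, P, \<rho>) = (SOME (m, C, P, \<rho>). partition_of_unity AX m C P \<rho>)
      in \<Sum>k<m. chart_integral (C k) (P k) (\<rho> k) (\<lambda>z. \<eta> (C k) z frame_X))"

definition total_volume ::
  "('x::topological_space, 'n::finite) chart set \<Rightarrow> (('x, 'n) chart \<Rightarrow> ('n \<Rightarrow> complex) \<Rightarrow> complex^'n^'n) \<Rightarrow> complex" where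
  "total_volume AX g = integral_X AX (\<lambda>C z. kaehler_pow id (g C z) CARD('n))"


section \<open>Reduced complex spaces\<close>

definition analytic_subset :: "'k set \<Rightarrow> ('k \<Rightarrow> complex) set \<Rightarrow> ('k \<Rightarrow> complex) set \<Rightarrow> bool" where
  "analytic_subset I U A \<longleftrightarrow> A \<subseteq> U \<and>
     (\<forall>p\<in>U. \<exists>\<Omega> F. copen I \<Omega> \<and> p \<in> \<Omega> \<and> \<Omega> \<subseteq> U \<and> finite F \<and> (\<forall>f\<in>F. hol I \<Omega> f) \<and>
        A \<inter> \<Omega> = {q\<in>\<Omega>. \<forall>f\<in>F. f q = 0})"

text \<open>
  A chart \<open>(N, D, \<kappa>)\<close> identifies the open set \<open>D\<close> with an analytic subset of an open subset of
  the \<open>N\<close>-dimensional coordinate space.  As the spaces are reduced, the structure sheaf consists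
  of the functions that are locally restrictions of holomorphic functions of the ambient coordinates,
  and it suffices to require that coordinate changes are locally restrictions of holomorphic maps.
\<close>

type_synonym 's schart = "nat \<times> 's set \<times> ('s \<Rightarrow> nat \<Rightarrow> complex)"

definition reduced_complex_space :: "('s::topological_space) schart set \<Rightarrow> bool" where
  "reduced_complex_space AS \<longleftrightarrow>
     (\<forall>(N, D, \<kappa>)\<in>AS. open D \<and> homeomorphism D (\<kappa> ` D) \<kappa> (inv_into D \<kappa>) \<and>
        (\<exists>U. copen {..<N} U \<and> analytic_subset {..<N} U (\<kappa> ` D))) \<and>
     (\<Union>(N, D, \<kappa>)\<in>AS. D) = UNIV \<and>
     (\<forall>(N, D, \<kappa>)\<in>AS. \<forall>(N', D', \<kappa>')\<in>AS. \<forall>s\<in>D \<inter> D'. \<exists>\<Omega> \<theta>.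
        copen {..<N} \<Omega> \<and> \<kappa> s \<in> \<Omega> \<and> (\<forall>i<N'. hol {..<N} \<Omega> (\<lambda>y. \<theta> y i)) \<and>
        (\<forall>t\<in>D \<inter> D'. \<kappa> t \<in> \<Omega> \<longrightarrow> \<kappa>' t = \<theta> (\<kappa> t)))"

text \<open>Functions on \<open>X \<times> S\<close> that are locally restrictions of ambient functions with property \<open>R\<close>.\<close>

definition locally_restricted ::
  "(('n + nat) set \<Rightarrow> ('n + nat \<Rightarrow> complex) set \<Rightarrow> (('n + nat \<Rightarrow> complex) \<Rightarrow> complex) \<Rightarrow> bool) \<Rightarrow>
   ('x, 'n) chart set \<Rightarrow> 's schart set \<Rightarrow> ('x \<times> 's) set \<Rightarrow> ('x \<times> 's \<Rightarrow> complex) \<Rightarrow> bool" where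
  "locally_restricted R AX AS W f \<longleftrightarrow>
     (\<forall>(x, s)\<in>W. \<exists>(V, c)\<in>AX. \<exists>(N, D, \<kappa>)\<in>AS. x \<in> V \<and> s \<in> D \<and>
        (\<exists>\<Omega> F. copen (UNIV <+> {..<N}) \<Omega> \<and> case_sum (c x) (\<kappa> s) \<in> \<Omega> \<and> R (UNIV <+> {..<N}) \<Omega> F \<and>
           (\<forall>x' s'. (x', s') \<in> W \<and> x' \<in> V \<and> s' \<in> D \<and> case_sum (c x') (\<kappa> s') \<in> \<Omega> \<longrightarrow>
              f (x', s') = F (case_sum (c x') (\<kappa> s')))))"

definition holo_XS :: "('x, 'n) chart set \<Rightarrow> 's schart set \<Rightarrow> ('x \<times> 's) set \<Rightarrow> ('x \<times> 's \<Rightarrow> complex) \<Rightarrow> bool" where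
  "holo_XS = locally_restricted hol"

definition smooth_XS :: "('x, 'n) chart set \<Rightarrow> 's schart set \<Rightarrow> ('x \<times> 's) set \<Rightarrow> ('x \<times> 's \<Rightarrow> complex) \<Rightarrow> bool" where
  "smooth_XS = locally_restricted smooth"


section \<open>Holomorphic vector bundles\<close>

text \<open>
  Bundles are given by holomorphic cocycles with respect to an open cover \<open>W\<close>: coordinate columns
  of sections satisfy \<open>\<xi>\<^sub>a = T a b \<xi>\<^sub>b\<close>.  The parameter \<open>holf\<close> is the sheaf of holomorphic (and
  \<open>smf\<close> the sheaf of smooth) functions of the base space.
\<close>

definition hol_bundle ::
  "(('y::topological_space) set \<Rightarrow> ('y \<Rightarrow> complex) \<Rightarrow> bool) \<Rightarrow> ('a \<Rightarrow> 'y set) \<Rightarrow>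
   ('a \<Rightarrow> 'a \<Rightarrow> 'y \<Rightarrow> complex^'r^'r) \<Rightarrow> bool" where
  "hol_bundle holf W T \<longleftrightarrow>
     (\<forall>a. open (W a)) \<and> (\<Union>a. W a) = UNIV \<and>
     (\<forall>a b i j. holf (W a \<inter> W b) (\<lambda>p. T a b p $ i $ j)) \<and>
     (\<forall>a. \<forall>p\<in>W a. T a a p = mat 1) \<and>
     (\<forall>a b c. \<forall>p\<in>W a \<inter> W b \<inter> W c. T a b p ** T b c p = T a c p)"

definition hermitian_metric ::
  "(('y::topological_space) set \<Rightarrow> ('y \<Rightarrow> complex) \<Rightarrow> bool) \<Rightarrow> ('a \<Rightarrow> 'y set) \<Rightarrow>
   ('a \<Rightarrow> 'a \<Rightarrow> 'y \<Rightarrow> complex^'r^'r) \<Rightarrow> ('a \<Rightarrow> 'y \<Rightarrow> complex^'r^'r) \<Rightarrow> bool" where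
  "hermitian_metric smf W T h \<longleftrightarrow>
     (\<forall>a i j. smf (W a) (\<lambda>p. h a p $ i $ j)) \<and>
     (\<forall>a. \<forall>p\<in>W a. hermitian_pd (h a p)) \<and>
     (\<forall>a b. \<forall>p\<in>W a \<inter> W b. h b p = cadj (T a b p) ** h a p ** T a b p)"

definition hol_hom ::
  "(('y::topological_space) set \<Rightarrow> ('y \<Rightarrow> complex) \<Rightarrow> bool) \<Rightarrow> ('a \<Rightarrow> 'y set) \<Rightarrow>
   ('a \<Rightarrow> 'a \<Rightarrow> 'y \<Rightarrow> complex^'r1^'r1) \<Rightarrow> ('a \<Rightarrow> 'a \<Rightarrow> 'y \<Rightarrow> complex^'r2^'r2) \<Rightarrow>
   ('a \<Rightarrow> 'y \<Rightarrow> complex^'r2^'r1) \<Rightarrow> bool" where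
  "hol_hom holf W T1 T2 \<Phi> \<longleftrightarrow>
     (\<forall>a i j. holf (W a) (\<lambda>p. \<Phi> a p $ i $ j)) \<and>
     (\<forall>a b. \<forall>p\<in>W a \<inter> W b. \<Phi> a p ** T2 a b p = T1 a b p ** \<Phi> b p)"

text \<open>The degree of a bundle on \<open>X\<close>; \<open>(\<i>/2\<pi>) tr \<Omega>\<close> represents the first Chern class for any
  Hermitian metric.\<close>

definition bundle_degree ::
  "('x::topological_space, 'n::finite) chart set \<Rightarrow> (('x, 'n) chart \<Rightarrow> ('n \<Rightarrow> complex) \<Rightarrow> complex^'n^'n) \<Rightarrow>
   ('a \<Rightarrow> 'x set) \<Rightarrow> ('a \<Rightarrow> 'a \<Rightarrow> 'x \<Rightarrow> complex^'r^'r) \<Rightarrow> real" where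
  "bundle_degree AX g W T = (THE d. \<exists>h. hermitian_metric (smooth_X AX) W T h \<and>
     complex_of_real d = integral_X AX (\<lambda>C z.
       (let a = (SOME a. chart_inv C z \<in> W a) in
        wedge (\<lambda>vs. \<i> / (2 * of_real pi) *
                 trace (curvature_form UNIV (\<lambda>w. h a (chart_inv C w)) z vs))
              (kaehler_pow id (g C z) (CARD('n) - 1)))))"


section \<open>Coherent subsheaves and stability\<close>

text \<open>A section over \<open>U\<close> of a bundle on \<open>X\<close> is the family of its coordinate columns; only the values
  of the \<open>a\<close>-th member on \<open>U \<inter> W a\<close> matter.\<close>

definition hol_section ::
  "('x, 'n) chart set \<Rightarrow> ('a \<Rightarrow> 'x set) \<Rightarrow> ('a \<Rightarrow> 'a \<Rightarrow> 'x \<Rightarrow> complex^'r^'r) \<Rightarrow> 'x set \<Rightarrow>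
   ('a \<Rightarrow> 'x \<Rightarrow> complex^'r) \<Rightarrow> bool" where
  "hol_section AX W T U \<sigma> \<longleftrightarrow>
     (\<forall>a i. holo_X AX (U \<inter> W a) (\<lambda>x. \<sigma> a x $ i)) \<and>
     (\<forall>a b. \<forall>x\<in>U \<inter> W a \<inter> W b. \<sigma> a x = T a b x *v \<sigma> b x)"

definition generates ::
  "('x::topological_space, 'n) chart set \<Rightarrow> ('a \<Rightarrow> 'x set) \<Rightarrow> ('x set \<Rightarrow> ('a \<Rightarrow> 'x \<Rightarrow> complex^'r) set) \<Rightarrow>
   'x set \<Rightarrow> ('a \<Rightarrow> 'x \<Rightarrow> complex^'r) list \<Rightarrow> bool" where
  "generates AX W F V \<sigma>s \<longleftrightarrow> set \<sigma>s \<subseteq> F V \<and>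
     (\<forall>V' \<tau> y. open V' \<and> V' \<subseteq> V \<and> \<tau> \<in> F V' \<and> y \<in> V' \<longrightarrow>
        (\<exists>V'' f. open V'' \<and> y \<in> V'' \<and> V'' \<subseteq> V' \<and> (\<forall>i<length \<sigma>s. holo_X AX V'' (f i)) \<and>
           (\<forall>a. \<forall>x\<in>V'' \<inter> W a. \<tau> a x = (\<Sum>i<length \<sigma>s. f i x *s (\<sigma>s ! i) a x))))"

text \<open>
  \<open>F U\<close> is the set of sections over the open set \<open>U\<close> of a subsheaf of modules of the sheaf of
  holomorphic sections of the bundle.  Such a subsheaf is coherent if and only if it is locally
  finitely generated (Oka), and it is automatically torsion free.
\<close>

definition coherent_subsheaf ::
  "('x::topological_space, 'n) chart set \<Rightarrow> ('a \<Rightarrow> 'x set) \<Rightarrow> ('a \<Rightarrow> 'a \<Rightarrow> 'x \<Rightarrow> complex^'r^'r) \<Rightarrow>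
   ('x set \<Rightarrow> ('a \<Rightarrow> 'x \<Rightarrow> complex^'r) set) \<Rightarrow> bool" where
  "coherent_subsheaf AX W T F \<longleftrightarrow>
     (\<forall>U. open U \<longrightarrow>
        (\<forall>\<sigma>\<in>F U. hol_section AX W T U \<sigma>) \<and>
        (\<lambda>a x. 0) \<in> F U \<and>
        (\<forall>\<sigma>\<in>F U. \<forall>\<tau>\<in>F U. (\<lambda>a x. \<sigma> a x + \<tau> a x) \<in> F U) \<and>
        (\<forall>\<sigma>\<in>F U. \<forall>f. holo_X AX U f \<longrightarrow> (\<lambda>a x. f x *s \<sigma> a x) \<in> F U) \<and>
        (\<forall>\<sigma>\<in>F U. \<forall>\<tau>. (\<forall>a. \<forall>x\<in>U \<inter> W a. \<tau> a x = \<sigma> a x) \<longrightarrow> \<tau> \<in> F U) \<and>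
        (\<forall>\<sigma>\<in>F U. \<forall>V. open V \<and> V \<subseteq> U \<longrightarrow> \<sigma> \<in> F V)) \<and>
     (\<forall>\<U> \<sigma>. (\<forall>U\<in>\<U>. open U \<and> \<sigma> \<in> F U) \<longrightarrow> \<sigma> \<in> F (\<Union>\<U>)) \<and>
     (\<forall>x. \<exists>V \<sigma>s. open V \<and> x \<in> V \<and> generates AX W F V \<sigma>s)"

text \<open>The rank at a generic point, where the dimension of the space of values is maximal.\<close>

definition sheaf_rank ::
  "('a \<Rightarrow> ('x::topological_space) set) \<Rightarrow> ('x set \<Rightarrow> ('a \<Rightarrow> 'x \<Rightarrow> complex^'r) set) \<Rightarrow> nat" where
  "sheaf_rank W F =
     Max {vec.dim {\<sigma> a x |\<sigma> U. open U \<and> x \<in> U \<and> \<sigma> \<in> F U} |a x. x \<in> W a}"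

text \<open>
  Analytic subsets of \<open>X\<close> of codimension at least 2.  Every holomorphic coordinate system in which a
  nonempty piece of the set is given by the vanishing of some of the coordinates must use at least
  two of them (the regular points of an analytic set are dense).
\<close>

definition codim_ge_2 :: "('x::topological_space, 'n::finite) chart set \<Rightarrow> 'x set \<Rightarrow> bool" where
  "codim_ge_2 AX Z \<longleftrightarrow>
     (\<forall>x. \<exists>V F. open V \<and> x \<in> V \<and> finite F \<and> (\<forall>f\<in>F. holo_X AX V f) \<and>
        Z \<inter> V = {y\<in>V. \<forall>f\<in>F. f y = 0}) \<and>
     (\<forall>V c J. complex_manifold (insert (V, c) AX) \<and> Z \<inter> V \<noteq> {} \<and>
        Z \<inter> V = {x\<in>V. \<forall>\<alpha>\<in>J. c x \<alpha> = 0} \<longrightarrow> 2 \<le> card J)"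

text \<open>Components of \<open>v\<^sub>0 \<and> \<dots> \<and> v\<^bsub>k-1\<^esub>\<close>: the minor with the rows \<open>is\<close>.\<close>

definition exterior_component :: "(complex^'r) list \<Rightarrow> 'r list \<Rightarrow> complex" where
  "exterior_component vs is =
     (\<Sum>p | p permutes {..<length vs}. of_int (sign p) * (\<Prod>i<length vs. (vs ! i) $ (is ! p i)))"

text \<open>
  The determinant bundle \<open>det F = (\<And>\<^sup>k F)\<^sup>*\<^sup>*\<close>, \<open>k = rk F\<close>: the line bundle that agrees with \<open>\<And>\<^sup>k F\<close>
  outside an analytic set \<open>Z\<close> of codimension at least 2 with \<open>F\<close> locally free outside \<open>Z\<close>.  The line
  bundle is given by a cocycle \<open>t\<close> on a cover \<open>L\<close> indexed by the points of \<open>X\<close>;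
  \<open>j y a x is\<close> are the components of the image in \<open>\<And>\<^sup>k E\<close> of its \<open>y\<close>-th local frame, which has to
  equal \<open>\<sigma>\<^sub>1 \<and> \<dots> \<and> \<sigma>\<^sub>k\<close> for a local frame \<open>\<sigma>\<^sub>1, \<dots>, \<sigma>\<^sub>k\<close> of \<open>F\<close>.
\<close>

definition det_bundle ::
  "('x::topological_space, 'n::finite) chart set \<Rightarrow> ('a \<Rightarrow> 'x set) \<Rightarrow> ('x set \<Rightarrow> ('a \<Rightarrow> 'x \<Rightarrow> complex^'r) set) \<Rightarrow>
   ('x \<Rightarrow> 'x set) \<Rightarrow> ('x \<Rightarrow> 'x \<Rightarrow> 'x \<Rightarrow> complex^1^1) \<Rightarrow> bool" where
  "det_bundle AX W F L t \<longleftrightarrow> hol_bundle (holo_X AX) L t \<and>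
     (\<exists>Z j. codim_ge_2 AX Z \<and>
        (\<forall>y. \<forall>x\<in>L y - Z. \<exists>V \<sigma>s. open V \<and> x \<in> V \<and> V \<subseteq> L y \<and>
           length \<sigma>s = sheaf_rank W F \<and> generates AX W F V \<sigma>s \<and>
           (\<forall>a. \<forall>x'\<in>V \<inter> W a. \<forall>is. length is = sheaf_rank W F \<longrightarrow>
              j y a x' is = exterior_component (map (\<lambda>\<sigma>. \<sigma> a x') \<sigma>s) is)) \<and>
        (\<forall>y y' a. \<forall>x\<in>L y \<inter> L y' \<inter> W a - Z. \<forall>is. length is = sheaf_rank W F \<longrightarrow>
           j y' a x is = t y y' x $ 1 $ 1 * j y a x is))"

definition sheaf_degree ::
  "('x::topological_space, 'n::finite) chart set \<Rightarrow> (('x, 'n) chart \<Rightarrow> ('n \<Rightarrow> complex) \<Rightarrow> complex^'n^'n) \<Rightarrow>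
   ('a \<Rightarrow> 'x set) \<Rightarrow> ('x set \<Rightarrow> ('a \<Rightarrow> 'x \<Rightarrow> complex^'r) set) \<Rightarrow> real" where
  "sheaf_degree AX g W F = (THE d. \<exists>L t. det_bundle AX W F L t \<and> d = bundle_degree AX g L t)"

definition slope :: "real \<Rightarrow> real \<Rightarrow> real \<Rightarrow> nat \<Rightarrow> nat \<Rightarrow> real" where
  "slope \<alpha> d1 d2 k1 k2 = (d1 + d2 + \<alpha> * real k2) / real (k1 + k2)"

definition stable_triple ::
  "('x::topological_space, 'n::finite) chart set \<Rightarrow> (('x, 'n) chart \<Rightarrow> ('n \<Rightarrow> complex) \<Rightarrow> complex^'n^'n) \<Rightarrow>
   ('a \<Rightarrow> 'x set) \<Rightarrow> ('a \<Rightarrow> 'a \<Rightarrow> 'x \<Rightarrow> complex^'r1^'r1) \<Rightarrow> ('a \<Rightarrow> 'a \<Rightarrow> 'x \<Rightarrow> complex^'r2^'r2) \<Rightarrow>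
   ('a \<Rightarrow> 'x \<Rightarrow> complex^'r2^'r1) \<Rightarrow> real \<Rightarrow> bool" where
  "stable_triple AX g W T1 T2 \<phi> \<alpha> \<longleftrightarrow>
     (\<forall>F1 F2. coherent_subsheaf AX W T1 F1 \<and> coherent_subsheaf AX W T2 F2 \<and>
        (\<forall>U. open U \<longrightarrow> (\<forall>\<sigma>\<in>F2 U. (\<lambda>a x. \<phi> a x *v \<sigma> a x) \<in> F1 U)) \<and>
        0 < sheaf_rank W F1 + sheaf_rank W F2 \<and>
        sheaf_rank W F1 + sheaf_rank W F2 < CARD('r1) + CARD('r2) \<longrightarrow>
        slope \<alpha> (sheaf_degree AX g W F1) (sheaf_degree AX g W F2) (sheaf_rank W F1) (sheaf_rank W F2)
          < slope \<alpha> (bundle_degree AX g W T1) (bundle_degree AX g W T2) CARD('r1) CARD('r2))"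


section \<open>Families over the base space\<close>

definition stable_family ::
  "('x::topological_space, 'n::finite) chart set \<Rightarrow> (('x, 'n) chart \<Rightarrow> ('n \<Rightarrow> complex) \<Rightarrow> complex^'n^'n) \<Rightarrow>
   ('a \<Rightarrow> ('x \<times> 's) set) \<Rightarrow> ('a \<Rightarrow> 'a \<Rightarrow> 'x \<times> 's \<Rightarrow> complex^'r1^'r1) \<Rightarrow>
   ('a \<Rightarrow> 'a \<Rightarrow> 'x \<times> 's \<Rightarrow> complex^'r2^'r2) \<Rightarrow> ('a \<Rightarrow> 'x \<times> 's \<Rightarrow> complex^'r2^'r1) \<Rightarrow> real \<Rightarrow> bool" where
  "stable_family AX g W T1 T2 \<Phi> \<alpha> \<longleftrightarrow>
     (\<forall>s. stable_triple AX g (\<lambda>a. {x. (x, s) \<in> W a}) (\<lambda>a b x. T1 a b (x, s)) (\<lambda>a b x. T2 a b (x, s))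
            (\<lambda>a x. \<Phi> a (x, s)) \<alpha>)"

definition coupled_vortex ::
  "('x, 'n::finite) chart set \<Rightarrow> (('x, 'n) chart \<Rightarrow> ('n \<Rightarrow> complex) \<Rightarrow> complex^'n^'n) \<Rightarrow>
   ('a \<Rightarrow> ('x \<times> 's) set) \<Rightarrow> ('a \<Rightarrow> 'x \<times> 's \<Rightarrow> complex^'r1^'r1) \<Rightarrow> ('a \<Rightarrow> 'x \<times> 's \<Rightarrow> complex^'r2^'r2) \<Rightarrow>
   ('a \<Rightarrow> 'x \<times> 's \<Rightarrow> complex^'r2^'r1) \<Rightarrow> real \<Rightarrow> real \<Rightarrow> 's \<Rightarrow> bool" where
  "coupled_vortex AX g W h1 h2 \<Phi> \<tau>1 \<tau>2 s \<longleftrightarrow>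
     (\<forall>C\<in>AX. \<forall>a. \<forall>x\<in>fst C. (x, s) \<in> W a \<longrightarrow>
        (let z = snd C x; G = g C z;
             H1 = (\<lambda>w. h1 a (chart_inv C w, s)); H2 = (\<lambda>w. h2 a (chart_inv C w, s));
             \<phi> = \<Phi> a (x, s); \<phi>' = metric_adj (h1 a (x, s)) (h2 a (x, s)) \<phi>
         in csm \<i> (Lambda_mat G (\<lambda>\<alpha> \<beta>. curv_coeff H1 \<alpha> \<beta> z)) + \<phi> ** \<phi>' = mat (of_real \<tau>1) \<and>
            csm \<i> (Lambda_mat G (\<lambda>\<alpha> \<beta>. curv_coeff H2 \<alpha> \<beta> z)) - \<phi>' ** \<phi> = mat (of_real \<tau>2)))"

text \<open>
  Local representation of a family near a fibre.  The compact fibre is covered by finitely many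
  coordinate domains \<open>piece k\<close>, with charts \<open>coord k\<close> and a subordinate partition of unity \<open>weight k\<close>,
  such that the \<open>triv k\<close>-th trivialization of the bundles is defined on the product of \<open>piece k\<close> with
  the given piece of \<open>S\<close>.  There \<open>met1 k\<close>, \<open>met2 k\<close>, \<open>hmat k\<close> are the matrices of the metrics and
  of the homomorphism as functions of the coordinates of \<open>X\<close> and of the ambient coordinates of \<open>S\<close>.
\<close>

record ('x, 'n, 'a, 'r1::finite, 'r2::finite) local_rep =
  pieces :: nat
  coord :: "nat \<Rightarrow> ('x, 'n) chart"
  piece :: "nat \<Rightarrow> 'x set"
  weight :: "nat \<Rightarrow> 'x \<Rightarrow> real"
  triv :: "nat \<Rightarrow> 'a"
  met1 :: "nat \<Rightarrow> ('n + nat \<Rightarrow> complex) \<Rightarrow> complex^'r1^'r1"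
  met2 :: "nat \<Rightarrow> ('n + nat \<Rightarrow> complex) \<Rightarrow> complex^'r2^'r2"
  hmat :: "nat \<Rightarrow> ('n + nat \<Rightarrow> complex) \<Rightarrow> complex^'r2^'r1"

text \<open>
  \<open>U\<close> is an open subset of the ambient space of the chart \<open>(N, D, \<kappa>)\<close>.  If \<open>S\<close> is smooth and \<open>\<kappa>\<close> maps
  to an open set, \<open>met1\<close>, \<open>met2\<close>, \<open>hmat\<close> are just the coordinate expressions of the given data;
  in general they are local extensions of these to the ambient space.
\<close>

definition represents_family ::
  "('x::topological_space, 'n::finite) chart set \<Rightarrow> 's schart \<Rightarrow> (nat \<Rightarrow> complex) set \<Rightarrow> ('a \<Rightarrow> ('x \<times> 's) set) \<Rightarrow>
   ('a \<Rightarrow> 'x \<times> 's \<Rightarrow> complex^'r1^'r1) \<Rightarrow> ('a \<Rightarrow> 'x \<times> 's \<Rightarrow> complex^'r2^'r2) \<Rightarrow>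
   ('a \<Rightarrow> 'x \<times> 's \<Rightarrow> complex^'r2^'r1) \<Rightarrow> ('x, 'n, 'a, 'r1::finite, 'r2::finite) local_rep \<Rightarrow> bool" where
  "represents_family AX K U W h1 h2 \<Phi> R \<longleftrightarrow>
     (case K of (N, D, \<kappa>) \<Rightarrow>
      copen {..<N} U \<and> partition_of_unity AX (pieces R) (coord R) (piece R) (weight R) \<and>
      (\<forall>k<pieces R.
        (\<forall>x\<in>piece R k. \<forall>s\<in>D. \<kappa> s \<in> U \<longrightarrow>
           (let p = case_sum (snd (coord R k) x) (\<kappa> s) in
            (x, s) \<in> W (triv R k) \<and> met1 R k p = h1 (triv R k) (x, s) \<and>
            met2 R k p = h2 (triv R k) (x, s) \<and> hmat R k p = \<Phi> (triv R k) (x, s))) \<and>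
        (let I = UNIV <+> {..<N}; \<Omega> = {case_sum z y |z y. z \<in> snd (coord R k) ` piece R k \<and> y \<in> U} in
         (\<forall>i j. smooth I \<Omega> (\<lambda>p. met1 R k p $ i $ j)) \<and> (\<forall>p\<in>\<Omega>. hermitian_pd (met1 R k p)) \<and>
         (\<forall>i j. smooth I \<Omega> (\<lambda>p. met2 R k p $ i $ j)) \<and> (\<forall>p\<in>\<Omega>. hermitian_pd (met2 R k p)) \<and>
         (\<forall>i j. hol I \<Omega> (\<lambda>p. hmat R k p $ i $ j)))))"

text \<open>
  Integration along the fibre over the point with coordinates \<open>y\<close>: \<open>\<eta> k p\<close> is the value at \<open>p\<close> of a
  form on \<open>X \<times> S\<close> in the coordinates of the \<open>k\<close>-th piece.  Since the fibre has even real dimension, it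
  does not matter whether the tangent vectors of the base come first or last.
\<close>

definition fibre_integral ::
  "('x, 'n::finite, 'a, 'r1::finite, 'r2::finite) local_rep \<Rightarrow>
   (nat \<Rightarrow> ('n + nat \<Rightarrow> complex) \<Rightarrow> ('n + nat \<Rightarrow> complex) list \<Rightarrow> complex) \<Rightarrow>
   (nat \<Rightarrow> complex) \<Rightarrow> (nat \<Rightarrow> complex) list \<Rightarrow> complex" where
  "fibre_integral R \<eta> y us =
     (\<Sum>k<pieces R. chart_integral (coord R k) (piece R k) (weight R k)
        (\<lambda>z. \<eta> k (case_sum z y)
               (map (\<lambda>u. case_sum (\<lambda>_. 0) u) us @ map (\<lambda>e. case_sum e (\<lambda>_. 0)) frame_X)))"

text \<open>The matrix \<open>g\<^bsub>\<alpha>\<beta>bar\<^esub>\<close> on the \<open>k\<close>-th piece and the powers \<open>\<omega>\<^bsup>m\<^esup>/m!\<close> of the Kaehler form, pulled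
  back to \<open>X \<times> S\<close>.  In particular \<open>omega_pow g R CARD('n) k p\<close> is \<open>g dV\<close>.\<close>

definition metric_at ::
  "(('x, 'n) chart \<Rightarrow> ('n \<Rightarrow> complex) \<Rightarrow> complex^'n^'n) \<Rightarrow> ('x, 'n, 'a, 'r1::finite, 'r2::finite) local_rep \<Rightarrow>
   nat \<Rightarrow> ('n + nat \<Rightarrow> complex) \<Rightarrow> complex^'n^'n" where
  "metric_at g R k p = g (coord R k) (\<lambda>\<alpha>. p (Inl \<alpha>))"

definition omega_pow ::
  "(('x, 'n::finite) chart \<Rightarrow> ('n \<Rightarrow> complex) \<Rightarrow> complex^'n^'n) \<Rightarrow> ('x, 'n, 'a, 'r1::finite, 'r2::finite) local_rep \<Rightarrow>
   nat \<Rightarrow> nat \<Rightarrow> ('n + nat \<Rightarrow> complex) \<Rightarrow> ('n + nat \<Rightarrow> complex) list \<Rightarrow> complex" where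
  "omega_pow g R m k p = kaehler_pow Inl (metric_at g R k p) m"

text \<open>\<open>tr(\<Phi>\<^bsub>;i\<^esub> (\<Phi>\<^bsub>;j\<^esub>)\<^sup>*)\<close>\<close>

definition hom_density ::
  "('x, 'n, 'a, 'r1::finite, 'r2::finite) local_rep \<Rightarrow> nat \<Rightarrow> nat \<Rightarrow> nat \<Rightarrow> ('n + nat \<Rightarrow> complex) \<Rightarrow> complex" where
  "hom_density R i j k p =
     trace (hom_cov (met1 R k) (met2 R k) (hmat R k) (Inr i) p **
            metric_adj (met1 R k p) (met2 R k p) (hom_cov (met1 R k) (met2 R k) (hmat R k) (Inr j) p))"

text \<open>\<open>tr(g\<^bsup>\<beta>bar \<alpha>\<^esup> R\<^bsub>i \<beta>bar\<^esub> R\<^bsub>\<alpha> jbar\<^esub>)\<close>\<close>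

definition curv_density ::
  "complex^'n^'n \<Rightarrow> (('n + nat \<Rightarrow> complex) \<Rightarrow> complex^'r^'r) \<Rightarrow> nat \<Rightarrow> nat \<Rightarrow> ('n + nat \<Rightarrow> complex) \<Rightarrow> complex" where
  "curv_density G H i j p = trace (\<Sum>\<alpha>\<in>UNIV. \<Sum>\<beta>\<in>UNIV.
     csm (matrix_inv G $ \<beta> $ \<alpha>) (curv_coeff H (Inr i) (Inl \<beta>) p ** curv_coeff H (Inl \<alpha>) (Inr j) p))"

definition G_VM ::
  "(('x, 'n::finite) chart \<Rightarrow> ('n \<Rightarrow> complex) \<Rightarrow> complex^'n^'n) \<Rightarrow> ('x, 'n, 'a, 'r1::finite, 'r2::finite) local_rep \<Rightarrow>
   nat \<Rightarrow> nat \<Rightarrow> (nat \<Rightarrow> complex) \<Rightarrow> complex" where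
  "G_VM g R i j y =
     fibre_integral R (\<lambda>k p vs. hom_density R i j k p * omega_pow g R CARD('n) k p vs) y [] +
     fibre_integral R (\<lambda>k p vs. curv_density (metric_at g R k p) (met1 R k) i j p *
                                 omega_pow g R CARD('n) k p vs) y [] +
     fibre_integral R (\<lambda>k p vs. curv_density (metric_at g R k p) (met2 R k) i j p *
                                 omega_pow g R CARD('n) k p vs) y []"

definition vortex_moduli_form ::
  "nat \<Rightarrow> (('x, 'n::finite) chart \<Rightarrow> ('n \<Rightarrow> complex) \<Rightarrow> complex^'n^'n) \<Rightarrow> ('x, 'n, 'a, 'r1::finite, 'r2::finite) local_rep \<Rightarrow>
   (nat \<Rightarrow> complex) \<Rightarrow> (nat \<Rightarrow> complex) list \<Rightarrow> complex" where
  "vortex_moduli_form N g R y vs =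
     \<i> * (\<Sum>i<N. \<Sum>j<N. G_VM g R i j y * wedge (dz i) (dzbar j) vs)"

text \<open>\<open>1/2 \<integral> tr(\<Omega> \<and> \<Omega>) \<and> \<omega>\<^bsup>n-1\<^esup>/(n-1)! + \<tau> \<integral> tr(\<i> \<Omega>) \<and> \<omega>\<^sup>n/n!\<close> for the curvature form of \<open>H\<close>\<close>

definition chern_term ::
  "nat \<Rightarrow> (('x, 'n::finite) chart \<Rightarrow> ('n \<Rightarrow> complex) \<Rightarrow> complex^'n^'n) \<Rightarrow> ('x, 'n, 'a, 'r1::finite, 'r2::finite) local_rep \<Rightarrow>
   (nat \<Rightarrow> ('n + nat \<Rightarrow> complex) \<Rightarrow> complex^'r^'r) \<Rightarrow> real \<Rightarrow>
   (nat \<Rightarrow> complex) \<Rightarrow> (nat \<Rightarrow> complex) list \<Rightarrow> complex" where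
  "chern_term N g R H \<tau> y vs =
     1 / 2 * fibre_integral R (\<lambda>k p.
        let \<Omega> = curvature_form (UNIV <+> {..<N}) (H k) p in
        wedge (\<lambda>us. trace (wedge_by (**) \<Omega> \<Omega> us)) (omega_pow g R (CARD('n) - 1) k p)) y vs +
     of_real \<tau> * fibre_integral R (\<lambda>k p.
        let \<Omega> = curvature_form (UNIV <+> {..<N}) (H k) p in
        wedge (\<lambda>us. trace (csm \<i> (\<Omega> us))) (omega_pow g R CARD('n) k p)) y vs"

text \<open>The function \<open>\<integral> tr(\<Phi> \<Phi>\<^sup>*) \<omega>\<^sup>n/n!\<close> on the base\<close>

definition hom_norm ::
  "(('x, 'n::finite) chart \<Rightarrow> ('n \<Rightarrow> complex) \<Rightarrow> complex^'n^'n) \<Rightarrow> ('x, 'n, 'a, 'r1::finite, 'r2::finite) local_rep \<Rightarrow>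
   (nat \<Rightarrow> complex) \<Rightarrow> complex" where
  "hom_norm g R y = fibre_integral R (\<lambda>k p vs.
     trace (hmat R k p ** metric_adj (met1 R k p) (met2 R k p) (hmat R k p)) *
     omega_pow g R CARD('n) k p vs) y []"

end

theory Submission
  imports Defs
begin

text \<open>
  The identity holds already for the integrands, at every point of the fibre.  By type, the fibre part
  of \<open>1/2 tr(\<Omega> \<and> \<Omega>) \<and> \<omega>\<^bsup>n-1\<^esup>/(n-1)!\<close> in the direction \<open>ds\<^sup>i \<and> dsbar\<^sup>j\<close> is \<open>\<i>\<close> times
  \<open>tr(g\<^bsup>\<beta>\<alpha>\<^esup> R\<^bsub>i\<beta>\<^esub> R\<^bsub>\<alpha>j\<^esub>) - tr(R\<^bsub>ij\<^esub> g\<^bsup>\<beta>\<alpha>\<^esup> R\<^bsub>\<alpha>\<beta>\<^esub>)\<close>, and on the fibre the vortex equations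
  turn \<open>g\<^bsup>\<beta>\<alpha>\<^esup> R\<^bsub>\<alpha>\<beta>\<^esub>\<close> into \<open>\<tau>\<^sub>1 - \<Phi>\<Phi>\<^sup>*\<close> and \<open>\<tau>\<^sub>2 + \<Phi>\<^sup>*\<Phi>\<close>.  The terms with \<open>\<tau>\<^sub>\<nu>\<close> cancel, and the remaining
  terms \<open>tr(R\<^sup>1\<^bsub>ij\<^esub> \<Phi>\<Phi>\<^sup>*) - tr(R\<^sup>2\<^bsub>ij\<^esub> \<Phi>\<^sup>*\<Phi>)\<close> are \<open>tr(\<Phi>\<^bsub>;i\<^esub> \<Phi>\<^sup>*\<^bsub>;j\<^esub>) - \<partial>\<^sub>i\<partial>bar\<^sub>j tr(\<Phi>\<Phi>\<^sup>*)\<close>, because \<open>\<Phi>\<close> is holomorphic.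
  It remains to differentiate under the integral sign.  No integration by parts takes place, so that
  the local extensions of the metrics to an ambient space of \<open>S\<close> need not agree on overlaps.
\<close>

section \<open>Exterior algebra by contraction\<close>

text \<open>Two obstacles shape the proof. If \<open>S\<close> is singular, the vortex equations are
  available only over points of \<open>S\<close>, while \<open>dd\<close> and \<open>ddbar\<close>
  look at a neighbourhood in the ambient space, where the extended metrics need not solve anything.
  This is harmless because the equations enter undifferentiated, at one point: the only fibre
  integral that gets differentiated is \<open>hom_norm\<close>, and the formula for its integrand
  rests on holomorphy of \<Phi> and on the Chern connections, which are available over all of
  \<open>U\<close>. The other obstacle is that wedge products are sums over shuffles. Powers of the
  Kaehler form are never expanded in a basis. A 1-form \<theta> times a power of \<omega>, evaluated
  on the frame with one of its vectors repeated, gives zero; contracting with that vector yields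
  linear equations for \<theta> \<and> dzbar \<and> \<omega>^m in terms of \<omega>^(m+1), and the
  inverse metric solves them. Thus neither a determinant of the metric nor the orientation of the
  frame is ever computed. The factor 1/2 in front of the squared curvature compensates that the six
  shuffles of the square fall into three pairs with equal trace.\<close>

lemma shuffle_sign_shift:
  assumes "I \<subseteq> {..<n}"
  shows "shuffle_sign (Suc n) (insert 0 (Suc ` I)) = shuffle_sign n I"
    and "shuffle_sign (Suc n) (Suc ` I) = (-1) ^ card I * shuffle_sign n I"
proof -
  let ?A = "{(i, j). i \<in> I \<and> j \<in> {..<n} - I \<and> j < i}"
  let ?s = "map_prod Suc Suc"
  have fin: "finite I" "finite ?A"
    using assms by (auto intro: finite_subset finite_subset[of _ "{..<n} \<times> {..<n}"])
  have inj: "inj_on ?s ?A" by (auto simp: inj_on_def)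
  have "{(i, j). i \<in> insert 0 (Suc ` I) \<and> j \<in> {..<Suc n} - insert 0 (Suc ` I) \<and> j < i} = ?s ` ?A"
    by (auto simp: image_iff gr0_conv_Suc less_Suc_eq_0_disj)
  then show "shuffle_sign (Suc n) (insert 0 (Suc ` I)) = shuffle_sign n I"
    unfolding shuffle_sign_def by (simp only: card_image[OF inj])
  \<comment> \<open>Position 0 precedes all others. Left out of the subset, it adds one inversion
    \<open>(Suc i, 0)\<close> for every chosen position; inside the subset it would add
    none.\<close>
  have *: "{(i, j). i \<in> Suc ` I \<and> j \<in> {..<Suc n} - Suc ` I \<and> j < i} = (\<lambda>i. (Suc i, 0)) ` I \<union> ?s ` ?A"
    by (auto simp: image_iff gr0_conv_Suc less_Suc_eq_0_disj)
  have "card ((\<lambda>i. (Suc i, 0::nat)) ` I \<union> ?s ` ?A) = card I + card ?A"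
    using fin by (subst card_Un_disjoint) (auto simp: card_image[OF inj] card_image inj_on_def)
  with * show "shuffle_sign (Suc n) (Suc ` I) = (-1) ^ card I * shuffle_sign n I"
    unfolding shuffle_sign_def by (simp only: power_add)
qed

text \<open>The contraction with a vector is an antiderivation.  This recursion replaces all further
  arguments with shuffles.\<close>

lemma wedge_by_Cons:
  assumes mul: "\<And>r a b. mul (r *\<^sub>R a) b = r *\<^sub>R mul a b"
  shows "wedge_by mul \<alpha> \<beta> (x # L) = wedge_by mul (\<lambda>l. \<alpha> (x # l)) \<beta> L
    + wedge_by mul (\<lambda>l. (-1) ^ length l *\<^sub>R \<alpha> l) (\<lambda>l. \<beta> (x # l)) L"
proof -
  let ?n = "length L"
  let ?P = "Pow {..<?n}"
  define t where "t = (\<lambda>I. shuffle_sign (Suc ?n) I *\<^sub>R mul (\<alpha> (nths (x # L) I)) (\<beta> (nths (x # L) (- I))))"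
  have inj1: "inj_on (\<lambda>I. insert 0 (Suc ` I)) ?P" and inj2: "inj_on ((`) Suc) ?P"
    by (rule inj_on_inverseI[where g = "\<lambda>J. {i. Suc i \<in> J}"], auto)+
  \<comment> \<open>The shuffles split by which factor receives the head \<open>x\<close>: position
    0 is either chosen for \<alpha> or left to \<beta>.\<close>
  have P: "Pow {..<Suc ?n} = (\<lambda>I. insert 0 (Suc ` I)) ` ?P \<union> (`) Suc ` ?P"
  proof (intro equalityI subsetI)
    fix J assume J: "J \<in> Pow {..<Suc ?n}"
    define I where "I = {i. Suc i \<in> J}"
    have "I \<in> ?P" using J by (auto simp: I_def)
    have "j \<in> J \<longleftrightarrow> j \<in> (if 0 \<in> J then insert 0 (Suc ` I) else Suc ` I)" for j
      by (cases j) (auto simp: I_def)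
    then have *: "(if 0 \<in> J then insert 0 (Suc ` I) else Suc ` I) = J" by blast
    show "J \<in> (\<lambda>I. insert 0 (Suc ` I)) ` ?P \<union> (`) Suc ` ?P"
    proof (cases "0 \<in> J")
      case True
      with * have "insert 0 (Suc ` I) = J" by (simp only: if_True)
      with \<open>I \<in> ?P\<close> show ?thesis by blast
    next
      case False
      with * have "Suc ` I = J" by (simp only: if_False)
      with \<open>I \<in> ?P\<close> show ?thesis by blast
    qed
  qed (auto simp: image_iff)
  have "wedge_by mul \<alpha> \<beta> (x # L) = sum t (Pow {..<Suc ?n})"
    by (simp add: wedge_by_def t_def)
  also have "\<dots> = sum t ((\<lambda>I. insert 0 (Suc ` I)) ` ?P) + sum t ((`) Suc ` ?P)"
    unfolding P
  proof (rule sum.union_disjoint)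
    have "0 \<in> insert 0 (Suc ` I)" "0 \<notin> Suc ` J" for I J by auto
    then show "(\<lambda>I. insert 0 (Suc ` I)) ` ?P \<inter> (`) Suc ` ?P = {}" by (metis (no_types, lifting) disjoint_iff imageE)
  qed simp_all
  also have "\<dots> = (\<Sum>I\<in>?P. t (insert 0 (Suc ` I))) + (\<Sum>I\<in>?P. t (Suc ` I))"
    by (simp add: sum.reindex[OF inj1] sum.reindex[OF inj2])
  also have "(\<Sum>I\<in>?P. t (insert 0 (Suc ` I))) = wedge_by mul (\<lambda>l. \<alpha> (x # l)) \<beta> L"
    unfolding wedge_by_def t_def
  proof (intro sum.cong refl)
    fix I assume "I \<in> ?P"
    then have I: "I \<subseteq> {..<?n}" by simp
    have *: "nths (x # L) (insert 0 (Suc ` I)) = x # nths L I"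
      "nths (x # L) (- insert 0 (Suc ` I)) = nths L (- I)"
      by (auto simp: nths_Cons image_iff intro!: arg_cong[where f = "nths L"])
    show "shuffle_sign (Suc ?n) (insert 0 (Suc ` I)) *\<^sub>R
        mul (\<alpha> (nths (x # L) (insert 0 (Suc ` I)))) (\<beta> (nths (x # L) (- insert 0 (Suc ` I)))) =
      shuffle_sign ?n I *\<^sub>R mul (\<alpha> (x # nths L I)) (\<beta> (nths L (- I)))"
      unfolding * shuffle_sign_shift(1)[OF I] ..
  qed
  also have "(\<Sum>I\<in>?P. t (Suc ` I)) = wedge_by mul (\<lambda>l. (-1) ^ length l *\<^sub>R \<alpha> l) (\<lambda>l. \<beta> (x # l)) L"
    unfolding wedge_by_def t_def
  proof (intro sum.cong refl)
    fix I assume "I \<in> ?P"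
    then have I: "I \<subseteq> {..<?n}" by simp
    \<comment> \<open>Counting the chosen positions turns the inversion sign into the parity of the
      degree of the argument of \<alpha>.\<close>
    then have "{i. i < ?n \<and> i \<in> I} = I" by auto
    then have l: "length (nths L I) = card I" by (simp add: length_nths)
    have *: "nths (x # L) (Suc ` I) = nths L I" "nths (x # L) (- Suc ` I) = x # nths L (- I)"
      by (auto simp: nths_Cons image_iff intro!: arg_cong[where f = "nths L"])
    show "shuffle_sign (Suc ?n) (Suc ` I) *\<^sub>R
        mul (\<alpha> (nths (x # L) (Suc ` I))) (\<beta> (nths (x # L) (- Suc ` I))) =
      shuffle_sign ?n I *\<^sub>R mul ((-1) ^ length (nths L I) *\<^sub>R \<alpha> (nths L I)) (\<beta> (x # nths L (- I)))"
      unfolding * shuffle_sign_shift(2)[OF I] l mul scaleR_scaleR by (simp only: mult.commute)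
  qed
  finally show ?thesis .
qed

lemma wedge_by_Nil: "wedge_by mul \<alpha> \<beta> [] = mul (\<alpha> []) (\<beta> [])"
  by (simp add: wedge_by_def shuffle_sign_def)

abbreviation (input) contr :: "'v \<Rightarrow> ('v list \<Rightarrow> 'b) \<Rightarrow> 'v list \<Rightarrow> 'b" where
  "contr x \<alpha> \<equiv> (\<lambda>l. \<alpha> (x # l))"

text \<open>The grading involution of the exterior algebra. Carrying the sign on the form itself
  lets the antiderivation rule hold for forms of mixed degree.\<close>

definition grade_inv :: "('v list \<Rightarrow> complex) \<Rightarrow> 'v list \<Rightarrow> complex" where
  "grade_inv \<alpha> l = (-1) ^ length l * \<alpha> l"

lemma wedge_Cons: "wedge \<alpha> \<beta> (x # L) = wedge (contr x \<alpha>) \<beta> L + wedge (grade_inv \<alpha>) (contr x \<beta>) L"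
proof -
  have *: "(\<lambda>l. (-1) ^ length l *\<^sub>R \<alpha> l) = grade_inv \<alpha>"
    by (rule ext) (simp add: grade_inv_def scaleR_conv_of_real)
  show ?thesis
    by (rule wedge_by_Cons[of "(*)" \<alpha> \<beta> x L, unfolded *]) simp
qed

lemma contr_grade_inv: "contr x (grade_inv \<alpha>) = grade_inv (\<lambda>l. - \<alpha> (x # l))"
  by (rule ext) (simp add: grade_inv_def)

lemma grade_inv_minus: "grade_inv (\<lambda>l. - \<alpha> l) = (\<lambda>l. - grade_inv \<alpha> l)"
  by (rule ext) (simp add: grade_inv_def)

lemma wedge_add_left: "wedge (\<lambda>l. \<alpha> l + \<alpha>' l) \<beta> L = wedge \<alpha> \<beta> L + wedge \<alpha>' \<beta> L"
  by (simp add: wedge_by_def algebra_simps sum.distrib)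

lemma wedge_add_right: "wedge \<alpha> (\<lambda>l. \<beta> l + \<beta>' l) L = wedge \<alpha> \<beta> L + wedge \<alpha> \<beta>' L"
  by (simp add: wedge_by_def algebra_simps sum.distrib)

lemma wedge_scale_left: "wedge (\<lambda>l. c * \<alpha> l) \<beta> L = c * wedge \<alpha> \<beta> L"
  by (simp add: wedge_by_def sum_distrib_left mult.assoc)

lemma wedge_scale_right: "wedge \<alpha> (\<lambda>l. c * \<beta> l) L = c * wedge \<alpha> \<beta> L"
  by (simp add: wedge_by_def sum_distrib_left algebra_simps)

lemma wedge_minus_left: "wedge (\<lambda>l. - \<alpha> l) \<beta> L = - wedge \<alpha> \<beta> L"
  using wedge_scale_left[of "-1" \<alpha> \<beta> L] by simp

lemma wedge_minus_right: "wedge \<alpha> (\<lambda>l. - \<beta> l) L = - wedge \<alpha> \<beta> L"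
  using wedge_scale_right[of \<alpha> "-1" \<beta> L] by simp

lemma wedge_zero_left [simp]: "wedge (\<lambda>l. 0) \<beta> L = 0"
  by (simp add: wedge_by_def)

lemma wedge_zero_right [simp]: "wedge \<alpha> (\<lambda>l. 0) L = 0"
  by (simp add: wedge_by_def)

lemma wedge_sum_left: "wedge (\<lambda>l. \<Sum>a\<in>A. \<alpha> a l) \<beta> L = (\<Sum>a\<in>A. wedge (\<alpha> a) \<beta> L)"
  by (induction A rule: infinite_finite_induct) (auto simp: wedge_add_left)

lemma wedge_sum_right: "wedge \<alpha> (\<lambda>l. \<Sum>a\<in>A. \<beta> a l) L = (\<Sum>a\<in>A. wedge \<alpha> (\<beta> a) L)"
  by (induction A rule: infinite_finite_induct) (auto simp: wedge_add_right)

text \<open>The sublists selected by \<open>I\<close> and by its complement have lengths adding up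
  to \<open>length L\<close>, so the sign is multiplicative term by term.\<close>

lemma grade_inv_wedge: "grade_inv (wedge \<alpha> \<beta>) L = wedge (grade_inv \<alpha>) (grade_inv \<beta>) L"
proof -
  have "(-1::complex) ^ length L = (-1) ^ length (nths L I) * (-1) ^ length (nths L (- I))" for I
  proof -
    have "{i. i < length L \<and> i \<in> I} \<union> {i. i < length L \<and> i \<in> - I} = {..<length L}" by auto
    then have "length (nths L I) + length (nths L (- I)) = length L"
      unfolding length_nths by (subst card_Un_disjoint[symmetric]) auto
    from this[symmetric] show ?thesis by (simp add: power_add)
  qed
  then show ?thesis
    unfolding grade_inv_def wedge_by_def sum_distrib_left
    by (intro sum.cong refl) (simp add: algebra_simps scaleR_conv_of_real)
qed

text \<open>Both sides obey the same rule under contraction with the head of the list, because the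
  grading involution is multiplicative. Induction on the arguments therefore avoids shuffles into
  three blocks.\<close>

lemma wedge_assoc: "wedge (wedge \<alpha> \<beta>) \<gamma> L = wedge \<alpha> (wedge \<beta> \<gamma>) L"
proof (induction L arbitrary: \<alpha> \<beta> \<gamma>)
  case Nil
  then show ?case by (simp add: wedge_by_Nil)
next
  case (Cons x L)
  have g: "grade_inv (wedge \<alpha> \<beta>) = wedge (grade_inv \<alpha>) (grade_inv \<beta>)"
    by (rule ext) (rule grade_inv_wedge)
  show ?case
    by (simp add: wedge_Cons wedge_add_left wedge_add_right g Cons.IH)
qed

text \<open>Needed because the type decomposition of the contracted curvature is known only on lists
  of frame vectors.\<close>

lemma wedge_cong:
  assumes "\<And>l. set l \<subseteq> set L \<Longrightarrow> \<alpha> l = \<alpha>' l" "\<And>l. set l \<subseteq> set L \<Longrightarrow> \<beta> l = \<beta>' l"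
  shows "wedge \<alpha> \<beta> L = wedge \<alpha>' \<beta>' L"
  unfolding wedge_by_def
  by (intro sum.cong refl) (simp add: assms set_nths_subset)

text \<open>Contraction exchanges even and odd forms, so the induction must treat both parities at
  once; for odd \<alpha> the commutation costs the grading sign on \<beta>.\<close>

lemma wedge_comm_even:
  assumes "grade_inv \<alpha> = \<alpha>"
  shows "wedge \<alpha> \<beta> L = wedge \<beta> \<alpha> L"
proof -
  have *: "(grade_inv \<alpha> = \<alpha> \<longrightarrow> wedge \<alpha> \<beta> L = wedge \<beta> \<alpha> L) \<and>
      (grade_inv \<alpha> = (\<lambda>l. - \<alpha> l) \<longrightarrow> wedge \<alpha> \<beta> L = wedge (grade_inv \<beta>) \<alpha> L)" for \<alpha> \<beta> :: "'a list \<Rightarrow> complex"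
  proof (induction L arbitrary: \<alpha> \<beta>)
    case Nil
    then show ?case by (auto simp: wedge_by_Nil grade_inv_def)
  next
    case (Cons x L)
    have gg: "grade_inv (grade_inv \<beta>) = \<beta>" for \<beta> :: "'a list \<Rightarrow> complex"
      by (rule ext) (simp add: grade_inv_def flip: mult.assoc power_add)
    show ?case
    proof (intro conjI impI)
      assume e: "grade_inv \<alpha> = \<alpha>"
      have "grade_inv (contr x \<alpha>) l = - contr x \<alpha> l" for l
        using fun_cong[OF e, of "x # l"] by (simp add: grade_inv_def minus_equation_iff[of "_ * _"])
      then have e': "grade_inv (contr x \<alpha>) = (\<lambda>l. - contr x \<alpha> l)" by auto
      have "wedge (contr x \<alpha>) \<beta> L = wedge (grade_inv \<beta>) (contr x \<alpha>) L"
        using Cons.IH[of "contr x \<alpha>" \<beta>] e' by blast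
      moreover have "wedge \<alpha> (contr x \<beta>) L = wedge (contr x \<beta>) \<alpha> L"
        using Cons.IH[of \<alpha> "contr x \<beta>"] e by blast
      ultimately show "wedge \<alpha> \<beta> (x # L) = wedge \<beta> \<alpha> (x # L)"
        by (simp only: wedge_Cons e add.commute)
    next
      assume e: "grade_inv \<alpha> = (\<lambda>l. - \<alpha> l)"
      have "grade_inv (contr x \<alpha>) l = contr x \<alpha> l" for l
        using fun_cong[OF e, of "x # l"] by (simp add: grade_inv_def)
      then have e': "grade_inv (contr x \<alpha>) = contr x \<alpha>" by auto
      have i: "wedge (contr x \<alpha>) \<beta> L = wedge \<beta> (contr x \<alpha>) L"
        using Cons.IH[of "contr x \<alpha>" \<beta>] e' by blast
      have "wedge (grade_inv \<alpha>) (contr x \<beta>) L = - wedge \<alpha> (contr x \<beta>) L"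
        by (simp add: e wedge_minus_left)
      also have "\<dots> = - wedge (grade_inv (contr x \<beta>)) \<alpha> L"
        using Cons.IH[of \<alpha> "contr x \<beta>"] e by (simp only: simp_thms)
      also have "\<dots> = wedge (\<lambda>l. grade_inv \<beta> (x # l)) \<alpha> L"
        by (simp add: wedge_minus_left[symmetric]) (simp add: grade_inv_def)
      finally show "wedge \<alpha> \<beta> (x # L) = wedge (grade_inv \<beta>) \<alpha> (x # L)"
        by (simp only: wedge_Cons i gg add.commute)
    qed
  qed
  then show ?thesis using assms by blast
qed

text \<open>Adjacent transpositions generate all permutations, and the arbitrary prefix
  \<open>xs\<close> makes the property pass to contractions at once.\<close>

definition antisym_form :: "('v list \<Rightarrow> complex) \<Rightarrow> bool" where
  "antisym_form \<alpha> \<longleftrightarrow> (\<forall>xs a b ys. \<alpha> (xs @ a # b # ys) = - \<alpha> (xs @ b # a # ys))"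

lemma antisymD: "antisym_form \<alpha> \<Longrightarrow> \<alpha> (xs @ a # b # ys) = - \<alpha> (xs @ b # a # ys)"
  unfolding antisym_form_def by (elim allE)

lemma antisym_contr: "antisym_form \<alpha> \<Longrightarrow> antisym_form (contr x \<alpha>)"
  unfolding antisym_form_def append_Cons[symmetric] by (intro allI) (elim allE)

lemma antisym_grade_inv: "antisym_form \<alpha> \<Longrightarrow> antisym_form (grade_inv \<alpha>)"
  unfolding antisym_form_def[of "grade_inv \<alpha>"] grade_inv_def
proof (intro allI)
  fix xs a b ys
  assume "antisym_form \<alpha>"
  note * = antisymD[OF this, of xs a b ys]
  show "(-1) ^ length (xs @ a # b # ys) * \<alpha> (xs @ a # b # ys) =
      - ((-1) ^ length (xs @ b # a # ys) * \<alpha> (xs @ b # a # ys))"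
    unfolding * by simp
qed

text \<open>Contracting along the prefix reduces to a swap at the head. In the double contraction
  the mixed terms, one vector to each factor, change places with opposite sign; the other two terms
  are antisymmetric by hypothesis.\<close>

lemma antisym_wedge:
  assumes "antisym_form \<alpha>" "antisym_form \<beta>"
  shows "antisym_form (wedge \<alpha> \<beta>)"
  unfolding antisym_form_def
proof (intro allI)
  fix xs a b ys
  show "wedge \<alpha> \<beta> (xs @ a # b # ys) = - wedge \<alpha> \<beta> (xs @ b # a # ys)"
    using assms
  proof (induction xs arbitrary: \<alpha> \<beta>)
    case Nil
    have 1: "(\<lambda>l. \<alpha> (a # b # l)) = (\<lambda>l. - \<alpha> (b # a # l))" "(\<lambda>l. \<beta> (a # b # l)) = (\<lambda>l. - \<beta> (b # a # l))"
      using Nil.prems unfolding antisym_form_def by (metis append_Nil)+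
    show ?case
      by (simp add: wedge_Cons contr_grade_inv)
        (simp add: 1 wedge_minus_left wedge_minus_right grade_inv_minus)
  next
    case (Cons x xs)
    show ?case
      by (simp add: wedge_Cons Cons.IH antisym_contr antisym_grade_inv Cons.prems)
  qed
qed

text \<open>The first copy of \<open>x\<close> moves right by adjacent swaps until it meets the
  second, where the value equals its own negative. The prefix \<open>ps\<close> in the induction
  absorbs the entries already passed.\<close>

lemma antisym_repeat:
  assumes "antisym_form \<alpha>" "x \<in> set L"
  shows "\<alpha> (x # L) = 0"
proof -
  obtain ys zs where L: "L = ys @ x # zs"
    using split_list[OF assms(2)] by (elim exE)
  have "\<alpha> (ps @ x # ys @ x # zs) = 0" for ps
  proof (induction ys arbitrary: ps)
    case Nil
    have "\<alpha> (ps @ x # x # zs) = - \<alpha> (ps @ x # x # zs)"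
      by (rule antisymD[OF assms(1)])
    then show ?case by simp
  next
    case (Cons y ys)
    have "\<alpha> (ps @ x # y # ys @ x # zs) = - \<alpha> (ps @ y # x # ys @ x # zs)"
      by (rule antisymD[OF assms(1)])
    also have "\<dots> = 0" using Cons.IH[of "ps @ [y]"] by simp
    finally show ?case by simp
  qed
  from this[of "[]"] show ?thesis by (simp add: L)
qed

section \<open>Products with powers of the Kaehler form\<close>

definition form_deg :: "nat \<Rightarrow> ('v list \<Rightarrow> 'b::zero) \<Rightarrow> bool" where
  "form_deg m \<alpha> \<longleftrightarrow> (\<forall>l. length l \<noteq> m \<longrightarrow> \<alpha> l = 0)"

lemma form_deg_wedge_by:
  assumes "form_deg m \<alpha>" "form_deg n \<beta>" "\<And>b. mul 0 b = 0" "\<And>a. mul a 0 = 0"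
  shows "form_deg (m + n) (wedge_by mul \<alpha> \<beta>)"
  unfolding form_deg_def wedge_by_def
proof (intro allI impI sum.neutral ballI)
  fix l :: "'a list" and I assume l: "length l \<noteq> m + n"
  have "{i. i < length l \<and> i \<in> I} \<union> {i. i < length l \<and> i \<in> - I} = {..<length l}" by auto
  then have "length (nths l I) + length (nths l (- I)) = length l"
    unfolding length_nths by (subst card_Un_disjoint[symmetric]) auto
  with l have "length (nths l I) \<noteq> m \<or> length (nths l (- I)) \<noteq> n" by linarith
  then show "shuffle_sign (length l) I *\<^sub>R mul (\<alpha> (nths l I)) (\<beta> (nths l (- I))) = 0"
    using assms unfolding form_deg_def by (metis scaleR_zero_right)
qed

lemma form_deg_wedge: "form_deg m \<alpha> \<Longrightarrow> form_deg n \<beta> \<Longrightarrow> form_deg (m + n) (wedge \<alpha> \<beta>)"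
  by (rule form_deg_wedge_by) auto

lemma form_deg_dz [simp]: "form_deg 1 (dz k)" and form_deg_dzbar [simp]: "form_deg 1 (dzbar k)"
  by (auto simp: form_deg_def dz_def dzbar_def)

lemma form_deg_kaehler_form:
  fixes \<iota> :: "'n::finite \<Rightarrow> 'k"
  shows "form_deg 2 (kaehler_form \<iota> G)"
proof -
  have "wedge (dz a) (dzbar b) l = 0" if "length l \<noteq> 2" for a b :: 'k and l
    using form_deg_wedge[OF form_deg_dz form_deg_dzbar, of a b] that by (simp add: form_deg_def)
  then show ?thesis
    unfolding form_deg_def kaehler_form_def by simp
qed

lemma form_deg_wedge_pow: "form_deg d \<omega> \<Longrightarrow> form_deg (m * d) (wedge_pow \<omega> m)"
proof (induction m)
  case 0
  then show ?case by (simp add: form_deg_def)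
next
  case (Suc m)
  then show ?case using form_deg_wedge[of d \<omega> "m * d" "wedge_pow \<omega> m"] by simp
qed

lemma grade_inv_deg: "form_deg d \<alpha> \<Longrightarrow> grade_inv \<alpha> = (\<lambda>l. (-1) ^ d * \<alpha> l)"
  by (rule ext) (auto simp: grade_inv_def form_deg_def)

lemma antisym_deg1: "form_deg 1 \<alpha> \<Longrightarrow> antisym_form \<alpha>"
  unfolding form_deg_def antisym_form_def by auto

lemma antisym_kaehler_form:
  fixes \<iota> :: "'n::finite \<Rightarrow> 'k"
  shows "antisym_form (kaehler_form \<iota> G)"
proof -
  have "antisym_form (wedge (dz a) (dzbar b))" for a b :: 'k
    by (rule antisym_wedge antisym_deg1 form_deg_dz form_deg_dzbar)+
  note * = antisymD[OF this]
  show ?thesis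
    unfolding antisym_form_def
  proof (intro allI)
    fix xs a b ys
    show "kaehler_form \<iota> G (xs @ a # b # ys) = - kaehler_form \<iota> G (xs @ b # a # ys)"
      unfolding kaehler_form_def sum_negf[symmetric]
      by (intro sum.cong refl) (simp only: *[of _ _ xs a b ys] mult_minus_right)
  qed
qed

lemma antisym_wedge_pow: "antisym_form \<omega> \<Longrightarrow> antisym_form (wedge_pow \<omega> m)"
proof (induction m)
  case 0
  then show ?case by (simp add: antisym_form_def)
next
  case (Suc m)
  then show ?case by (simp add: antisym_wedge)
qed

lemma wedge_scalar_left: "form_deg 0 \<alpha> \<Longrightarrow> wedge \<alpha> \<beta> L = \<alpha> [] * \<beta> L"
proof (induction L arbitrary: \<beta>)
  case Nil
  then show ?case by (simp add: wedge_by_Nil)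
next
  case (Cons x L)
  have "contr x \<alpha> = (\<lambda>l. 0)" using Cons.prems by (auto simp: form_deg_def)
  with Cons show ?case by (simp add: wedge_Cons grade_inv_deg)
qed

text \<open>The power rule: \<omega> is even, so contraction acts on its powers as a derivation, and
  the contracted factor can be moved to the front in each of the \<open>Suc m\<close> terms.\<close>

lemma contr_wedge_pow:
  assumes "form_deg 2 \<omega>"
  shows "wedge_pow \<omega> (Suc m) (x # l) = of_nat (Suc m) * wedge (contr x \<omega>) (wedge_pow \<omega> m) l"
proof (induction m arbitrary: l)
  case 0
  have "contr x (wedge_pow \<omega> 0) = (\<lambda>l. 0)" by auto
  then show ?case by (simp add: wedge_Cons del: wedge_pow.simps(1))
next
  case (Suc m)
  have e: "grade_inv \<omega> = \<omega>" by (simp add: grade_inv_deg[OF assms])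
  have "wedge_pow \<omega> (Suc (Suc m)) (x # l) =
      wedge (contr x \<omega>) (wedge_pow \<omega> (Suc m)) l + wedge \<omega> (contr x (wedge_pow \<omega> (Suc m))) l"
    by (subst wedge_pow.simps) (simp only: wedge_Cons e)
  also have "wedge \<omega> (contr x (wedge_pow \<omega> (Suc m))) l =
      of_nat (Suc m) * wedge \<omega> (wedge (contr x \<omega>) (wedge_pow \<omega> m)) l"
    by (simp only: Suc.IH wedge_scale_right)
  also have "wedge \<omega> (wedge (contr x \<omega>) (wedge_pow \<omega> m)) l = wedge (contr x \<omega>) (wedge \<omega> (wedge_pow \<omega> m)) l"
    unfolding wedge_assoc[symmetric] wedge_comm_even[OF e, abs_def] ..
  finally show ?case by (simp add: algebra_simps)
qed

text \<open>The form \<open>\<theta> \<and> \<omega>\<^bsup>m+1\<^esup>\<close> vanishes on lists with a repeated vector; contract it.\<close>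

lemma contr_top:
  assumes "form_deg 1 \<theta>" "form_deg 2 \<omega>" "antisym_form \<omega>" "x \<in> set F"
  shows "\<theta> [x] * wedge_pow \<omega> (Suc m) F = of_nat (Suc m) * wedge \<theta> (wedge (contr x \<omega>) (wedge_pow \<omega> m)) F"
proof -
  have "antisym_form (wedge \<theta> (wedge_pow \<omega> (Suc m)))"
    by (rule antisym_wedge[OF antisym_deg1[OF assms(1)] antisym_wedge_pow[OF assms(3)]])
  then have "0 = wedge \<theta> (wedge_pow \<omega> (Suc m)) (x # F)"
    using assms(4) by (simp add: antisym_repeat)
  also have "\<dots> = wedge (contr x \<theta>) (wedge_pow \<omega> (Suc m)) F - wedge \<theta> (contr x (wedge_pow \<omega> (Suc m))) F"
    by (simp only: wedge_Cons grade_inv_deg[OF assms(1)]) (simp add: wedge_minus_left)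
  also have "wedge (contr x \<theta>) (wedge_pow \<omega> (Suc m)) F = \<theta> [x] * wedge_pow \<omega> (Suc m) F"
    using assms(1) by (intro wedge_scalar_left) (auto simp: form_deg_def)
  also have "wedge \<theta> (contr x (wedge_pow \<omega> (Suc m))) F =
      of_nat (Suc m) * wedge \<theta> (wedge (contr x \<omega>) (wedge_pow \<omega> m)) F"
    by (simp only: contr_wedge_pow[OF assms(2)] wedge_scale_right)
  finally show ?thesis by simp
qed

lemma wedge_dz_dzbar: "wedge (dz k) (dzbar l) [x, y] = x k * cnj (y l) - y k * cnj (x l)"
  and wedge_dz_dz: "wedge (dz k) (dz l) [x, y] = x k * y l - y k * x l"
  and wedge_dzbar_dzbar: "wedge (dzbar k) (dzbar l) [x, y] = cnj (x k) * cnj (y l) - cnj (y k) * cnj (x l)"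
  and wedge_dzbar_dz: "wedge (dzbar l) (dz k) [x, y] = y k * cnj (x l) - x k * cnj (y l)"
  by (simp_all add: wedge_Cons wedge_by_Nil dz_def dzbar_def grade_inv_def)

lemma kaehler_form_pair:
  "kaehler_form \<iota> G [x, y] = (\<Sum>\<alpha>\<in>UNIV. \<Sum>\<beta>\<in>UNIV. \<i> * G $ \<alpha> $ \<beta> * (x (\<iota> \<alpha>) * cnj (y (\<iota> \<beta>)) - y (\<iota> \<alpha>) * cnj (x (\<iota> \<beta>))))"
  by (simp add: kaehler_form_def wedge_dz_dzbar)

definition unit_vec :: "'k \<Rightarrow> complex \<Rightarrow> 'k \<Rightarrow> complex" where
  "unit_vec k c = (\<lambda>_. 0)(k := c)"

text \<open>Only membership is recorded: the contraction argument asks just that each coordinate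
  vector repeat an entry of the list. Orientation and length are absorbed in the common volume
  factor.\<close>

definition has_frame :: "('n \<Rightarrow> 'k) \<Rightarrow> ('k \<Rightarrow> complex) list \<Rightarrow> bool" where
  "has_frame \<iota> F \<longleftrightarrow> (\<forall>\<alpha>. unit_vec (\<iota> \<alpha>) 1 \<in> set F \<and> unit_vec (\<iota> \<alpha>) \<i> \<in> set F)"

text \<open>The values of a 1-form on \<open>\<partial>/\<partial>z\<^bsup>k\<^esup>\<close> and on its conjugate.\<close>

definition val10 :: "'k \<Rightarrow> (('k \<Rightarrow> complex) list \<Rightarrow> complex) \<Rightarrow> complex" where
  "val10 k \<theta> = (\<theta> [unit_vec k 1] - \<i> * \<theta> [unit_vec k \<i>]) / 2"

definition val01 :: "'k \<Rightarrow> (('k \<Rightarrow> complex) list \<Rightarrow> complex) \<Rightarrow> complex" where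
  "val01 k \<theta> = (\<theta> [unit_vec k 1] + \<i> * \<theta> [unit_vec k \<i>]) / 2"

lemma val_simps [simp]:
  "val10 k (dz l) = (if l = k then 1 else 0)" "val10 k (dzbar l) = 0"
  "val01 k (dz l) = 0" "val01 k (dzbar l) = (if l = k then 1 else 0)"
  by (auto simp: val10_def val01_def dz_def dzbar_def unit_vec_def)

text \<open>These are the contractions with the complex vectors \<partial>/\<partial>z^\<gamma> and
  its conjugate, written through real ones; each leaves only a row or a column of
  \<open>G\<close>.\<close>

lemma contr_kaehler_form:
  assumes "inj \<iota>"
  shows "(kaehler_form \<iota> G (unit_vec (\<iota> \<gamma>) 1 # l) - \<i> * kaehler_form \<iota> G (unit_vec (\<iota> \<gamma>) \<i> # l)) / 2 =
      (\<Sum>\<beta>\<in>UNIV. \<i> * G $ \<gamma> $ \<beta> * dzbar (\<iota> \<beta>) l)" (is ?A)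
    and "(kaehler_form \<iota> G (unit_vec (\<iota> \<gamma>) 1 # l) + \<i> * kaehler_form \<iota> G (unit_vec (\<iota> \<gamma>) \<i> # l)) / 2 =
      (\<Sum>\<alpha>\<in>UNIV. - \<i> * G $ \<alpha> $ \<gamma> * dz (\<iota> \<alpha>) l)" (is ?B)
proof -
  have u: "unit_vec (\<iota> \<gamma>) c (\<iota> \<alpha>) = (if \<alpha> = \<gamma> then c else 0)" for c \<alpha>
    using assms by (auto simp: unit_vec_def inj_eq)
  have "?A \<and> ?B"
  proof (cases "\<exists>v. l = [v]")
    case True
    then obtain v where l: "l = [v]" by blast
    \<comment> \<open>One term is linear in \<open>c\<close>, the other in \<open>cnj c\<close>.
      Combining the values at 1 and \<i> with the factor -\<i> or \<i> therefore isolates one of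
      them.\<close>
    have c: "kaehler_form \<iota> G (unit_vec (\<iota> \<gamma>) c # l) =
        c * (\<Sum>\<beta>\<in>UNIV. \<i> * G $ \<gamma> $ \<beta> * cnj (v (\<iota> \<beta>))) - cnj c * (\<Sum>\<alpha>\<in>UNIV. \<i> * G $ \<alpha> $ \<gamma> * v (\<iota> \<alpha>))" for c
    proof -
      have "kaehler_form \<iota> G (unit_vec (\<iota> \<gamma>) c # l) =
        (\<Sum>\<alpha>\<in>UNIV. \<Sum>\<beta>\<in>UNIV. if \<alpha> = \<gamma> then \<i> * G $ \<gamma> $ \<beta> * (c * cnj (v (\<iota> \<beta>))) else 0) -
        (\<Sum>\<alpha>\<in>UNIV. \<Sum>\<beta>\<in>UNIV. if \<beta> = \<gamma> then \<i> * G $ \<alpha> $ \<gamma> * (v (\<iota> \<alpha>) * cnj c) else 0)"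
        unfolding l kaehler_form_pair u sum_subtractf[symmetric]
        by (intro sum.cong refl) (auto simp: algebra_simps)
      also have "(\<Sum>\<alpha>\<in>UNIV. \<Sum>\<beta>\<in>UNIV. if \<alpha> = \<gamma> then \<i> * G $ \<gamma> $ \<beta> * (c * cnj (v (\<iota> \<beta>))) else 0) =
          (\<Sum>\<beta>\<in>UNIV. \<i> * G $ \<gamma> $ \<beta> * (c * cnj (v (\<iota> \<beta>))))"
        by (subst sum.swap) simp
      finally show ?thesis by (simp add: sum_distrib_left algebra_simps)
    qed
    show ?thesis unfolding c
      by (simp add: l dz_def dzbar_def sum_negf sum_distrib_left algebra_simps)
  next
    case False
    then have "length l \<noteq> 1" by (auto simp: length_Suc_conv)
    then have "kaehler_form \<iota> G (x # l) = 0" "dz k l = 0" "dzbar k l = 0" for x k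
      using form_deg_kaehler_form[of \<iota> G] by (auto simp: form_deg_def dz_def dzbar_def)
    then show ?thesis by simp
  qed
  then show ?A ?B by auto
qed

lemma wedge_div_right: "wedge \<alpha> (\<lambda>l. \<beta> l / c) L = wedge \<alpha> \<beta> L / c"
  using wedge_scale_right[of \<alpha> "1 / c" \<beta> L] by simp

text \<open>\<open>contr_top\<close> for the two real directions of a coordinate, combined
  complexly; dividing by the factorials absorbs the factor \<open>Suc m\<close>. For fixed \<theta>
  this is a linear system with matrix \<open>G\<close> for the products of \<theta> with
  \<open>dzbar\<close> or \<open>dz\<close>.\<close>

lemma wedge_one_form_kaehler:
  fixes G :: "complex^'n::finite^'n"
  assumes "inj \<iota>" "has_frame \<iota> F" "form_deg 1 \<theta>"
  shows "val10 (\<iota> \<gamma>) \<theta> * kaehler_pow \<iota> G (Suc m) F =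
      (\<Sum>\<beta>\<in>UNIV. \<i> * G $ \<gamma> $ \<beta> * wedge \<theta> (wedge (dzbar (\<iota> \<beta>)) (kaehler_pow \<iota> G m)) F)" (is ?A)
    and "val01 (\<iota> \<gamma>) \<theta> * kaehler_pow \<iota> G (Suc m) F =
      (\<Sum>\<alpha>\<in>UNIV. - \<i> * G $ \<alpha> $ \<gamma> * wedge \<theta> (wedge (dz (\<iota> \<alpha>)) (kaehler_pow \<iota> G m)) F)" (is ?B)
proof -
  let ?\<omega> = "kaehler_form \<iota> G"
  let ?c = "of_nat (Suc m) :: complex"
  have k: "kaehler_pow \<iota> G m = (\<lambda>l. wedge_pow ?\<omega> m l / fact m)" by (rule ext) (simp add: kaehler_pow_def)
  have c: "?c \<noteq> 0" using of_nat_neq_0 by blast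
  have t: "\<theta> [x] * wedge_pow ?\<omega> (Suc m) F = ?c * wedge \<theta> (wedge (contr x ?\<omega>) (wedge_pow ?\<omega> m)) F"
    if "x \<in> set F" for x
    using that by (intro contr_top assms form_deg_kaehler_form antisym_kaehler_form)
  have t2: "(\<theta> [x] + e * \<theta> [y]) / 2 * wedge_pow ?\<omega> (Suc m) F =
      ?c * wedge \<theta> (wedge (\<lambda>l. (?\<omega> (x # l) + e * ?\<omega> (y # l)) / 2) (wedge_pow ?\<omega> m)) F"
    if xy: "x \<in> set F" "y \<in> set F" for x y e
  proof -
    have *: "(\<lambda>l. (?\<omega> (x # l) + e * ?\<omega> (y # l)) / 2) = (\<lambda>l. (1 / 2) * (?\<omega> (x # l) + e * ?\<omega> (y # l)))" by auto
    have "?c * wedge \<theta> (wedge (\<lambda>l. (?\<omega> (x # l) + e * ?\<omega> (y # l)) / 2) (wedge_pow ?\<omega> m)) F =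
        (1 / 2) * (?c * wedge \<theta> (wedge (contr x ?\<omega>) (wedge_pow ?\<omega> m)) F +
          e * (?c * wedge \<theta> (wedge (contr y ?\<omega>) (wedge_pow ?\<omega> m)) F))"
      unfolding * wedge_scale_left wedge_add_left wedge_scale_right wedge_add_right
      by (simp add: field_simps del: of_nat_Suc)
    also have "\<dots> = (\<theta> [x] + e * \<theta> [y]) / 2 * wedge_pow ?\<omega> (Suc m) F"
      unfolding t[OF xy(1), symmetric] t[OF xy(2), symmetric] by (simp add: field_simps del: of_nat_Suc wedge_pow.simps)
    finally show ?thesis by simp
  qed
  have fr: "unit_vec (\<iota> \<gamma>) 1 \<in> set F" "unit_vec (\<iota> \<gamma>) \<i> \<in> set F"
    using assms(2) by (auto simp: has_frame_def)
  have s: "kaehler_pow \<iota> G (Suc m) F = wedge_pow ?\<omega> (Suc m) F / (?c * fact m)"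
    by (simp add: kaehler_pow_def)
  have "val10 (\<iota> \<gamma>) \<theta> * wedge_pow ?\<omega> (Suc m) F =
      ?c * wedge \<theta> (wedge (\<lambda>l. \<Sum>\<beta>\<in>UNIV. \<i> * G $ \<gamma> $ \<beta> * dzbar (\<iota> \<beta>) l) (wedge_pow ?\<omega> m)) F"
    using t2[OF fr, of "- \<i>"] contr_kaehler_form(1)[OF assms(1), of G \<gamma>]
    unfolding val10_def by simp
  then show ?A
    unfolding s k wedge_sum_left wedge_scale_left wedge_div_right wedge_sum_right wedge_scale_right
    using c by (simp add: field_simps sum_distrib_left sum_divide_distrib del: of_nat_Suc wedge_pow.simps)
  have "val01 (\<iota> \<gamma>) \<theta> * wedge_pow ?\<omega> (Suc m) F =
      ?c * wedge \<theta> (wedge (\<lambda>l. \<Sum>\<alpha>\<in>UNIV. - \<i> * G $ \<alpha> $ \<gamma> * dz (\<iota> \<alpha>) l) (wedge_pow ?\<omega> m)) F"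
    using t2[OF fr, of "\<i>"] contr_kaehler_form(2)[OF assms(1), of G \<gamma>]
    unfolding val01_def by simp
  then show ?B
    unfolding s k wedge_sum_left wedge_scale_left wedge_div_right wedge_sum_right wedge_scale_right
    using c by (simp add: field_simps sum_distrib_left sum_divide_distrib del: of_nat_Suc wedge_pow.simps)
qed

lemma matrix_inv_inverse:
  fixes G :: "complex^'n^'n"
  assumes "invertible G"
  shows "G ** matrix_inv G = mat 1" "matrix_inv G ** G = mat 1"
  using assms unfolding invertible_def matrix_inv_def by (metis (mono_tags, lifting) someI_ex)+

lemma matrix_inv_sums:
  fixes G :: "complex^'n^'n"
  assumes "invertible G"
  shows "(\<Sum>\<gamma>\<in>UNIV. matrix_inv G $ \<alpha> $ \<gamma> * G $ \<gamma> $ \<beta>) = (if \<alpha> = \<beta> then 1 else 0)"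
    and "(\<Sum>\<gamma>\<in>UNIV. G $ \<alpha> $ \<gamma> * matrix_inv G $ \<gamma> $ \<beta>) = (if \<alpha> = \<beta> then 1 else 0)"
  using matrix_inv_inverse[OF assms] by (auto simp: vec_eq_iff matrix_matrix_mult_def mat_def)

text \<open>The inverse metric solves the linear system of
  \<open>wedge_one_form_kaehler\<close>.\<close>

lemma wedge_two_form_kaehler:
  fixes G :: "complex^'n::finite^'n"
  assumes "inj \<iota>" "has_frame \<iota> F" "form_deg 1 \<theta>" "invertible G"
  shows "wedge (wedge \<theta> (dzbar (\<iota> \<beta>))) (kaehler_pow \<iota> G m) F =
      - \<i> * (\<Sum>\<gamma>\<in>UNIV. matrix_inv G $ \<beta> $ \<gamma> * val10 (\<iota> \<gamma>) \<theta>) * kaehler_pow \<iota> G (Suc m) F" (is ?A)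
    and "wedge (wedge \<theta> (dz (\<iota> \<beta>))) (kaehler_pow \<iota> G m) F =
      \<i> * (\<Sum>\<gamma>\<in>UNIV. matrix_inv G $ \<gamma> $ \<beta> * val01 (\<iota> \<gamma>) \<theta>) * kaehler_pow \<iota> G (Suc m) F" (is ?B)
proof -
  let ?w = "\<lambda>\<beta>. wedge \<theta> (wedge (dzbar (\<iota> \<beta>)) (kaehler_pow \<iota> G m)) F"
  let ?v = "\<lambda>\<beta>. wedge \<theta> (wedge (dz (\<iota> \<beta>)) (kaehler_pow \<iota> G m)) F"
  have "(\<Sum>\<gamma>\<in>UNIV. matrix_inv G $ \<beta> $ \<gamma> * val10 (\<iota> \<gamma>) \<theta>) * kaehler_pow \<iota> G (Suc m) F =
      (\<Sum>\<gamma>\<in>UNIV. \<Sum>\<delta>\<in>UNIV. matrix_inv G $ \<beta> $ \<gamma> * (\<i> * G $ \<gamma> $ \<delta> * ?w \<delta>))"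
    unfolding sum_distrib_right mult.assoc wedge_one_form_kaehler(1)[OF assms(1-3)] sum_distrib_left ..
  also have "\<dots> = (\<Sum>\<delta>\<in>UNIV. (\<Sum>\<gamma>\<in>UNIV. matrix_inv G $ \<beta> $ \<gamma> * G $ \<gamma> $ \<delta>) * (\<i> * ?w \<delta>))"
    by (subst sum.swap) (simp add: sum_distrib_left sum_distrib_right algebra_simps)
  also have "\<dots> = \<i> * ?w \<beta>"
    unfolding matrix_inv_sums(1)[OF assms(4)] by (simp add: if_distrib[of "\<lambda>c. c * _"] cong: if_cong)
  finally show ?A by (simp add: wedge_assoc mult.assoc)
  have "(\<Sum>\<gamma>\<in>UNIV. matrix_inv G $ \<gamma> $ \<beta> * val01 (\<iota> \<gamma>) \<theta>) * kaehler_pow \<iota> G (Suc m) F =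
      (\<Sum>\<gamma>\<in>UNIV. \<Sum>\<delta>\<in>UNIV. matrix_inv G $ \<gamma> $ \<beta> * (- \<i> * G $ \<delta> $ \<gamma> * ?v \<delta>))"
    unfolding sum_distrib_right mult.assoc wedge_one_form_kaehler(2)[OF assms(1-3)] sum_distrib_left ..
  also have "\<dots> = (\<Sum>\<delta>\<in>UNIV. (\<Sum>\<gamma>\<in>UNIV. G $ \<delta> $ \<gamma> * matrix_inv G $ \<gamma> $ \<beta>) * (- \<i> * ?v \<delta>))"
    by (subst sum.swap) (simp add: sum_distrib_left sum_distrib_right sum_negf algebra_simps)
  also have "\<dots> = - \<i> * ?v \<beta>"
    unfolding matrix_inv_sums(2)[OF assms(4)] by (simp add: sum_negf if_distrib[of "\<lambda>c. c * _"] cong: if_cong)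
  finally show ?B by (simp add: wedge_assoc mult.assoc)
qed

text \<open>This is \<eta> \<and> \<omega>^m/m! = (\<Lambda> \<eta>) \<omega>^(m+1)/(m+1)! on the
  frame. The parts of type (2,0) and (0,2) drop out because \<open>val01\<close> vanishes on
  \<open>dz\<close> and \<open>val10\<close> on \<open>dzbar\<close>.\<close>

lemma wedge_kaehler_pow_type:
  fixes G :: "complex^'n::finite^'n"
  assumes "inj \<iota>" "has_frame \<iota> F" "invertible G"
    and \<eta>: "\<And>l. set l \<subseteq> set F \<Longrightarrow> \<eta> l = (\<Sum>\<alpha>\<in>UNIV. \<Sum>\<beta>\<in>UNIV.
      a \<alpha> \<beta> * wedge (dz (\<iota> \<alpha>)) (dzbar (\<iota> \<beta>)) l + b \<alpha> \<beta> * wedge (dz (\<iota> \<alpha>)) (dz (\<iota> \<beta>)) l +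
      c \<alpha> \<beta> * wedge (dzbar (\<iota> \<alpha>)) (dzbar (\<iota> \<beta>)) l)"
  shows "wedge \<eta> (kaehler_pow \<iota> G m) F =
    - \<i> * (\<Sum>\<alpha>\<in>UNIV. \<Sum>\<beta>\<in>UNIV. matrix_inv G $ \<beta> $ \<alpha> * a \<alpha> \<beta>) * kaehler_pow \<iota> G (Suc m) F"
proof -
  have "wedge \<eta> (kaehler_pow \<iota> G m) F = wedge (\<lambda>l. \<Sum>\<alpha>\<in>UNIV. \<Sum>\<beta>\<in>UNIV.
      a \<alpha> \<beta> * wedge (dz (\<iota> \<alpha>)) (dzbar (\<iota> \<beta>)) l + b \<alpha> \<beta> * wedge (dz (\<iota> \<alpha>)) (dz (\<iota> \<beta>)) l +
      c \<alpha> \<beta> * wedge (dzbar (\<iota> \<alpha>)) (dzbar (\<iota> \<beta>)) l) (kaehler_pow \<iota> G m) F"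
    by (rule wedge_cong) (auto simp: \<eta>)
  also have "\<dots> = (\<Sum>\<alpha>\<in>UNIV. \<Sum>\<beta>\<in>UNIV.
      a \<alpha> \<beta> * (- \<i> * matrix_inv G $ \<beta> $ \<alpha> * kaehler_pow \<iota> G (Suc m) F))"
  proof -
    note [simp] = inj_eq[OF assms(1)]
    have "wedge (wedge (dz (\<iota> \<alpha>)) (dzbar (\<iota> \<beta>))) (kaehler_pow \<iota> G m) F =
        - \<i> * matrix_inv G $ \<beta> $ \<alpha> * kaehler_pow \<iota> G (Suc m) F"
      "wedge (wedge (dz (\<iota> \<alpha>)) (dz (\<iota> \<beta>))) (kaehler_pow \<iota> G m) F = 0"
      "wedge (wedge (dzbar (\<iota> \<alpha>)) (dzbar (\<iota> \<beta>))) (kaehler_pow \<iota> G m) F = 0" for \<alpha> \<beta>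
      by (simp_all add: wedge_two_form_kaehler[OF assms(1,2) _ assms(3)] form_deg_dz[simplified] form_deg_dzbar[simplified]
        if_distrib[of "\<lambda>c. _ * c"] cong: if_cong)
    then show ?thesis
      unfolding wedge_sum_left wedge_add_left wedge_scale_left by simp
  qed
  finally show ?thesis by (simp add: sum_distrib_left sum_distrib_right algebra_simps sum_negf)
qed

section \<open>Scalars, products and traces of complex matrices\<close>

lemma csm_zero [simp]: "csm 0 A = 0" "csm c 0 = 0"
  and csm_mult_left: "csm c (A :: complex^'b^'d) ** (B :: complex^'c^'b) = csm c (A ** B)"
  and csm_mult_right: "A ** csm c B = csm c (A ** B)"
  and csm_csm: "csm c (csm d A) = csm (c * d) A"
  by (simp_all add: csm_def vec_eq_iff matrix_matrix_mult_def sum_distrib_left algebra_simps)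

lemma csm_sum: "csm c (\<Sum>i\<in>S. A i) = (\<Sum>i\<in>S. csm c (A i))"
  by (simp add: csm_def vec_eq_iff sum_distrib_left)

lemma csm_minus: "csm c (- A) = - csm c A"
  and csm_minus_left: "csm (- c) A = - csm c A"
  by (simp_all add: csm_def vec_eq_iff algebra_simps)

lemma matrix_mult_minus:
  fixes A :: "complex^'b^'d" and B :: "complex^'c^'b"
  shows "(- A) ** B = - (A ** B)" "A ** (- B) = - (A ** B)"
  by (simp_all add: vec_eq_iff matrix_matrix_mult_def sum_negf)

lemma matrix_mult_diff:
  fixes A :: "complex^'b^'d" and B :: "complex^'c^'b"
  shows "(A - A') ** B = A ** B - A' ** B" "A ** (B - B') = A ** B - A ** B'"
  by (simp_all add: vec_eq_iff matrix_matrix_mult_def sum_subtractf algebra_simps)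

lemma matrix_add_rdistrib:
  fixes A :: "complex^'b^'d" and B :: "complex^'c^'b"
  shows "(A + A') ** B = A ** B + A' ** B"
  by (simp add: vec_eq_iff matrix_matrix_mult_def sum.distrib algebra_simps)

lemma matrix_mult_zero_left: "(0 :: complex^'b^'d) ** (B :: complex^'c^'b) = 0"
  by (simp add: vec_eq_iff matrix_matrix_mult_def)

lemma matrix_mult_zero_right: "(A :: complex^'b^'d) ** (0 :: complex^'c^'b) = 0"
  by (simp add: vec_eq_iff matrix_matrix_mult_def)

lemma matrix_mult_sum:
  fixes A :: "'i \<Rightarrow> complex^'b^'d" and B :: "complex^'c^'b"
  shows "(\<Sum>i\<in>S. A i) ** B = (\<Sum>i\<in>S. A i ** B)"
  by (induction S rule: infinite_finite_induct) (auto simp: matrix_add_rdistrib matrix_mult_zero_left)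

lemma matrix_mult_sum_right:
  fixes B :: "'i \<Rightarrow> complex^'c^'b" and A :: "complex^'b^'d"
  shows "A ** (\<Sum>i\<in>S. B i) = (\<Sum>i\<in>S. A ** B i)"
  by (induction S rule: infinite_finite_induct) (auto simp: matrix_add_ldistrib matrix_mult_zero_right)

lemma trace_csm: "trace (csm c A) = c * trace A"
  by (simp add: trace_def csm_def sum_distrib_left)

lemma trace_zero [simp]: "trace (0 :: complex^'n^'n) = 0"
  by (simp add: trace_def)

lemma trace_minus: "trace (- A :: complex^'n^'n) = - trace A"
  by (simp add: trace_def sum_negf)

lemma trace_sum: "trace (\<Sum>i\<in>S. A i :: complex^'n^'n) = (\<Sum>i\<in>S. trace (A i))"
  by (induction S rule: infinite_finite_induct) (auto simp: trace_add)

text \<open>Vanishing of the interior product with \<open>x\<close>, phrased for every position of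
  \<open>x\<close> so that it passes to the sublists in a wedge product. Forms pulled back from the
  fibre kill base vectors.\<close>

definition kills :: "'v \<Rightarrow> ('v list \<Rightarrow> complex) \<Rightarrow> bool" where
  "kills x \<alpha> \<longleftrightarrow> (\<forall>l. x \<in> set l \<longrightarrow> \<alpha> l = 0)"

lemma kills_wedge:
  assumes "kills x \<alpha>" "kills x \<beta>"
  shows "kills x (wedge \<alpha> \<beta>)"
  unfolding kills_def wedge_by_def
proof (intro allI impI sum.neutral ballI)
  fix l I assume "x \<in> set l"
  then have "x \<in> set (nths l I) \<or> x \<in> set (nths l (- I))"
    by (auto simp: set_nths in_set_conv_nth)
  then show "shuffle_sign (length l) I *\<^sub>R (\<alpha> (nths l I) * \<beta> (nths l (- I))) = 0"
    using assms by (auto simp: kills_def)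
qed

lemma kills_kaehler_pow:
  assumes "\<And>\<alpha>. x (\<iota> \<alpha>) = 0"
  shows "kills x (kaehler_pow \<iota> G m)"
proof -
  have "kills x (wedge (dz (\<iota> a)) (dzbar (\<iota> b)))" for a b
    by (intro kills_wedge) (auto simp: kills_def dz_def dzbar_def length_Suc_conv assms)
  then have "kills x (kaehler_form \<iota> G)" by (simp add: kills_def kaehler_form_def)
  then have "kills x (wedge_pow (kaehler_form \<iota> G) m)"
  proof (induction m)
    case 0
    then show ?case by (auto simp: kills_def)
  next
    case (Suc m)
    then show ?case by (simp add: kills_wedge)
  qed
  then show ?thesis by (simp add: kills_def kaehler_pow_def)
qed

lemma wedge_kills: "kills x \<beta> \<Longrightarrow> wedge \<alpha> \<beta> (x # L) = wedge (contr x \<alpha>) \<beta> L"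
  by (simp add: wedge_Cons kills_def)

text \<open>Both base vectors must go into \<alpha>, which then has no slot left for the
  frame.\<close>

lemma wedge_base_pair:
  assumes "form_deg 2 \<alpha>" "kills u \<beta>" "kills v \<beta>"
  shows "wedge \<alpha> \<beta> (u # v # F) = \<alpha> [u, v] * \<beta> F"
proof -
  have "form_deg 0 (\<lambda>l. \<alpha> (u # v # l))" using assms(1) by (auto simp: form_deg_def)
  then show ?thesis by (simp add: wedge_kills assms wedge_scalar_left)
qed

text \<open>The six ways to split four vectors into two pairs group into three, since exchanging the
  two pairs preserves the shuffle sign and, by cyclicity, the trace. This is the origin of the
  factors 2.\<close>

lemma trace_wedge_square:
  fixes \<Omega> :: "'v list \<Rightarrow> complex^'r^'r"
  assumes "form_deg 2 \<Omega>"
  shows "trace (wedge_by (**) \<Omega> \<Omega> [u, v, a, b]) = 2 * trace (\<Omega> [u, v] ** \<Omega> [a, b]) -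
    2 * trace (\<Omega> [u, a] ** \<Omega> [v, b]) + 2 * trace (\<Omega> [u, b] ** \<Omega> [v, a])"
proof -
  have mul: "(r *\<^sub>R A) ** B = r *\<^sub>R (A ** B)" for r and A B :: "complex^'r^'r"
    by (simp add: vec_eq_iff matrix_matrix_mult_def scaleR_sum_right)
  have z: "\<Omega> l = 0" if "length l \<noteq> 2" for l using assms that by (auto simp: form_deg_def)
  show ?thesis
    apply (simp add: wedge_by_Cons[of "(**)", OF mul] wedge_by_Nil z mul matrix_mult_zero_left matrix_mult_zero_right matrix_mult_minus trace_add trace_sub trace_minus)
    apply (simp add: trace_mul_sym[of "\<Omega> [v, b]"] trace_mul_sym[of "\<Omega> [v, a]"] trace_mul_sym[of "\<Omega> [a, b]"])
    done
qed

lemma trace_mult_sums: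
  fixes A :: "'i \<Rightarrow> complex^'b^'d" and B :: "'j \<Rightarrow> complex^'d^'b"
  shows "trace ((\<Sum>i\<in>S. csm (f i) (A i)) ** (\<Sum>j\<in>T. csm (g j) (B j))) =
    (\<Sum>i\<in>S. \<Sum>j\<in>T. f i * g j * trace (A i ** B j))"
  unfolding matrix_mult_sum trace_sum
  by (simp only: matrix_mult_sum_right trace_sum csm_mult_left csm_mult_right csm_csm trace_csm mult.commute)

text \<open>Since the Kaehler power kills \<open>u'\<close> and \<open>v'\<close>, both go into the
  square of the curvature. What remains is a fibre 2-form whose part of type (1,1) alone survives,
  by \<open>wedge_kaehler_pow_type\<close>.\<close>

lemma trace_wedge_square_fibre:
  fixes u v :: "nat \<Rightarrow> complex" and Rm :: "'n::finite + nat \<Rightarrow> 'n + nat \<Rightarrow> complex^'r^'r"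
    and G :: "complex^'n^'n"
  defines "u' \<equiv> case_sum (\<lambda>_. 0) u" and "v' \<equiv> case_sum (\<lambda>_. 0) v"
  assumes \<Omega>: "\<And>x y. \<Omega> [x, y] = (\<Sum>k\<in>UNIV <+> {..<N}. \<Sum>l\<in>UNIV <+> {..<N}. csm (x k * cnj (y l) - y k * cnj (x l)) (Rm k l))"
    and deg: "form_deg 2 \<Omega>" and F: "has_frame Inl F" "\<And>a i. a \<in> set F \<Longrightarrow> a (Inr i) = 0"
    and G: "invertible G"
  shows "wedge (\<lambda>us. trace (wedge_by (**) \<Omega> \<Omega> us)) (kaehler_pow Inl G m) (u' # v' # F) =
    2 * \<i> * (\<Sum>i<N. \<Sum>j<N. wedge (dz i) (dzbar j) [u, v] *
      (trace (\<Sum>\<alpha>\<in>UNIV. \<Sum>\<beta>\<in>UNIV. csm (matrix_inv G $ \<beta> $ \<alpha>) (Rm (Inr i) (Inl \<beta>) ** Rm (Inl \<alpha>) (Inr j))) -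
       trace (Rm (Inr i) (Inr j) ** (\<Sum>\<alpha>\<in>UNIV. \<Sum>\<beta>\<in>UNIV. csm (matrix_inv G $ \<beta> $ \<alpha>) (Rm (Inl \<alpha>) (Inl \<beta>))))))
    * kaehler_pow Inl G (Suc m) F"
proof -
  define w where "w = (\<lambda>i j. u i * cnj (v j) - v i * cnj (u j))"
  \<comment> \<open>\<open>K\<close> is the curvature on the two base vectors. \<open>P\<close> and
    \<open>Q\<close> are, up to sign, the coefficients of \<open>dzbar\<close> and \<open>dz\<close>
    in the curvature contracted with one base vector. \<open>A\<close>, \<open>B\<close> and
    \<open>C\<close> are the coefficients of \<eta> of types (1,1), (2,0) and (0,2).\<close>
  define K where "K = (\<Sum>i<N. \<Sum>j<N. csm (w i j) (Rm (Inr i) (Inr j)))"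
  define P where "P = (\<lambda>u \<beta>. \<Sum>i<N. csm (u i) (Rm (Inr i) (Inl \<beta>)))"
  define Q where "Q = (\<lambda>u \<alpha>. \<Sum>j<N. csm (cnj (u j)) (Rm (Inl \<alpha>) (Inr j)))"
  define \<eta> where "\<eta> = (\<lambda>l. trace (wedge_by (**) \<Omega> \<Omega> (u' # v' # l)))"
  define A where "A = (\<lambda>\<alpha> \<beta>. 2 * trace (K ** Rm (Inl \<alpha>) (Inl \<beta>)) -
    2 * (trace (P u \<beta> ** Q v \<alpha>) - trace (Q u \<alpha> ** P v \<beta>)))"
  define B where "B = (\<lambda>\<alpha> \<beta>. - 2 * trace (Q u \<alpha> ** Q v \<beta>))"
  define C where "C = (\<lambda>\<alpha> \<beta>. - 2 * trace (P u \<alpha> ** P v \<beta>))"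
  have ww: "wedge (dz i) (dzbar j) [u, v] = w i j" for i j
    by (simp add: wedge_dz_dzbar w_def)
  have uv: "\<Omega> [u', v'] = K"
    unfolding \<Omega> u'_def v'_def by (simp add: sum.Plus K_def w_def)
  have ua: "\<Omega> [case_sum (\<lambda>_. 0) u, a] = (\<Sum>\<beta>\<in>UNIV. csm (cnj (a (Inl \<beta>))) (P u \<beta>)) - (\<Sum>\<alpha>\<in>UNIV. csm (a (Inl \<alpha>)) (Q u \<alpha>))"
    if "a \<in> set F" for a u
    unfolding \<Omega> P_def Q_def using F(2)[OF that]
    by (simp add: sum.Plus csm_minus_left sum_negf csm_sum csm_csm sum.swap[of _ "{..<N}" UNIV] mult.commute)
  have ab: "\<Omega> [a, b] = (\<Sum>\<alpha>\<in>UNIV. \<Sum>\<beta>\<in>UNIV. csm (a (Inl \<alpha>) * cnj (b (Inl \<beta>)) - b (Inl \<alpha>) * cnj (a (Inl \<beta>))) (Rm (Inl \<alpha>) (Inl \<beta>)))"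
    if "a \<in> set F" "b \<in> set F" for a b
    unfolding \<Omega> using F(2)[OF that(1)] F(2)[OF that(2)] by (simp add: sum.Plus)
  have tr: "trace (\<Omega> [case_sum (\<lambda>_. 0) u, a] ** \<Omega> [case_sum (\<lambda>_. 0) v, b]) =
      (\<Sum>\<alpha>\<in>UNIV. \<Sum>\<beta>\<in>UNIV. cnj (a (Inl \<alpha>)) * cnj (b (Inl \<beta>)) * trace (P u \<alpha> ** P v \<beta>)
        - cnj (a (Inl \<beta>)) * b (Inl \<alpha>) * trace (P u \<beta> ** Q v \<alpha>)
        - a (Inl \<alpha>) * cnj (b (Inl \<beta>)) * trace (Q u \<alpha> ** P v \<beta>)
        + a (Inl \<alpha>) * b (Inl \<beta>) * trace (Q u \<alpha> ** Q v \<beta>))"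
    if ab: "a \<in> set F" "b \<in> set F" for a b
  proof -
    \<comment> \<open>Indices are arranged so that in both mixed products \<alpha> belongs to
      \<open>dz\<close> and \<beta> to \<open>dzbar\<close>.\<close>
    have sw: "(\<Sum>\<alpha>\<in>UNIV. \<Sum>\<beta>\<in>UNIV. cnj (a (Inl \<beta>)) * b (Inl \<alpha>) * trace (P u \<beta> ** Q v \<alpha>)) =
      (\<Sum>\<beta>\<in>UNIV. \<Sum>\<alpha>\<in>UNIV. cnj (a (Inl \<beta>)) * b (Inl \<alpha>) * trace (P u \<beta> ** Q v \<alpha>))"
      by (rule sum.swap)
    show ?thesis
      unfolding ua[OF ab(1)] ua[OF ab(2)] sum.distrib sum_subtractf sw
      by (simp add: matrix_mult_diff trace_sub trace_mult_sums)
  qed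
  have trO: "trace (K ** \<Omega> [a, b]) = (\<Sum>\<alpha>\<in>UNIV. \<Sum>\<beta>\<in>UNIV.
      (a (Inl \<alpha>) * cnj (b (Inl \<beta>)) - b (Inl \<alpha>) * cnj (a (Inl \<beta>))) * trace (K ** Rm (Inl \<alpha>) (Inl \<beta>)))"
    if "a \<in> set F" "b \<in> set F" for a b
    unfolding ab[OF that] by (simp add: matrix_mult_sum_right csm_mult_right trace_sum trace_csm)
  have \<eta>: "\<eta> l = (\<Sum>\<alpha>\<in>UNIV. \<Sum>\<beta>\<in>UNIV.
      A \<alpha> \<beta> * wedge (dz (Inl \<alpha>)) (dzbar (Inl \<beta>)) l + B \<alpha> \<beta> * wedge (dz (Inl \<alpha>)) (dz (Inl \<beta>)) l +
      C \<alpha> \<beta> * wedge (dzbar (Inl \<alpha>)) (dzbar (Inl \<beta>)) l)" if l: "set l \<subseteq> set F" for l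
  proof (cases "length l = 2")
    case True
    then obtain a b where lab: "l = [a, b]" by (auto simp: length_Suc_conv numeral_2_eq_2)
    with l have ab: "a \<in> set F" "b \<in> set F" by auto
    have "\<eta> l = 2 * trace (K ** \<Omega> [a, b]) - 2 * trace (\<Omega> [u', a] ** \<Omega> [v', b]) + 2 * trace (\<Omega> [u', b] ** \<Omega> [v', a])"
      unfolding \<eta>_def lab trace_wedge_square[OF deg] uv ..
    then show ?thesis
      unfolding u'_def v'_def trO[OF ab] tr[OF ab] tr[OF ab(2,1)] lab wedge_dz_dzbar wedge_dz_dz wedge_dzbar_dzbar
        sum_distrib_left sum_subtractf[symmetric] sum.distrib[symmetric] A_def B_def C_def
      by (simp only:) (intro sum.cong refl, simp add: algebra_simps)
  next
    case False
    have "form_deg (2 + 2) (wedge_by (**) \<Omega> \<Omega>)"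
      by (intro form_deg_wedge_by deg matrix_mult_zero_left matrix_mult_zero_right)
    with False have "\<eta> l = 0" by (auto simp: \<eta>_def form_deg_def)
    moreover have "form_deg (1 + 1) (wedge (dz k) (dzbar k'))" "form_deg (1 + 1) (wedge (dz k) (dz k'))"
      "form_deg (1 + 1) (wedge (dzbar k) (dzbar k'))" for k k' :: "'n + nat"
      by (intro form_deg_wedge form_deg_dz form_deg_dzbar)+
    ultimately show ?thesis using False by (simp add: form_deg_def)
  qed
  have k: "kills u' (kaehler_pow Inl G m)" "kills v' (kaehler_pow Inl G m)"
    by (intro kills_kaehler_pow, simp add: u'_def v'_def)+
  have "wedge (\<lambda>us. trace (wedge_by (**) \<Omega> \<Omega> us)) (kaehler_pow Inl G m) (u' # v' # F) =
      wedge \<eta> (kaehler_pow Inl G m) F"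
    by (simp add: wedge_kills k \<eta>_def)
  also have "\<dots> = - \<i> * (\<Sum>\<alpha>\<in>UNIV. \<Sum>\<beta>\<in>UNIV. matrix_inv G $ \<beta> $ \<alpha> * A \<alpha> \<beta>) * kaehler_pow Inl G (Suc m) F"
    by (rule wedge_kaehler_pow_type[OF inj_Inl F(1) G \<eta>])
  also have "(\<Sum>\<alpha>\<in>UNIV. \<Sum>\<beta>\<in>UNIV. matrix_inv G $ \<beta> $ \<alpha> * A \<alpha> \<beta>) =
    (\<Sum>\<alpha>\<in>UNIV. \<Sum>\<beta>\<in>UNIV. \<Sum>i<N. \<Sum>j<N. 2 * (w i j * (matrix_inv G $ \<beta> $ \<alpha> *
      (trace (Rm (Inr i) (Inr j) ** Rm (Inl \<alpha>) (Inl \<beta>)) - trace (Rm (Inr i) (Inl \<beta>) ** Rm (Inl \<alpha>) (Inr j))))))"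
  proof (intro sum.cong refl)
    fix \<alpha> \<beta>
    have 1: "trace (P u \<beta> ** Q v \<alpha>) = (\<Sum>i<N. \<Sum>j<N. u i * cnj (v j) * trace (Rm (Inr i) (Inl \<beta>) ** Rm (Inl \<alpha>) (Inr j)))" for u v
      unfolding P_def Q_def by (rule trace_mult_sums)
    have 2: "trace (K ** Rm (Inl \<alpha>) (Inl \<beta>)) = (\<Sum>i<N. \<Sum>j<N. w i j * trace (Rm (Inr i) (Inr j) ** Rm (Inl \<alpha>) (Inl \<beta>)))"
      unfolding K_def by (simp add: matrix_mult_sum csm_mult_left trace_sum trace_csm)
    \<comment> \<open>Cyclicity of the trace turns the product of \<open>Q\<close> and
      \<open>P\<close> into one of \<open>P\<close> and \<open>Q\<close>, so the two mixed terms
      combine to the coefficient \<open>w i j\<close>, antisymmetric in \<open>u\<close> and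
      \<open>v\<close>.\<close>
    show "matrix_inv G $ \<beta> $ \<alpha> * A \<alpha> \<beta> = (\<Sum>i<N. \<Sum>j<N. 2 * (w i j * (matrix_inv G $ \<beta> $ \<alpha> *
      (trace (Rm (Inr i) (Inr j) ** Rm (Inl \<alpha>) (Inl \<beta>)) - trace (Rm (Inr i) (Inl \<beta>) ** Rm (Inl \<alpha>) (Inr j))))))"
      unfolding A_def trace_mul_sym[of "Q u \<alpha>"] 1 2 sum_distrib_left sum_subtractf[symmetric]
      by (intro sum.cong refl) (simp add: w_def algebra_simps)
  qed
  also have "\<dots> = (\<Sum>i<N. \<Sum>j<N. \<Sum>\<alpha>\<in>UNIV. \<Sum>\<beta>\<in>UNIV. 2 * (w i j * (matrix_inv G $ \<beta> $ \<alpha> *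
      (trace (Rm (Inr i) (Inr j) ** Rm (Inl \<alpha>) (Inl \<beta>)) - trace (Rm (Inr i) (Inl \<beta>) ** Rm (Inl \<alpha>) (Inr j))))))"
    by (simp only: sum.swap[of _ "{..<N}" "UNIV :: 'n set"])
  also have "\<dots> = 2 * (\<Sum>i<N. \<Sum>j<N. wedge (dz i) (dzbar j) [u, v] *
      (trace (Rm (Inr i) (Inr j) ** (\<Sum>\<alpha>\<in>UNIV. \<Sum>\<beta>\<in>UNIV. csm (matrix_inv G $ \<beta> $ \<alpha>) (Rm (Inl \<alpha>) (Inl \<beta>)))) -
       trace (\<Sum>\<alpha>\<in>UNIV. \<Sum>\<beta>\<in>UNIV. csm (matrix_inv G $ \<beta> $ \<alpha>) (Rm (Inr i) (Inl \<beta>) ** Rm (Inl \<alpha>) (Inr j)))))"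
    unfolding ww
    by (simp add: matrix_mult_sum_right csm_mult_right trace_sum trace_csm sum_distrib_left sum_subtractf[symmetric] algebra_simps)
  finally show ?thesis
    by (simp add: sum_negf[symmetric] sum_distrib_left algebra_simps)
qed

section \<open>Wirtinger calculus\<close>

lemma line_in_0 [simp]: "line_in c k p 0 = p"
  by (simp add: line_in_def)

lemma line_in_add: "line_in c k (line_in c k p s) t = line_in c k p (s + t)"
  by (rule ext) (auto simp: line_in_def algebra_simps)

lemma line_in_commute: "line_in d l (line_in c k p s) t = line_in c k (line_in d l p t) s"
  by (rule ext) (auto simp: line_in_def algebra_simps)

lemma continuous_line_in: "continuous_on S (\<lambda>z. line_in d l (line_in c k p (fst z)) (snd z))"
proof (rule continuous_on_coordinatewise_then_product)
  fix i
  show "continuous_on S (\<lambda>z. line_in d l (line_in c k p (fst z)) (snd z) i)"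
    by (cases "i = l"; cases "i = k"; cases "k = l") (auto simp: line_in_def intro!: continuous_intros)
qed

text \<open>Openness is relative to the coordinate space, so both directions must be active; moving
  along them keeps the inactive coordinates zero.\<close>

lemma copen_plane:
  assumes "copen I \<Omega>" "p \<in> \<Omega>" "k \<in> I" "l \<in> I"
  obtains e where "e > 0" "\<And>s t. \<bar>s\<bar> < e \<Longrightarrow> \<bar>t\<bar> < e \<Longrightarrow> line_in d l (line_in c k p s) t \<in> \<Omega>"
proof -
  obtain V where V: "open V" "\<Omega> = coord_space I \<inter> V"
    using assms(1) unfolding copen_def openin_open by blast
  let ?f = "\<lambda>z::real \<times> real. line_in d l (line_in c k p (fst z)) (snd z)"
  have "open (?f -` V)"
    by (rule open_vimage[OF V(1) continuous_line_in])
  moreover have "(0, 0) \<in> ?f -` V" using assms V by auto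
  ultimately obtain A B where AB: "open A" "open B" "0 \<in> A" "0 \<in> B" "A \<times> B \<subseteq> ?f -` V"
    by (elim open_prod_elim) auto
  obtain a b where ab: "a > 0" "b > 0" "ball 0 a \<subseteq> A" "ball 0 b \<subseteq> B"
    using AB(1-4) by (meson open_contains_ball)
  show ?thesis
  proof (rule that[of "min a b"])
    show "min a b > 0" using ab by simp
    fix s t :: real assume "\<bar>s\<bar> < min a b" "\<bar>t\<bar> < min a b"
    then have "(s, t) \<in> A \<times> B" using ab by (auto simp: dist_real_def)
    with AB(5) have "line_in d l (line_in c k p s) t \<in> V" by auto
    moreover have "line_in d l (line_in c k p s) t \<in> coord_space I"
      using assms V by (auto simp: coord_space_def line_in_def)
    ultimately show "line_in d l (line_in c k p s) t \<in> \<Omega>" using V by simp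
  qed
qed

lemma copen_line:
  assumes "copen I \<Omega>" "p \<in> \<Omega>" "k \<in> I"
  shows "\<forall>\<^sub>F t in nhds 0. line_in c k p t \<in> \<Omega>"
proof -
  obtain e where e: "e > 0" "\<And>s t. \<bar>s\<bar> < e \<Longrightarrow> \<bar>t\<bar> < e \<Longrightarrow> line_in c k (line_in c k p s) t \<in> \<Omega>"
    using copen_plane[OF assms assms(3), of c c] by blast
  have "line_in c k p t \<in> \<Omega>" if "dist t 0 < e" for t
    using e(2)[of 0 t] e(1) that by simp
  with e(1) show ?thesis
    unfolding eventually_nhds_metric by blast
qed

lemma pd_cong:
  assumes "copen I \<Omega>" "p \<in> \<Omega>" "k \<in> I" "\<And>q. q \<in> \<Omega> \<Longrightarrow> f q = g q"
  shows "pd c k f p = pd c k g p"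
  unfolding pd_def
proof (rule vector_derivative_cong_eq)
  show "\<forall>\<^sub>F t in nhds 0. t \<in> UNIV \<longrightarrow> f (line_in c k p t) = g (line_in c k p t)"
    using copen_line[OF assms(1-3), of c] by eventually_elim (simp add: assms(4))
qed simp_all

lemma dd_cong:
  assumes "copen I \<Omega>" "p \<in> \<Omega>" "k \<in> I" "\<And>q. q \<in> \<Omega> \<Longrightarrow> f q = g q"
  shows "dd k f p = dd k g p" and "ddbar k f p = ddbar k g p"
  unfolding dd_def ddbar_def using pd_cong[OF assms] by simp_all

text \<open>Regularity is usually proved for a formula, such as Cramer's rule, that agrees with the
  function in question only on \<Omega>.\<close>

lemma Ck_cong:
  assumes "copen I \<Omega>" "\<And>q. q \<in> \<Omega> \<Longrightarrow> f q = g q" "Ck I m \<Omega> f"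
  shows "Ck I m \<Omega> g"
  using assms(2,3)
proof (induction m arbitrary: f g)
  case 0
  then show ?case using continuous_on_cong[of \<Omega> \<Omega> f g] by simp
next
  case (Suc m)
  have "(\<lambda>t. g (line_in c k p t)) differentiable (at 0)" if "k \<in> I" "c \<in> {1, \<i>}" "p \<in> \<Omega>" for k c p
  proof -
    have ev: "\<forall>\<^sub>F t in nhds 0. f (line_in c k p t) = g (line_in c k p t)"
      using copen_line[OF assms(1) that(3,1), of c] by eventually_elim (rule Suc.prems(1))
    then have ev': "\<forall>\<^sub>F t in at 0. f (line_in c k p t) = g (line_in c k p t)"
      by (simp add: eventually_at_filter eventually_mono)
    have "(\<lambda>t. f (line_in c k p t)) differentiable (at 0)" using Suc.prems(2) that by auto
    then obtain D where D: "((\<lambda>t. f (line_in c k p t)) has_derivative D) (at 0)"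
      by (auto simp: differentiable_def)
    from has_derivative_transform_eventually[OF D ev' eventually_nhds_x_imp_x[OF ev]]
    have "((\<lambda>t. g (line_in c k p t)) has_derivative D) (at 0)" by simp
    then show ?thesis by (auto simp: differentiable_def)
  qed
  moreover have "Ck I m \<Omega> (pd c k g)" if "k \<in> I" "c \<in> {1, \<i>}" for k c
    using Suc.IH[of "pd c k f" "pd c k g"] pd_cong[OF assms(1) _ that(1) Suc.prems(1)] Suc.prems(2) that by auto
  moreover have "continuous_on \<Omega> g"
    using Suc.prems continuous_on_cong[of \<Omega> \<Omega> f g] by simp
  ultimately show ?case by simp
qed

section \<open>Closure properties of the classes \<open>Ck\<close>\<close>

lemma Ck_pd: "Ck I (Suc m) \<Omega> f \<Longrightarrow> k \<in> I \<Longrightarrow> c \<in> {1, \<i>} \<Longrightarrow> Ck I m \<Omega> (pd c k f)"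
  by (simp only: Ck.simps(2))

lemma Ck_Suc_D: "Ck I (Suc m) \<Omega> f \<Longrightarrow> Ck I m \<Omega> f"
proof (induction m arbitrary: f)
  case (Suc m)
  have "Ck I m \<Omega> (pd c k f)" if "k \<in> I" "c \<in> {1, \<i>}" for k c
    by (rule Suc.IH[OF Ck_pd[OF Suc.prems that]])
  moreover from Suc.prems have "continuous_on \<Omega> f"
    "\<forall>k\<in>I. \<forall>c\<in>{1, \<i>}. \<forall>p\<in>\<Omega>. (\<lambda>t. f (line_in c k p t)) differentiable (at 0)"
    by (subst (asm) Ck.simps(2), blast)+
  ultimately show ?case by (subst Ck.simps(2)) blast
qed simp

lemma Ck_mono: "Ck I n \<Omega> f \<Longrightarrow> m \<le> n \<Longrightarrow> Ck I m \<Omega> f"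
  by (induction n) (auto dest: Ck_Suc_D simp: le_Suc_eq simp del: Ck.simps(2))

lemma Ck_continuous: "Ck I m \<Omega> f \<Longrightarrow> continuous_on \<Omega> f"
  by (cases m) auto

lemma has_vector_derivative_pd:
  assumes "Ck I (Suc m) \<Omega> f" "k \<in> I" "c \<in> {1, \<i>}" "p \<in> \<Omega>"
  shows "((\<lambda>t. f (line_in c k p t)) has_vector_derivative pd c k f p) (at 0)"
  using assms unfolding pd_def by (auto simp: vector_derivative_works)

lemma pd_eqI: "((\<lambda>t. f (line_in c k p t)) has_vector_derivative D) (at 0) \<Longrightarrow> pd c k f p = D"
  unfolding pd_def by (rule vector_derivative_at)

text \<open>Lets the derivative be given by an explicit formula \<open>D\<close>, to which an
  induction on the order applies, in place of the opaque \<open>pd\<close>.\<close>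

lemma Ck_SucI:
  assumes "copen I \<Omega>" "continuous_on \<Omega> f"
    "\<And>k c p. k \<in> I \<Longrightarrow> c \<in> {1, \<i>} \<Longrightarrow> p \<in> \<Omega> \<Longrightarrow> ((\<lambda>t. f (line_in c k p t)) has_vector_derivative D c k p) (at 0)"
    "\<And>k c. k \<in> I \<Longrightarrow> c \<in> {1, \<i>} \<Longrightarrow> Ck I m \<Omega> (D c k)"
  shows "Ck I (Suc m) \<Omega> f"
proof -
  have "Ck I m \<Omega> (pd c k f)" if "k \<in> I" "c \<in> {1, \<i>}" for k c
    by (rule Ck_cong[OF assms(1) _ assms(4)[OF that]]) (simp add: pd_eqI[OF assms(3)[OF that]])
  moreover have "(\<lambda>t. f (line_in c k p t)) differentiable (at 0)" if "k \<in> I" "c \<in> {1, \<i>}" "p \<in> \<Omega>" for k c p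
    using assms(3)[OF that] by (rule differentiableI_vector)
  ultimately show ?thesis using assms(2) by simp
qed

lemma Ck_const: "Ck I m \<Omega> (\<lambda>_. a)"
proof (induction m arbitrary: a)
  case (Suc m)
  have "pd c k (\<lambda>_. a) = (\<lambda>_. 0)" for c :: complex and k :: 'a
    by (rule ext) (simp add: pd_def)
  with Suc show ?case by simp
qed auto

lemma has_vector_derivative_pd_add:
  assumes "Ck I (Suc m) \<Omega> f" "Ck I (Suc m) \<Omega> g" "k \<in> I" "c \<in> {1, \<i>}" "p \<in> \<Omega>"
  shows "((\<lambda>t. f (line_in c k p t) + g (line_in c k p t)) has_vector_derivative pd c k f p + pd c k g p) (at 0)"
  by (intro has_vector_derivative_add has_vector_derivative_pd[OF assms(1,3-5)] has_vector_derivative_pd[OF assms(2-5)])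

lemma has_vector_derivative_pd_mult:
  assumes "Ck I (Suc m) \<Omega> f" "Ck I (Suc m) \<Omega> g" "k \<in> I" "c \<in> {1, \<i>}" "p \<in> \<Omega>"
  shows "((\<lambda>t. f (line_in c k p t) * g (line_in c k p t)) has_vector_derivative f p * pd c k g p + pd c k f p * g p) (at 0)"
  using has_vector_derivative_mult[OF has_vector_derivative_pd[OF assms(1,3-5)] has_vector_derivative_pd[OF assms(2-5)]]
  by simp

lemma has_vector_derivative_pd_cnj:
  assumes "Ck I (Suc m) \<Omega> f" "k \<in> I" "c \<in> {1, \<i>}" "p \<in> \<Omega>"
  shows "((\<lambda>t. cnj (f (line_in c k p t))) has_vector_derivative cnj (pd c k f p)) (at 0)"
  by (rule bounded_linear.has_vector_derivative[OF bounded_linear_cnj has_vector_derivative_pd[OF assms]])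

lemma Ck_add:
  assumes \<Omega>: "copen I \<Omega>" shows "Ck I m \<Omega> f \<Longrightarrow> Ck I m \<Omega> g \<Longrightarrow> Ck I m \<Omega> (\<lambda>p. f p + g p)"
proof (induction m arbitrary: f g)
  case 0
  then show ?case by (simp add: continuous_on_add)
next
  case (Suc m)
  show ?case
  proof (rule Ck_SucI[OF \<Omega>])
    show "continuous_on \<Omega> (\<lambda>p. f p + g p)"
      by (intro continuous_on_add Ck_continuous[OF Suc.prems(1)] Ck_continuous[OF Suc.prems(2)])
    fix k c assume kc: "k \<in> I" "c \<in> {1, \<i>}"
    show "Ck I m \<Omega> (\<lambda>p. pd c k f p + pd c k g p)"
      by (rule Suc.IH[OF Ck_pd[OF Suc.prems(1) kc] Ck_pd[OF Suc.prems(2) kc]])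
  qed (rule has_vector_derivative_pd_add[OF Suc.prems])
qed

lemma Ck_mult:
  assumes \<Omega>: "copen I \<Omega>" shows "Ck I m \<Omega> f \<Longrightarrow> Ck I m \<Omega> g \<Longrightarrow> Ck I m \<Omega> (\<lambda>p. f p * g p)"
proof (induction m arbitrary: f g)
  case 0
  then show ?case by (simp add: continuous_on_mult)
next
  case (Suc m)
  show ?case
  proof (rule Ck_SucI[OF \<Omega>])
    show "continuous_on \<Omega> (\<lambda>p. f p * g p)"
      by (intro continuous_on_mult Ck_continuous[OF Suc.prems(1)] Ck_continuous[OF Suc.prems(2)])
    fix k c assume kc: "k \<in> I" "c \<in> {1, \<i>}"
    show "Ck I m \<Omega> (\<lambda>p. f p * pd c k g p + pd c k f p * g p)"
      by (rule Ck_add[OF \<Omega> Suc.IH[OF Ck_Suc_D[OF Suc.prems(1)] Ck_pd[OF Suc.prems(2) kc]]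
            Suc.IH[OF Ck_pd[OF Suc.prems(1) kc] Ck_Suc_D[OF Suc.prems(2)]]])
  qed (rule has_vector_derivative_pd_mult[OF Suc.prems])
qed

lemma Ck_cnj:
  assumes \<Omega>: "copen I \<Omega>" shows "Ck I m \<Omega> f \<Longrightarrow> Ck I m \<Omega> (\<lambda>p. cnj (f p))"
proof (induction m arbitrary: f)
  case 0
  then show ?case by (simp add: continuous_on_cnj)
next
  case (Suc m)
  show ?case
  proof (rule Ck_SucI[OF \<Omega>])
    show "continuous_on \<Omega> (\<lambda>p. cnj (f p))"
      by (intro continuous_on_cnj Ck_continuous[OF Suc.prems])
    fix k c assume kc: "k \<in> I" "c \<in> {1, \<i>}"
    show "Ck I m \<Omega> (\<lambda>p. cnj (pd c k f p))"
      by (rule Suc.IH[OF Ck_pd[OF Suc.prems kc]])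
  qed (rule has_vector_derivative_pd_cnj[OF Suc.prems])
qed

lemma Ck_scale: "copen I \<Omega> \<Longrightarrow> Ck I m \<Omega> f \<Longrightarrow> Ck I m \<Omega> (\<lambda>p. a * f p)"
  by (intro Ck_mult Ck_const)

lemma Ck_minus: "copen I \<Omega> \<Longrightarrow> Ck I m \<Omega> f \<Longrightarrow> Ck I m \<Omega> (\<lambda>p. - f p)"
  using Ck_scale[of I \<Omega> m f "-1"] by simp

lemma Ck_diff: "copen I \<Omega> \<Longrightarrow> Ck I m \<Omega> f \<Longrightarrow> Ck I m \<Omega> g \<Longrightarrow> Ck I m \<Omega> (\<lambda>p. f p - g p)"
  using Ck_add[of I \<Omega> m f "\<lambda>p. - g p"] Ck_minus[of I \<Omega> m g] by simp

text \<open>The derivative -f'/f^2 contains the reciprocal only undifferentiated, so the induction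
  hypothesis of one order less covers it.\<close>

lemma Ck_inverse:
  assumes \<Omega>: "copen I \<Omega>" and nz: "\<And>p. p \<in> \<Omega> \<Longrightarrow> f p \<noteq> 0"
  shows "Ck I m \<Omega> f \<Longrightarrow> Ck I m \<Omega> (\<lambda>p. inverse (f p))"
proof (induction m)
  case 0
  then show ?case using nz by (simp add: continuous_on_inverse)
next
  case (Suc m)
  show ?case
  proof (rule Ck_SucI[OF \<Omega>, where D = "\<lambda>c k p. - (pd c k f p * (inverse (f p) * inverse (f p)))"])
    show "continuous_on \<Omega> (\<lambda>p. inverse (f p))"
      using nz Ck_continuous[OF Suc.prems] by (simp add: continuous_on_inverse)
    fix k c assume kc: "k \<in> I" "c \<in> {1, \<i>}"
    show "Ck I m \<Omega> (\<lambda>p. - (pd c k f p * (inverse (f p) * inverse (f p))))"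
      using Suc.prems kc by (intro Ck_minus Ck_mult \<Omega> Suc.IH Ck_Suc_D[OF Suc.prems] Ck_pd)
    fix p assume p: "p \<in> \<Omega>"
    have "(inverse has_field_derivative - (inverse (f p) * inverse (f p))) (at (f (line_in c k p 0)))"
      using nz[OF p] by (auto intro!: derivative_eq_intros simp: power2_eq_square)
    from field_vector_diff_chain_at[OF has_vector_derivative_pd[OF Suc.prems kc p] this]
    show "((\<lambda>t. inverse (f (line_in c k p t))) has_vector_derivative - (pd c k f p * (inverse (f p) * inverse (f p)))) (at 0)"
      by (simp add: o_def algebra_simps)
  qed
qed

lemma Ck_sum: "copen I \<Omega> \<Longrightarrow> (\<And>i. i \<in> S \<Longrightarrow> Ck I m \<Omega> (f i)) \<Longrightarrow> Ck I m \<Omega> (\<lambda>p. \<Sum>i\<in>S. f i p)"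
  by (induction S rule: infinite_finite_induct) (auto simp: Ck_const intro!: Ck_add)

lemma Ck_prod: "copen I \<Omega> \<Longrightarrow> (\<And>i. i \<in> S \<Longrightarrow> Ck I m \<Omega> (f i)) \<Longrightarrow> Ck I m \<Omega> (\<lambda>p. \<Prod>i\<in>S. f i p)"
  by (induction S rule: infinite_finite_induct) (auto simp: Ck_const intro!: Ck_mult)

section \<open>Rules for the Wirtinger derivatives\<close>

lemma Ck_dd:
  assumes "copen I \<Omega>" "Ck I (Suc m) \<Omega> f" "k \<in> I"
  shows "Ck I m \<Omega> (dd k f)" and "Ck I m \<Omega> (ddbar k f)"
proof -
  have pd: "Ck I m \<Omega> (pd c k f)" if "c \<in> {1, \<i>}" for c using Ck_pd[OF assms(2,3) that] .
  have "Ck I m \<Omega> (\<lambda>p. (1 / 2) * (pd 1 k f p - \<i> * pd \<i> k f p))"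
    "Ck I m \<Omega> (\<lambda>p. (1 / 2) * (pd 1 k f p + \<i> * pd \<i> k f p))"
    by (intro Ck_scale Ck_diff Ck_add assms(1) pd; simp)+
  then show "Ck I m \<Omega> (dd k f)" "Ck I m \<Omega> (ddbar k f)"
    by (simp_all add: dd_def[abs_def] ddbar_def[abs_def])
qed

lemma dd_add:
  assumes "Ck I (Suc m) \<Omega> f" "Ck I (Suc m) \<Omega> g" "k \<in> I" "p \<in> \<Omega>"
  shows "dd k (\<lambda>p. f p + g p) p = dd k f p + dd k g p"
    and "ddbar k (\<lambda>p. f p + g p) p = ddbar k f p + ddbar k g p"
proof -
  have "pd c k (\<lambda>p. f p + g p) p = pd c k f p + pd c k g p" if "c \<in> {1, \<i>}" for c
    by (rule pd_eqI[OF has_vector_derivative_pd_add[OF assms(1-3) that assms(4)]])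
  then show "dd k (\<lambda>p. f p + g p) p = dd k f p + dd k g p" "ddbar k (\<lambda>p. f p + g p) p = ddbar k f p + ddbar k g p"
    by (simp_all add: dd_def ddbar_def field_simps)
qed

lemma dd_mult:
  assumes "Ck I (Suc m) \<Omega> f" "Ck I (Suc m) \<Omega> g" "k \<in> I" "p \<in> \<Omega>"
  shows "dd k (\<lambda>p. f p * g p) p = dd k f p * g p + f p * dd k g p"
    and "ddbar k (\<lambda>p. f p * g p) p = ddbar k f p * g p + f p * ddbar k g p"
proof -
  have "pd c k (\<lambda>p. f p * g p) p = f p * pd c k g p + pd c k f p * g p" if "c \<in> {1, \<i>}" for c
    by (rule pd_eqI[OF has_vector_derivative_pd_mult[OF assms(1-3) that assms(4)]])
  then show "dd k (\<lambda>p. f p * g p) p = dd k f p * g p + f p * dd k g p"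
    "ddbar k (\<lambda>p. f p * g p) p = ddbar k f p * g p + f p * ddbar k g p"
    by (simp_all add: dd_def ddbar_def field_simps)
qed

lemma dd_cnj:
  assumes "Ck I (Suc m) \<Omega> f" "k \<in> I" "p \<in> \<Omega>"
  shows "dd k (\<lambda>p. cnj (f p)) p = cnj (ddbar k f p)"
    and "ddbar k (\<lambda>p. cnj (f p)) p = cnj (dd k f p)"
proof -
  have "pd c k (\<lambda>p. cnj (f p)) p = cnj (pd c k f p)" if "c \<in> {1, \<i>}" for c
    by (rule pd_eqI[OF has_vector_derivative_pd_cnj[OF assms(1,2) that assms(3)]])
  then show "dd k (\<lambda>p. cnj (f p)) p = cnj (ddbar k f p)" "ddbar k (\<lambda>p. cnj (f p)) p = cnj (dd k f p)"
    by (simp_all add: dd_def ddbar_def)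
qed

lemma dd_const [simp]: "dd k (\<lambda>_. a) p = 0" "ddbar k (\<lambda>_. a) p = 0"
  by (simp_all add: dd_def ddbar_def pd_def)

lemma dd_sum:
  assumes "copen I \<Omega>" "\<And>i. i \<in> S \<Longrightarrow> Ck I (Suc m) \<Omega> (f i)" "k \<in> I" "p \<in> \<Omega>"
  shows "dd k (\<lambda>p. \<Sum>i\<in>S. f i p) p = (\<Sum>i\<in>S. dd k (f i) p)"
    and "ddbar k (\<lambda>p. \<Sum>i\<in>S. f i p) p = (\<Sum>i\<in>S. ddbar k (f i) p)"
proof -
  have "dd k (\<lambda>p. \<Sum>i\<in>S. f i p) p = (\<Sum>i\<in>S. dd k (f i) p) \<and>
      ddbar k (\<lambda>p. \<Sum>i\<in>S. f i p) p = (\<Sum>i\<in>S. ddbar k (f i) p)"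
    using assms(2)
  proof (induction S rule: infinite_finite_induct)
    case (insert i S)
    then have "Ck I (Suc m) \<Omega> (f i)" "Ck I (Suc m) \<Omega> (\<lambda>p. \<Sum>i\<in>S. f i p)"
      using Ck_sum[OF assms(1), of S "Suc m" f] by auto
    then show ?case using insert dd_add[of I m \<Omega> "f i" "\<lambda>p. \<Sum>i\<in>S. f i p"] assms(3,4) by auto
  qed auto
  then show "dd k (\<lambda>p. \<Sum>i\<in>S. f i p) p = (\<Sum>i\<in>S. dd k (f i) p)"
    "ddbar k (\<lambda>p. \<Sum>i\<in>S. f i p) p = (\<Sum>i\<in>S. ddbar k (f i) p)" by auto
qed

text \<open>Schwarz's theorem: the second difference over a small square is evaluated by the mean
  value theorem twice, in either order of the variables, and continuity of both mixed derivatives at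
  the origin compares the results.\<close>

lemma mixed_derivatives_real:
  fixes F :: "real \<Rightarrow> real \<Rightarrow> real"
  assumes e: "e > 0"
    and d1: "\<And>s t. \<bar>s\<bar> < e \<Longrightarrow> \<bar>t\<bar> < e \<Longrightarrow> ((\<lambda>x. F x t) has_real_derivative Fs s t) (at s)"
    and d2: "\<And>s t. \<bar>s\<bar> < e \<Longrightarrow> \<bar>t\<bar> < e \<Longrightarrow> ((\<lambda>y. F s y) has_real_derivative Ft s t) (at t)"
    and d12: "\<And>s t. \<bar>s\<bar> < e \<Longrightarrow> \<bar>t\<bar> < e \<Longrightarrow> ((\<lambda>y. Fs s y) has_real_derivative Fst s t) (at t)"
    and d21: "\<And>s t. \<bar>s\<bar> < e \<Longrightarrow> \<bar>t\<bar> < e \<Longrightarrow> ((\<lambda>x. Ft x t) has_real_derivative Fts s t) (at s)"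
    and c12: "continuous_on ({-e<..<e} \<times> {-e<..<e}) (\<lambda>z. Fst (fst z) (snd z))"
    and c21: "continuous_on ({-e<..<e} \<times> {-e<..<e}) (\<lambda>z. Fts (fst z) (snd z))"
  shows "Fst 0 0 = Fts 0 0"
proof (rule ccontr)
  assume ne: "Fst 0 0 \<noteq> Fts 0 0"
  \<comment> \<open>Half the gap, so that the two open balls of radius \<open>r\<close> are
    disjoint.\<close>
  define r where "r = \<bar>Fst 0 0 - Fts 0 0\<bar> / 2"
  have r: "r > 0" using ne by (simp add: r_def)
  have z: "(0, 0) \<in> {-e<..<e} \<times> {-e<..<e}" using e by auto
  obtain d where d: "d > 0" "\<And>z. z \<in> {-e<..<e} \<times> {-e<..<e} \<Longrightarrow> dist z (0, 0) < d \<Longrightarrow> dist (Fst (fst z) (snd z)) (Fst 0 0) < r"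
    using c12 z r unfolding continuous_on_iff by (metis fst_conv snd_conv)
  obtain d' where d': "d' > 0" "\<And>z. z \<in> {-e<..<e} \<times> {-e<..<e} \<Longrightarrow> dist z (0, 0) < d' \<Longrightarrow> dist (Fts (fst z) (snd z)) (Fts 0 0) < r"
    using c21 z r unfolding continuous_on_iff by (metis fst_conv snd_conv)
  \<comment> \<open>The open square of side \<open>h\<close> lies within distance
    \<open>2 * h\<close> of the origin, and \<open>h < e\<close> keeps its closed edges in the
    domain.\<close>
  define h where "h = min e (min d d') / 2"
  have h: "h > 0" "h < e" "h * 2 \<le> d" "h * 2 \<le> d'" using e d d' by (auto simp: h_def)
  have near: "dist (s, t) (0, 0) < h * 2" if "0 < s" "s < h" "0 < t" "t < h" for s t
  proof -
    have "dist (s, t) (0, 0) \<le> \<bar>s\<bar> + \<bar>t\<bar>" 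
      using norm_Pair_le[of s t] by (simp add: dist_norm)
    then show ?thesis using that by simp
  qed
  have "\<exists>x>0. x < h \<and> (F h h - F h 0) - (F 0 h - F 0 0) = (h - 0) * (Fs x h - Fs x 0)"
    using h by (intro MVT2) (auto intro!: derivative_eq_intros d1)
  then obtain x where x: "0 < x" "x < h" "(F h h - F h 0) - (F 0 h - F 0 0) = h * (Fs x h - Fs x 0)" by auto
  have "\<exists>y>0. y < h \<and> Fs x h - Fs x 0 = (h - 0) * Fst x y"
    using h x by (intro MVT2) (auto intro!: d12)
  then obtain y where y: "0 < y" "y < h" "Fs x h - Fs x 0 = h * Fst x y" by auto
  have "\<exists>x>0. x < h \<and> (F h h - F 0 h) - (F h 0 - F 0 0) = (h - 0) * (Ft h x - Ft 0 x)"
    using h by (intro MVT2) (auto intro!: derivative_eq_intros d2)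
  then obtain y' where y': "0 < y'" "y' < h" "(F h h - F 0 h) - (F h 0 - F 0 0) = h * (Ft h y' - Ft 0 y')" by auto
  have "\<exists>x>0. x < h \<and> Ft h y' - Ft 0 y' = (h - 0) * Fts x y'"
    using h y' by (intro MVT2) (auto intro!: d21)
  then obtain x' where x': "0 < x'" "x' < h" "Ft h y' - Ft 0 y' = h * Fts x' y'" by auto
  have "h * (h * Fst x y) = (F h h - F h 0) - (F 0 h - F 0 0)" using x(3) y(3) by simp
  also have "\<dots> = (F h h - F 0 h) - (F h 0 - F 0 0)" by simp
  also have "\<dots> = h * (h * Fts x' y')" using y'(3) x'(3) by simp
  finally have "h * (h * Fst x y) = h * (h * Fts x' y')" .
  then have eq: "Fst x y = Fts x' y'" using h by simp
  have "dist (Fst x y) (Fst 0 0) < r" "dist (Fts x' y') (Fts 0 0) < r"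
    using d(2)[of "(x, y)"] d'(2)[of "(x', y')"] near[of x y] near[of x' y'] x y x' y' h by auto
  then show False using eq by (simp add: dist_real_def r_def abs_if split: if_splits)
qed

text \<open>\<open>pd\<close> differentiates only at parameter 0; shifting the base point along the
  line reaches every other parameter.\<close>

lemma has_vector_derivative_line:
  assumes "Ck I (Suc m) \<Omega> f" "k \<in> I" "c \<in> {1, \<i>}" "line_in c k q t \<in> \<Omega>"
  shows "((\<lambda>y. f (line_in c k q y)) has_vector_derivative pd c k f (line_in c k q t)) (at t)"
proof -
  have "((\<lambda>y. f (line_in c k q (t + y))) has_vector_derivative pd c k f (line_in c k q t)) (at (t - t))"
    using has_vector_derivative_pd[OF assms] by (simp add: line_in_add)
  moreover have "((\<lambda>y. y - t) has_vector_derivative 1) (at t)"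
    by (auto intro!: derivative_eq_intros)
  ultimately show ?thesis
    using vector_diff_chain_at[of "\<lambda>y. y - t" 1 t "\<lambda>y. f (line_in c k q (t + y))"] by (simp add: o_def)
qed

text \<open>The mean value theorem is real, so Schwarz's theorem is applied to the real and the
  imaginary part, both instances of a bounded linear \<open>L\<close>.\<close>

lemma pd_commute:
  assumes \<Omega>: "copen I \<Omega>" and f: "Ck I (Suc (Suc m)) \<Omega> f" and "k \<in> I" "l \<in> I" "c \<in> {1, \<i>}" "d \<in> {1, \<i>}" "p \<in> \<Omega>"
  shows "pd c k (pd d l f) p = pd d l (pd c k f) p"
proof -
  obtain e where e: "e > 0" "\<And>s t. \<bar>s\<bar> < e \<Longrightarrow> \<bar>t\<bar> < e \<Longrightarrow> line_in d l (line_in c k p s) t \<in> \<Omega>"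
    using copen_plane[OF \<Omega> \<open>p \<in> \<Omega>\<close> assms(3,4)] by metis
  have e': "line_in c k (line_in d l p t) s \<in> \<Omega>" if "\<bar>s\<bar> < e" "\<bar>t\<bar> < e" for s t
    using e(2)[OF that] by (simp only: line_in_commute[of d l c])
  let ?L = "\<lambda>s t. line_in d l (line_in c k p s) t"
  have ds: "((\<lambda>x. g (?L x t)) has_vector_derivative pd c k g (?L s t)) (at s)"
    if "Ck I (Suc m') \<Omega> g" "\<bar>s\<bar> < e" "\<bar>t\<bar> < e" for g s t m'
    unfolding line_in_commute[of d l c]
    by (rule has_vector_derivative_line[OF that(1) assms(3,5) e'[OF that(2,3)]])
  have dt: "((\<lambda>y. g (?L s y)) has_vector_derivative pd d l g (?L s t)) (at t)"
    if "Ck I (Suc m') \<Omega> g" "\<bar>s\<bar> < e" "\<bar>t\<bar> < e" for g s t m'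
    by (rule has_vector_derivative_line[OF that(1) assms(4,6) e(2)[OF that(2,3)]])
  have C1: "Ck I (Suc m) \<Omega> (pd c k f)" "Ck I (Suc m) \<Omega> (pd d l f)"
    using f assms by (auto intro: Ck_pd simp del: Ck.simps)
  have C0: "Ck I m \<Omega> (pd d l (pd c k f))" "Ck I m \<Omega> (pd c k (pd d l f))"
    using C1 assms by (auto intro: Ck_pd simp del: Ck.simps)
  have cont: "continuous_on ({-e<..<e} \<times> {-e<..<e}) (\<lambda>z. g (?L (fst z) (snd z)))" if "Ck I m \<Omega> g" for g
    by (rule continuous_on_compose2[OF Ck_continuous[OF that] continuous_line_in]) (auto intro!: e)
  have *: "L (pd d l (pd c k f) (?L 0 0)) = L (pd c k (pd d l f) (?L 0 0))" if L: "bounded_linear L" for L :: "complex \<Rightarrow> real"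
  proof (rule mixed_derivatives_real[OF e(1), where F = "\<lambda>s t. L (f (?L s t))" and Fs = "\<lambda>s t. L (pd c k f (?L s t))"
      and Ft = "\<lambda>s t. L (pd d l f (?L s t))" and Fst = "\<lambda>s t. L (pd d l (pd c k f) (?L s t))"
      and Fts = "\<lambda>s t. L (pd c k (pd d l f) (?L s t))"])
    fix s t :: real assume st: "\<bar>s\<bar> < e" "\<bar>t\<bar> < e"
    note r = has_real_derivative_iff_has_vector_derivative[THEN iffD2, OF bounded_linear.has_vector_derivative[OF L]]
    show "((\<lambda>x. L (f (?L x t))) has_real_derivative L (pd c k f (?L s t))) (at s)" by (rule r[OF ds[OF f st]])
    show "((\<lambda>y. L (f (?L s y))) has_real_derivative L (pd d l f (?L s t))) (at t)" by (rule r[OF dt[OF f st]])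
    show "((\<lambda>y. L (pd c k f (?L s y))) has_real_derivative L (pd d l (pd c k f) (?L s t))) (at t)" by (rule r[OF dt[OF C1(1) st]])
    show "((\<lambda>x. L (pd d l f (?L x t))) has_real_derivative L (pd c k (pd d l f) (?L s t))) (at s)" by (rule r[OF ds[OF C1(2) st]])
  qed (intro continuous_on_compose2[OF linear_continuous_on[OF L, of UNIV] cont] C0; simp)+
  show ?thesis
    using *[OF bounded_linear_Re] *[OF bounded_linear_Im] by (simp add: complex_eq_iff)
qed

lemma dd_ddbar_commute:
  assumes \<Omega>: "copen I \<Omega>" and f: "Ck I (Suc (Suc m)) \<Omega> f" and k: "k \<in> I" and l: "l \<in> I" and p: "p \<in> \<Omega>"
  shows "ddbar l (dd k f) p = dd k (ddbar l f) p"
proof -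
  have C: "Ck I (Suc m) \<Omega> (pd c k f)" "Ck I (Suc m) \<Omega> (pd c l f)" if "c \<in> {1, \<i>}" for c
    using f k l that by (auto intro: Ck_pd simp del: Ck.simps)
  have lin: "pd d j (\<lambda>q. (g q + a * h q) / 2) p = (pd d j g p + a * pd d j h p) / 2"
    if g: "Ck I (Suc m) \<Omega> g" and h: "Ck I (Suc m) \<Omega> h" and j: "j \<in> I" and d: "d \<in> {1, \<i>}" for d j g h a
  proof (rule pd_eqI)
    show "((\<lambda>t. (g (line_in d j p t) + a * h (line_in d j p t)) / 2) has_vector_derivative (pd d j g p + a * pd d j h p) / 2) (at 0)"
      by (intro has_vector_derivative_divide has_vector_derivative_add has_vector_derivative_mult_right
          has_vector_derivative_pd[OF g j d p] has_vector_derivative_pd[OF h j d p])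
  qed
  have comm: "pd d l (pd c k f) p = pd c k (pd d l f) p" if "c \<in> {1, \<i>}" "d \<in> {1, \<i>}" for c d
    using pd_commute[OF \<Omega> f k l that p] by simp
  have D: "pd d l (dd k f) p = (pd d l (pd 1 k f) p - \<i> * pd d l (pd \<i> k f) p) / 2" if "d \<in> {1, \<i>}" for d
    using lin[OF C(1) C(1) l that, of 1 \<i> "- \<i>"] by (simp add: dd_def[abs_def])
  have B: "pd d k (ddbar l f) p = (pd d k (pd 1 l f) p + \<i> * pd d k (pd \<i> l f) p) / 2" if "d \<in> {1, \<i>}" for d
    using lin[OF C(2) C(2) k that, of 1 \<i> \<i>] by (simp add: ddbar_def[abs_def])
  show ?thesis
    unfolding dd_def[of k "ddbar l f"] ddbar_def[of l "dd k f"]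
    by (simp add: D B comm) (simp add: field_simps)
qed

section \<open>The Bochner identity for holomorphic homomorphisms\<close>

text \<open>\<open>matrix_inv\<close> is a choice; Cramer's rule shows its entries to be rational in
  those of \<open>A\<close>, hence as regular as \<open>A\<close>.\<close>

lemma matrix_inv_cramer:
  fixes A :: "complex^'n^'n"
  assumes "invertible A"
  shows "matrix_inv A $ k $ l = det (\<chi> i j. if j = k then (if i = l then 1 else 0) else A $ i $ j) * inverse (det A)"
proof -
  have "(A *v column l (matrix_inv A)) $ i = (if i = l then 1 else 0)" for i
    using matrix_inv_inverse(1)[OF assms]
    by (auto simp: vec_eq_iff matrix_vector_mult_def matrix_matrix_mult_def column_def mat_def)
  moreover have "det A \<noteq> 0" using assms by (simp add: invertible_det_nz)
  ultimately show ?thesis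
    using cramer_lemma[of k A "column l (matrix_inv A)"] by (simp add: column_def field_simps cong: if_cong)
qed

lemma invertible_hermitian_pd:
  assumes "hermitian_pd H"
  shows "invertible H"
proof -
  have "v = 0" if "H *v v = 0" for v
  proof (rule ccontr)
    assume "v \<noteq> 0"
    then have "0 < Re (\<Sum>i\<in>UNIV. \<Sum>j\<in>UNIV. cnj (v $ i) * H $ i $ j * v $ j)"
      using assms by (simp add: hermitian_pd_def)
    also have "(\<Sum>i\<in>UNIV. \<Sum>j\<in>UNIV. cnj (v $ i) * H $ i $ j * v $ j) = (\<Sum>i\<in>UNIV. cnj (v $ i) * (H *v v) $ i)"
      by (simp add: matrix_vector_mult_def sum_distrib_left mult.assoc)
    finally show False using that by simp
  qed
  then show ?thesis
    unfolding invertible_left_inverse matrix_left_invertible_ker by blast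
qed

lemma cadj_mult: "cadj (A ** B) = cadj B ** cadj A"
  and cadj_add: "cadj (C + D) = cadj C + cadj D"
  and cadj_diff: "cadj (C - D) = cadj C - cadj D"
  and cadj_mat_1 [simp]: "cadj (mat 1 :: complex^'n^'n) = mat 1"
  by (auto simp: cadj_def matrix_matrix_mult_def vec_eq_iff mat_def mult.commute)

lemma cadj_matrix_inv:
  assumes "hermitian_pd H"
  shows "cadj (matrix_inv H) = matrix_inv H"
proof -
  note inv = matrix_inv_inverse[OF invertible_hermitian_pd[OF assms]]
  have H: "cadj H = H" using assms by (simp add: hermitian_pd_def)
  have "cadj (matrix_inv H) ** H = mat 1"
    using arg_cong[OF inv(1), of cadj] by (simp add: cadj_mult H)
  then have "cadj (matrix_inv H) ** (H ** matrix_inv H) = matrix_inv H"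
    by (simp add: matrix_mul_assoc)
  then show ?thesis by (simp add: inv)
qed

section \<open>Matrix-valued functions and their derivatives\<close>

definition mCk :: "'k set \<Rightarrow> nat \<Rightarrow> ('k \<Rightarrow> complex) set \<Rightarrow> (('k \<Rightarrow> complex) \<Rightarrow> complex^'c^'d) \<Rightarrow> bool" where
  "mCk I m \<Omega> M \<longleftrightarrow> (\<forall>i j. Ck I m \<Omega> (\<lambda>p. M p $ i $ j))"

lemma mCk_D: "mCk I m \<Omega> M \<Longrightarrow> Ck I m \<Omega> (\<lambda>p. M p $ i $ j)"
  by (simp add: mCk_def)

lemma mCk_mono: "mCk I n \<Omega> M \<Longrightarrow> m \<le> n \<Longrightarrow> mCk I m \<Omega> M"
  unfolding mCk_def using Ck_mono by blast

lemma mCk_mult: "copen I \<Omega> \<Longrightarrow> mCk I m \<Omega> A \<Longrightarrow> mCk I m \<Omega> B \<Longrightarrow> mCk I m \<Omega> (\<lambda>p. A p ** B p)"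
  unfolding mCk_def matrix_matrix_mult_def by (auto intro!: Ck_sum Ck_mult)

lemma mCk_add: "copen I \<Omega> \<Longrightarrow> mCk I m \<Omega> A \<Longrightarrow> mCk I m \<Omega> B \<Longrightarrow> mCk I m \<Omega> (\<lambda>p. A p + B p)"
  unfolding mCk_def by (auto intro!: Ck_add)

lemma mCk_minus: "copen I \<Omega> \<Longrightarrow> mCk I m \<Omega> A \<Longrightarrow> mCk I m \<Omega> (\<lambda>p. - A p)"
  unfolding mCk_def by (auto intro!: Ck_minus)

lemma mCk_diff: "copen I \<Omega> \<Longrightarrow> mCk I m \<Omega> A \<Longrightarrow> mCk I m \<Omega> B \<Longrightarrow> mCk I m \<Omega> (\<lambda>p. A p - B p)"
  unfolding mCk_def by (auto intro!: Ck_diff)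

lemma mCk_cadj: "copen I \<Omega> \<Longrightarrow> mCk I m \<Omega> A \<Longrightarrow> mCk I m \<Omega> (\<lambda>p. cadj (A p))"
  unfolding mCk_def cadj_def by (auto intro!: Ck_cnj)

lemma mCk_dd:
  assumes "copen I \<Omega>" "mCk I (Suc m) \<Omega> M" "k \<in> I"
  shows "mCk I m \<Omega> (mat_dd k M)" "mCk I m \<Omega> (mat_ddbar k M)"
  using Ck_dd[OF assms(1) mCk_D[OF assms(2)] assms(3)] by (simp_all add: mCk_def mat_dd_def mat_ddbar_def)

lemma Ck_trace: "copen I \<Omega> \<Longrightarrow> mCk I m \<Omega> A \<Longrightarrow> Ck I m \<Omega> (\<lambda>p. trace (A p))"
  unfolding mCk_def trace_def by (auto intro!: Ck_sum)

lemma Ck_det: "copen I \<Omega> \<Longrightarrow> mCk I m \<Omega> A \<Longrightarrow> Ck I m \<Omega> (\<lambda>p. det (A p))"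
  unfolding mCk_def det_def by (auto intro!: Ck_sum Ck_scale Ck_prod)

lemma mCk_matrix_inv:
  fixes A :: "('k \<Rightarrow> complex) \<Rightarrow> complex^'n^'n"
  assumes \<Omega>: "copen I \<Omega>" and inv: "\<And>p. p \<in> \<Omega> \<Longrightarrow> invertible (A p)" and A: "mCk I m \<Omega> A"
  shows "mCk I m \<Omega> (\<lambda>p. matrix_inv (A p))"
  unfolding mCk_def
proof (intro allI)
  fix k l
  have "mCk I m \<Omega> (\<lambda>p. \<chi> i j. if j = k then (if i = l then 1 else 0) else A p $ i $ j)"
    unfolding mCk_def
  proof (intro allI)
    fix i j
    show "Ck I m \<Omega> (\<lambda>p. (\<chi> i j. if j = k then (if i = l then 1 else 0) else A p $ i $ j) $ i $ j)"
      by (cases "j = k") (simp_all add: Ck_const mCk_D[OF A])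
  qed
  then have "Ck I m \<Omega> (\<lambda>p. det (\<chi> i j. if j = k then (if i = l then 1 else 0) else A p $ i $ j) * inverse (det (A p)))"
    using inv by (intro Ck_mult Ck_inverse Ck_det \<Omega> A) (auto simp: invertible_det_nz)
  then show "Ck I m \<Omega> (\<lambda>p. matrix_inv (A p) $ k $ l)"
    by (rule Ck_cong[OF \<Omega>, rotated]) (simp add: matrix_inv_cramer[OF inv])
qed

lemma mat_dd_cong:
  assumes "copen I \<Omega>" "p \<in> \<Omega>" "k \<in> I" "\<And>q. q \<in> \<Omega> \<Longrightarrow> A q = B q"
  shows "mat_dd k A p = mat_dd k B p" "mat_ddbar k A p = mat_ddbar k B p"
  unfolding mat_dd_def mat_ddbar_def
  by (auto simp: vec_eq_iff assms(4) intro!: dd_cong[OF assms(1-3)])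

lemma mat_dd_mult:
  assumes "copen I \<Omega>" "mCk I (Suc m) \<Omega> A" "mCk I (Suc m) \<Omega> B" "k \<in> I" "p \<in> \<Omega>"
  shows "mat_dd k (\<lambda>p. A p ** B p) p = mat_dd k A p ** B p + A p ** mat_dd k B p"
    and "mat_ddbar k (\<lambda>p. A p ** B p) p = mat_ddbar k A p ** B p + A p ** mat_ddbar k B p"
proof -
  note c = Ck_mult[OF assms(1) mCk_D[OF assms(2)] mCk_D[OF assms(3)]]
  show "mat_dd k (\<lambda>p. A p ** B p) p = mat_dd k A p ** B p + A p ** mat_dd k B p"
    "mat_ddbar k (\<lambda>p. A p ** B p) p = mat_ddbar k A p ** B p + A p ** mat_ddbar k B p"
    by (simp_all add: vec_eq_iff mat_dd_def mat_ddbar_def matrix_matrix_mult_def dd_sum[OF assms(1) c assms(4,5)]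
        dd_mult[OF mCk_D[OF assms(2)] mCk_D[OF assms(3)] assms(4,5)] sum.distrib)
qed

lemma mat_dd_add:
  assumes "mCk I (Suc m) \<Omega> A" "mCk I (Suc m) \<Omega> B" "k \<in> I" "p \<in> \<Omega>"
  shows "mat_ddbar k (\<lambda>p. A p + B p) p = mat_ddbar k A p + mat_ddbar k B p"
  by (simp add: vec_eq_iff mat_ddbar_def dd_add[OF mCk_D[OF assms(1)] mCk_D[OF assms(2)] assms(3,4)])

lemma mat_dd_cadj:
  assumes "mCk I (Suc m) \<Omega> A" "k \<in> I" "p \<in> \<Omega>"
  shows "mat_dd k (\<lambda>p. cadj (A p)) p = cadj (mat_ddbar k A p)"
    and "mat_ddbar k (\<lambda>p. cadj (A p)) p = cadj (mat_dd k A p)"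
  by (simp_all add: vec_eq_iff mat_dd_def mat_ddbar_def cadj_def dd_cnj[OF mCk_D[OF assms(1)] assms(2,3)])

lemma mat_dd_const [simp]: "mat_dd k (\<lambda>_. A) p = 0" "mat_ddbar k (\<lambda>_. A) p = 0"
  by (simp_all add: mat_dd_def mat_ddbar_def vec_eq_iff)

text \<open>Differentiate the identity \<open>A p ** matrix_inv (A p) = mat 1\<close>, valid on the
  whole open set.\<close>

lemma mat_dd_matrix_inv:
  fixes A :: "('k \<Rightarrow> complex) \<Rightarrow> complex^'n^'n"
  assumes \<Omega>: "copen I \<Omega>" and inv: "\<And>p. p \<in> \<Omega> \<Longrightarrow> invertible (A p)" and A: "mCk I (Suc m) \<Omega> A"
    and k: "k \<in> I" and p: "p \<in> \<Omega>"
  shows "mat_dd k (\<lambda>p. matrix_inv (A p)) p = - (matrix_inv (A p) ** mat_dd k A p ** matrix_inv (A p))" (is ?D)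
    and "mat_ddbar k (\<lambda>p. matrix_inv (A p)) p = - (matrix_inv (A p) ** mat_ddbar k A p ** matrix_inv (A p))" (is ?B)
proof -
  let ?b = "\<lambda>p. matrix_inv (A p)"
  note i = matrix_inv_inverse[OF inv]
  have "mat_dd k (\<lambda>p. A p ** ?b p) p = 0" "mat_ddbar k (\<lambda>p. A p ** ?b p) p = 0"
    using mat_dd_cong[OF \<Omega> p k, of "\<lambda>p. A p ** ?b p" "\<lambda>_. mat 1"] by (simp_all add: i)
  then have *: "mat_dd k A p ** ?b p + A p ** mat_dd k ?b p = 0" "mat_ddbar k A p ** ?b p + A p ** mat_ddbar k ?b p = 0"
    using mat_dd_mult[OF \<Omega> A mCk_matrix_inv[OF \<Omega> inv A] k p] by simp_all
  have **: "X = - (?b p ** Y ** ?b p)" if "Y ** ?b p + A p ** X = 0" for X Y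
  proof -
    have "?b p ** (A p ** X) = ?b p ** (- (Y ** ?b p))"
      using that by (simp add: add_eq_0_iff)
    then show ?thesis by (simp add: matrix_mul_assoc i[OF p] matrix_mult_minus)
  qed
  show ?D ?B by (rule **[OF *(1)], rule **[OF *(2)])
qed

lemma mat_dd_ddbar_commute:
  assumes "copen I \<Omega>" "mCk I (Suc (Suc m)) \<Omega> M" "k \<in> I" "l \<in> I" "p \<in> \<Omega>"
  shows "mat_ddbar l (mat_dd k M) p = mat_dd k (mat_ddbar l M) p"
  using dd_ddbar_commute[OF assms(1) mCk_D[OF assms(2)] assms(3-5)]
  by (simp add: vec_eq_iff mat_dd_def mat_ddbar_def)

lemma dd_trace_mult:
  assumes "copen I \<Omega>" "mCk I (Suc m) \<Omega> A" "mCk I (Suc m) \<Omega> B" "k \<in> I" "p \<in> \<Omega>"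
  shows "dd k (\<lambda>p. trace (A p ** B p)) p = trace (mat_dd k A p ** B p) + trace (A p ** mat_dd k B p)"
    and "ddbar k (\<lambda>p. trace (A p ** B p)) p = trace (mat_ddbar k A p ** B p) + trace (A p ** mat_ddbar k B p)"
proof -
  note c = mCk_D[OF mCk_mult[OF assms(1-3)]]
  have "dd k (\<lambda>p. trace (A p ** B p)) p = trace (mat_dd k (\<lambda>p. A p ** B p) p)"
    "ddbar k (\<lambda>p. trace (A p ** B p)) p = trace (mat_ddbar k (\<lambda>p. A p ** B p) p)"
    by (simp_all add: trace_def mat_dd_def mat_ddbar_def dd_sum[OF assms(1) c assms(4,5)])
  then show "dd k (\<lambda>p. trace (A p ** B p)) p = trace (mat_dd k A p ** B p) + trace (A p ** mat_dd k B p)"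
    "ddbar k (\<lambda>p. trace (A p ** B p)) p = trace (mat_ddbar k A p ** B p) + trace (A p ** mat_ddbar k B p)"
    by (simp_all add: mat_dd_mult[OF assms] trace_add)
qed

lemma mCk_conn:
  assumes "copen I \<Omega>" "\<And>p. p \<in> \<Omega> \<Longrightarrow> hermitian_pd (H p)" "mCk I (Suc m) \<Omega> H" "k \<in> I"
  shows "mCk I m \<Omega> (conn H k)"
proof -
  have "mCk I m \<Omega> (\<lambda>p. matrix_inv (H p))"
    by (rule mCk_matrix_inv[OF assms(1) invertible_hermitian_pd[OF assms(2)] mCk_mono[OF assms(3)]]) auto
  then show ?thesis
    unfolding conn_def[abs_def] by (rule mCk_mult[OF assms(1) _ mCk_dd(1)[OF assms(1,3,4)]])
qed

text \<open>With \<open>\<Psi> = \<Phi>\<^sup>*\<close> one has \<open>\<Psi>\<^bsub>;l\<^esub> = (\<Phi>\<^bsub>;l\<^esub>)\<^sup>*\<close> for the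
  antiholomorphic derivatives, \<open>\<Psi>\<close> is parallel in the holomorphic directions, and the curvature
  arises as the commutator.\<close>

lemma dd_ddbar_hom_norm:
  fixes H1 :: "('k \<Rightarrow> complex) \<Rightarrow> complex^'r1^'r1" and H2 :: "('k \<Rightarrow> complex) \<Rightarrow> complex^'r2^'r2"
    and F :: "('k \<Rightarrow> complex) \<Rightarrow> complex^'r2^'r1"
  assumes \<Omega>: "copen I \<Omega>" and H1: "mCk I 2 \<Omega> H1" and H2: "mCk I 2 \<Omega> H2" and F: "mCk I 2 \<Omega> F"
    and pd1: "\<And>p. p \<in> \<Omega> \<Longrightarrow> hermitian_pd (H1 p)" and pd2: "\<And>p. p \<in> \<Omega> \<Longrightarrow> hermitian_pd (H2 p)"
    and hol: "\<And>p k. p \<in> \<Omega> \<Longrightarrow> k \<in> I \<Longrightarrow> mat_ddbar k F p = 0"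
    and k: "k \<in> I" and l: "l \<in> I" and p: "p \<in> \<Omega>"
  defines "\<Psi> \<equiv> (\<lambda>p. metric_adj (H1 p) (H2 p) (F p))"
  shows "dd k (ddbar l (\<lambda>p. trace (F p ** \<Psi> p))) p =
    trace (hom_cov H1 H2 F k p ** metric_adj (H1 p) (H2 p) (hom_cov H1 H2 F l p)) +
    trace (curv_coeff H2 k l p ** (\<Psi> p ** F p)) - trace (curv_coeff H1 k l p ** (F p ** \<Psi> p))"
proof -
  note [simp] = numeral_2_eq_2
  define b where "b = (\<lambda>p. matrix_inv (H2 p))"
  define a where "a = (\<lambda>p. matrix_inv (H1 p))"
  define \<Psi>l where "\<Psi>l = (\<lambda>p. metric_adj (H1 p) (H2 p) (hom_cov H1 H2 F l p))"
  note inv1 = invertible_hermitian_pd[OF pd1] and inv2 = invertible_hermitian_pd[OF pd2]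
  note i1 = matrix_inv_inverse[OF inv1]
  have C: "mCk I (Suc (Suc 0)) \<Omega> H1" "mCk I (Suc (Suc 0)) \<Omega> H2" "mCk I (Suc (Suc 0)) \<Omega> F"
    using H1 H2 F by simp_all
  have C1: "mCk I (Suc 0) \<Omega> H1" "mCk I (Suc 0) \<Omega> H2" "mCk I (Suc 0) \<Omega> F"
    using C by (auto intro: mCk_mono)
  have b: "mCk I (Suc (Suc 0)) \<Omega> b" unfolding b_def by (rule mCk_matrix_inv[OF \<Omega> inv2 C(2)])
  have b1: "mCk I (Suc 0) \<Omega> b" using b by (rule mCk_mono) simp
  have F': "mCk I (Suc (Suc 0)) \<Omega> (\<lambda>p. cadj (F p))" by (rule mCk_cadj[OF \<Omega> C(3)])
  have F'1: "mCk I (Suc 0) \<Omega> (\<lambda>p. cadj (F p))" using F' by (rule mCk_mono) simp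
  have \<Psi>: "\<Psi> = (\<lambda>p. (b p ** cadj (F p)) ** H1 p)"
    by (rule ext) (simp add: \<Psi>_def metric_adj_def b_def)
  have \<Psi>2: "mCk I (Suc (Suc 0)) \<Omega> \<Psi>" unfolding \<Psi> by (intro mCk_mult \<Omega> b F' C(1))
  have \<Psi>1: "mCk I (Suc 0) \<Omega> \<Psi>" using \<Psi>2 by (rule mCk_mono) simp
  have A1: "mCk I (Suc 0) \<Omega> (conn H1 k)" and A2: "mCk I (Suc 0) \<Omega> (conn H2 k)"
    by (rule mCk_conn[OF \<Omega> pd1 C(1) k], assumption, rule mCk_conn[OF \<Omega> pd2 C(2) k], assumption)
  \<comment> \<open>The matrices equal their adjoints on an open set, and taking adjoints exchanges
    the two kinds of derivatives.\<close>
  have herm: "mat_ddbar m H1 q = cadj (mat_dd m H1 q)" "mat_ddbar m H2 q = cadj (mat_dd m H2 q)"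
    if "q \<in> \<Omega>" "m \<in> I" for q m
    using mat_dd_cadj(2)[OF C1(1) that(2,1)] mat_dd_cadj(2)[OF C1(2) that(2,1)]
      mat_dd_cong(2)[OF \<Omega> that, of "\<lambda>p. cadj (H1 p)" H1] mat_dd_cong(2)[OF \<Omega> that, of "\<lambda>p. cadj (H2 p)" H2]
      pd1 pd2 by (auto simp: hermitian_pd_def)
  note ml = matrix_mul_assoc[symmetric] matrix_add_ldistrib matrix_add_rdistrib matrix_mult_diff matrix_mult_minus
    matrix_mult_zero_left matrix_mult_zero_right
  \<comment> \<open>The derivatives of the two metrics inside the adjoint are exactly the adjoints
    of the connection terms of \<open>hom_cov\<close>.\<close>
  have dbar\<Psi>: "mat_ddbar l \<Psi> q = \<Psi>l q" if q: "q \<in> \<Omega>" for q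
  proof -
    have a: "a q ** H1 q = mat 1" using i1[OF q] by (simp add: a_def)
    have "mat_ddbar l \<Psi> q = (mat_ddbar l b q ** cadj (F q) + b q ** cadj (mat_dd l F q)) ** H1 q +
        (b q ** cadj (F q)) ** mat_ddbar l H1 q"
      unfolding \<Psi> mat_dd_mult(2)[OF \<Omega> mCk_mult[OF \<Omega> b1 F'1] C1(1) l q] mat_dd_mult(2)[OF \<Omega> b1 F'1 l q]
        mat_dd_cadj(2)[OF C1(3) l q] ..
    also have "mat_ddbar l b q = - (b q ** mat_ddbar l H2 q ** b q)"
      unfolding b_def by (rule mat_dd_matrix_inv(2)[OF \<Omega> inv2 C1(2) l q])
    finally have 1: "mat_ddbar l \<Psi> q = (- (b q ** mat_ddbar l H2 q ** b q) ** cadj (F q) +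
        b q ** cadj (mat_dd l F q)) ** H1 q + (b q ** cadj (F q)) ** mat_ddbar l H1 q" .
    have 2: "\<Psi>l q = b q ** (cadj (mat_dd l F q) + cadj (F q) ** (mat_ddbar l H1 q ** a q) -
        (mat_ddbar l H2 q ** b q) ** cadj (F q)) ** H1 q"
      unfolding \<Psi>l_def metric_adj_def hom_cov_def conn_def cadj_diff cadj_add cadj_mult
        cadj_matrix_inv[OF pd1[OF q]] cadj_matrix_inv[OF pd2[OF q]] herm[OF q l] a_def b_def ..
    show ?thesis unfolding 1 2 by (simp add: ml a)
  qed
  \<comment> \<open>Holomorphy removes the derivative of \<open>cadj (F q)\<close>; only connection
    terms remain, which says that the covariant derivative of \<Psi> in this direction
    vanishes.\<close>
  have d\<Psi>: "mat_dd k \<Psi> q = \<Psi> q ** conn H1 k q - conn H2 k q ** \<Psi> q" if q: "q \<in> \<Omega>" for q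
  proof -
    have h: "H1 q ** (matrix_inv (H1 q) ** Y) = Y" for Y :: "complex^'r1^'r1"
      by (simp add: matrix_mul_assoc i1[OF q])
    have cb: "matrix_inv (H2 q) = b q" by (simp add: b_def)
    have z: "cadj 0 = (0 :: complex^'r1^'r2)" by (simp add: cadj_def vec_eq_iff)
    have "mat_dd k \<Psi> q = (mat_dd k b q ** cadj (F q) + b q ** cadj (mat_ddbar k F q)) ** H1 q +
        (b q ** cadj (F q)) ** mat_dd k H1 q"
      unfolding \<Psi> mat_dd_mult(1)[OF \<Omega> mCk_mult[OF \<Omega> b1 F'1] C1(1) k q] mat_dd_mult(1)[OF \<Omega> b1 F'1 k q]
        mat_dd_cadj(1)[OF C1(3) k q] ..
    also have "mat_dd k b q = - (b q ** mat_dd k H2 q ** b q)"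
      unfolding b_def by (rule mat_dd_matrix_inv(1)[OF \<Omega> inv2 C1(2) k q])
    finally show ?thesis
      unfolding hol[OF q k] conn_def \<Psi> by (simp add: ml h z cb)
  qed
  \<comment> \<open>After exchanging the derivatives, the first-order equation
    \<open>d\<Psi>\<close> can be differentiated antiholomorphically; curvature enters as the
    derivative of the connection matrices.\<close>
  have \<Psi>l: "mat_dd k \<Psi>l p = mat_dd k (mat_ddbar l \<Psi>) p"
    by (rule mat_dd_cong(1)[OF \<Omega> p k]) (simp add: dbar\<Psi>)
  also have "\<dots> = mat_ddbar l (mat_dd k \<Psi>) p"
    by (rule mat_dd_ddbar_commute[OF \<Omega> \<Psi>2 k l p, symmetric])
  also have "\<dots> = mat_ddbar l (\<lambda>q. \<Psi> q ** conn H1 k q + (- conn H2 k q) ** \<Psi> q) p"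
    by (rule mat_dd_cong(2)[OF \<Omega> p l]) (simp add: d\<Psi> ml)
  also have "\<dots> = (\<Psi>l p ** conn H1 k p + \<Psi> p ** mat_ddbar l (conn H1 k) p) +
      (mat_ddbar l (\<lambda>q. - conn H2 k q) p ** \<Psi> p + (- conn H2 k p) ** \<Psi>l p)"
    unfolding mat_dd_add[OF mCk_mult[OF \<Omega> \<Psi>1 A1] mCk_mult[OF \<Omega> mCk_minus[OF \<Omega> A2] \<Psi>1] l p]
      mat_dd_mult(2)[OF \<Omega> \<Psi>1 A1 l p] mat_dd_mult(2)[OF \<Omega> mCk_minus[OF \<Omega> A2] \<Psi>1 l p] dbar\<Psi>[OF p] ..
  also have "mat_ddbar l (\<lambda>q. - conn H2 k q) p = - mat_ddbar l (conn H2 k) p"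
  proof -
    have "mat_ddbar l (\<lambda>q. - conn H2 k q + conn H2 k q) p = mat_ddbar l (\<lambda>q. - conn H2 k q) p + mat_ddbar l (conn H2 k) p"
      by (rule mat_dd_add[OF mCk_minus[OF \<Omega> A2] A2 l p])
    then show ?thesis by (simp add: eq_neg_iff_add_eq_0)
  qed
  finally have dd\<Psi>: "mat_dd k \<Psi>l p = \<Psi>l p ** conn H1 k p - \<Psi> p ** curv_coeff H1 k l p +
      curv_coeff H2 k l p ** \<Psi> p - conn H2 k p ** \<Psi>l p"
    by (simp add: curv_coeff_def ml)
  have "dd k (ddbar l (\<lambda>p. trace (F p ** \<Psi> p))) p = dd k (\<lambda>q. trace (F q ** \<Psi>l q)) p"
    by (rule dd_cong(1)[OF \<Omega> p k])
      (simp add: dd_trace_mult(2)[OF \<Omega> C1(3) \<Psi>1 l] hol[OF _ l] dbar\<Psi> matrix_mult_zero_left)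
  \<comment> \<open>Returning to the derivative of \<Psi> provides the regularity needed for the
    product rule.\<close>
  also have "\<dots> = dd k (\<lambda>q. trace (F q ** mat_ddbar l \<Psi> q)) p"
    by (rule dd_cong(1)[OF \<Omega> p k]) (simp add: dbar\<Psi>)
  also have "\<dots> = trace (mat_dd k F p ** \<Psi>l p) + trace (F p ** mat_dd k \<Psi>l p)"
    unfolding dd_trace_mult(1)[OF \<Omega> C1(3) mCk_dd(2)[OF \<Omega> \<Psi>2 l] k p] dbar\<Psi>[OF p] \<Psi>l ..
  \<comment> \<open>By cyclicity the connection terms in \<open>dd\<Psi>\<close> move next to the
    derivative of \<open>F\<close> and complete it to the covariant derivative.\<close>
  also have "\<dots> = trace (hom_cov H1 H2 F k p ** \<Psi>l p) +
      trace (curv_coeff H2 k l p ** (\<Psi> p ** F p)) - trace (curv_coeff H1 k l p ** (F p ** \<Psi> p))"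
  proof -
    have "trace (F p ** (\<Psi>l p ** conn H1 k p)) = trace (conn H1 k p ** F p ** \<Psi>l p)"
      using trace_mul_sym[of "F p ** \<Psi>l p" "conn H1 k p"] by (simp add: matrix_mul_assoc)
    moreover have "trace (F p ** (\<Psi> p ** curv_coeff H1 k l p)) = trace (curv_coeff H1 k l p ** (F p ** \<Psi> p))"
      using trace_mul_sym[of "F p ** \<Psi> p" "curv_coeff H1 k l p"] by (simp add: matrix_mul_assoc)
    moreover have "trace (F p ** (curv_coeff H2 k l p ** \<Psi> p)) = trace (curv_coeff H2 k l p ** (\<Psi> p ** F p))"
      using trace_mul_sym[of "F p" "curv_coeff H2 k l p ** \<Psi> p"] by (simp add: matrix_mul_assoc)
    ultimately show ?thesis
      unfolding dd\<Psi> hom_cov_def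
      by (simp add: matrix_add_ldistrib matrix_add_rdistrib matrix_mult_diff trace_add trace_sub matrix_mul_assoc)
  qed
  finally show ?thesis unfolding \<Psi>l_def .
qed

section \<open>Weighted integrals over charts\<close>

definition wint :: "('n::finite \<Rightarrow> complex) set \<Rightarrow> (('n \<Rightarrow> complex) \<Rightarrow> real) \<Rightarrow> (('n \<Rightarrow> complex) \<Rightarrow> complex) \<Rightarrow> complex" where
  "wint Z w f = (LINT z:{z::complex^'n. ($) z \<in> Z}|lborel. of_real (w (($) z)) * f (($) z))"

lemma continuous_vec_nth_fun: "continuous_on S (\<lambda>z::complex^'n. ($) z)"
  by (rule continuous_on_coordinatewise_then_product) (rule linear_continuous_on[OF bounded_linear_vec_nth])

text \<open>\<open>Z\<close> is the coordinate image of a piece, \<open>w\<close> a member of the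
  partition of unity in coordinates and \<open>K\<close> a compact set outside which it vanishes.
  Compactness provides integrability and uniform estimates.\<close>

locale weighted_chart =
  fixes Z K :: "('n::finite \<Rightarrow> complex) set" and w :: "('n \<Rightarrow> complex) \<Rightarrow> real"
  assumes open_Z: "open Z" and compact_K: "compact K" and K_subset: "K \<subseteq> Z"
    and cont_w: "continuous_on Z w" and w_zero: "\<And>z. z \<in> Z \<Longrightarrow> z \<notin> K \<Longrightarrow> w z = 0"
begin

text \<open>The copy of \<open>K\<close> in the vector type, which carries the Lebesgue
  measure.\<close>

definition Kv :: "(complex^'n) set" where
  "Kv = {z. ($) z \<in> K}"

lemma compact_Kv: "compact Kv"
proof -
  have "z \<in> (\<lambda>f. \<chi> i. f i) ` K" if "z \<in> Kv" for z
    using that by (intro image_eqI[of _ _ "($) z"]) (simp_all add: Kv_def)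
  moreover have "(\<chi> i. f i) \<in> Kv" if "f \<in> K" for f
    using that by (simp add: Kv_def vec_lambda_inverse)
  ultimately have "Kv = (\<lambda>f. \<chi> i. f i) ` K" by blast
  moreover have "continuous_on K (\<lambda>f::'n \<Rightarrow> complex. \<chi> i. f i)"
    by (rule continuous_on_vec_lambda) (rule continuous_on_product_then_coordinatewise[OF continuous_on_id])
  ultimately show ?thesis using compact_continuous_image[OF _ compact_K] by simp
qed

lemma continuous_Kv: "continuous_on Z f \<Longrightarrow> continuous_on Kv (\<lambda>z. f (($) z))"
  by (rule continuous_on_compose2[OF _ continuous_vec_nth_fun]) (use K_subset in \<open>auto simp: Kv_def\<close>)

text \<open>The weight vanishes on the rest of \<open>Z\<close>, so the domain becomes compact;
  continuity on the open set alone would not give integrability.\<close>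

lemma integrand_Kv:
  "indicator {z::complex^'n. ($) z \<in> Z} z *\<^sub>R (of_real (w (($) z)) * f (($) z)) =
   indicator Kv z *\<^sub>R (of_real (w (($) z)) * f (($) z) :: complex)"
  using K_subset w_zero[of "($) z"] by (auto simp: indicator_def Kv_def)

lemma wint_Kv: "wint Z w f = (LINT z|lborel. indicator Kv z *\<^sub>R (of_real (w (($) z)) * f (($) z)))"
  unfolding wint_def set_lebesgue_integral_def integrand_Kv ..

lemma integrable_wint:
  "continuous_on Z f \<Longrightarrow> integrable lborel (\<lambda>z. indicator Kv z *\<^sub>R (of_real (w (($) z)) * f (($) z) :: complex))"
  by (rule borel_integrable_compact[OF compact_Kv
        continuous_on_mult[OF continuous_on_of_real[OF continuous_Kv[OF cont_w]] continuous_Kv]])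

lemma wint_add: "continuous_on Z f \<Longrightarrow> continuous_on Z g \<Longrightarrow> wint Z w (\<lambda>z. f z + g z) = wint Z w f + wint Z w g"
  unfolding wint_Kv by (simp add: Bochner_Integration.integral_add[OF integrable_wint integrable_wint, symmetric]
      distrib_left scaleR_add_right)

lemma wint_cmult: "wint Z w (\<lambda>z. c * f z) = c * wint Z w f"
  unfolding wint_Kv by (subst integral_mult_right_zero[symmetric]) (simp add: mult.left_commute scaleR_conv_of_real)

lemma wint_cong: "(\<And>z. z \<in> Z \<Longrightarrow> f z = g z) \<Longrightarrow> wint Z w f = wint Z w g"
  unfolding wint_def set_lebesgue_integral_def by (intro Bochner_Integration.integral_cong) (auto simp: indicator_def)

text \<open>Differentiation under the integral by uniform continuity: on a compact product the
  derivative changes little with the parameter, uniformly in the point, so the mean value inequality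
  can be integrated against the weight.\<close>

lemma wint_has_vector_derivative:
  fixes f :: "('n \<Rightarrow> complex) \<Rightarrow> real \<Rightarrow> complex"
  assumes e: "e > 0"
    and d: "\<And>z t. z \<in> Z \<Longrightarrow> \<bar>t\<bar> < e \<Longrightarrow> (f z has_vector_derivative f' z t) (at t)"
    and c: "\<And>t. \<bar>t\<bar> < e \<Longrightarrow> continuous_on Z (\<lambda>z. f z t)"
    and c': "continuous_on (Z \<times> {-e<..<e}) (\<lambda>x. f' (fst x) (snd x))"
  shows "((\<lambda>t. wint Z w (\<lambda>z. f z t)) has_vector_derivative wint Z w (\<lambda>z. f' z 0)) (at 0)"
  unfolding has_vector_derivative_def has_derivative_at_alt
proof (intro conjI allI impI)
  show "bounded_linear (\<lambda>x. x *\<^sub>R wint Z w (\<lambda>z. f' z 0))" by (rule bounded_linear_scaleR_left)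
  fix eps :: real assume eps: "eps > 0"
  \<comment> \<open>A closed parameter interval inside the open one, so that
    \<open>Kv \<times> {-a..a}\<close> is compact.\<close>
  define a where "a = e / 2"
  have a: "0 < a" "a < e" using e by (auto simp: a_def)
  define M where "M = (LINT z|lborel. indicator Kv z *\<^sub>R \<bar>w (($) z)\<bar>)"
  have iw: "integrable lborel (\<lambda>z. indicator Kv z *\<^sub>R \<bar>w (($) z)\<bar>)"
    by (rule borel_integrable_compact[OF compact_Kv continuous_on_rabs[OF continuous_Kv[OF cont_w]]])
  have M0: "M \<ge> 0" unfolding M_def by (intro Bochner_Integration.integral_nonneg) auto
  \<comment> \<open>\<open>M\<close> is the mass of the absolute weight; adding 1 covers the case
    \<open>M = 0\<close>.\<close>
  define r where "r = eps / (M + 1)"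
  have r: "r > 0" using eps M0 by (simp add: r_def)
  have "continuous_on (Kv \<times> {-a..a}) (\<lambda>x. f' (($) (fst x)) (snd x))"
  proof -
    have 1: "continuous_on (Kv \<times> {-a..a}) (\<lambda>x. (($) (fst x), snd x))"
      by (rule continuous_on_Pair[OF continuous_on_compose2[OF continuous_vec_nth_fun[of UNIV]
            continuous_on_fst[OF continuous_on_id]] continuous_on_snd[OF continuous_on_id]]) simp
    have 2: "(\<lambda>x. (($) (fst x), snd x)) ` (Kv \<times> {-a..a}) \<subseteq> Z \<times> {-e<..<e}"
      using a K_subset by (auto simp: Kv_def)
    from continuous_on_compose2[OF c' 1 2] show ?thesis by simp
  qed
  then have uc: "uniformly_continuous_on (Kv \<times> {-a..a}) (\<lambda>x. f' (($) (fst x)) (snd x))"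
    by (intro compact_uniformly_continuous compact_Times compact_Kv) auto
  obtain \<delta> where \<delta>: "\<delta> > 0" "\<And>x y. x \<in> Kv \<times> {-a..a} \<Longrightarrow> y \<in> Kv \<times> {-a..a} \<Longrightarrow> dist y x < \<delta> \<Longrightarrow>
      dist (f' (($) (fst y)) (snd y)) (f' (($) (fst x)) (snd x)) < r"
    by (rule uniformly_continuous_onE[OF uc r]) (blast intro: that)
  show "\<exists>d>0. \<forall>y. norm (y - 0) < d \<longrightarrow> norm (wint Z w (\<lambda>z. f z y) - wint Z w (\<lambda>z. f z 0) -
      (y - 0) *\<^sub>R wint Z w (\<lambda>z. f' z 0)) \<le> eps * norm (y - 0)"
  proof (intro exI[of _ "min a \<delta>"] conjI allI impI)
    show "0 < min a \<delta>" using a \<delta> by simp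
    fix y :: real assume "norm (y - 0) < min a \<delta>"
    then have y: "\<bar>y\<bar> < a" "\<bar>y\<bar> < \<delta>" "\<bar>y\<bar> < e" using a by auto
    have cf'0: "continuous_on Z (\<lambda>z. f' z 0)"
    proof -
      have 1: "continuous_on Z (\<lambda>z. (z, 0::real))" by (intro continuous_intros)
      have 2: "(\<lambda>z. (z, 0::real)) ` Z \<subseteq> Z \<times> {-e<..<e}" using e by auto
      from continuous_on_compose2[OF c' 1 2] show ?thesis by simp
    qed
    \<comment> \<open>On the segment from 0 to \<open>y\<close> the derivative stays within
      \<open>r\<close> of its value at 0, for all \<open>z\<close> in \<open>Kv\<close>
      simultaneously.\<close>
    have est: "norm (f (($) z) y - f (($) z) 0 - y *\<^sub>R f' (($) z) 0) \<le> \<bar>y\<bar> * r" if z: "z \<in> Kv" for z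
    proof -
      have "norm (f (($) z) y - f (($) z) 0 - (y - 0) *\<^sub>R f' (($) z) 0) \<le> norm (y - 0) * r"
      proof (rule vector_differentiable_bound_linearization[where S = "closed_segment 0 y"])
        fix t assume t: "t \<in> closed_segment 0 y"
        then have ty: "\<bar>t\<bar> \<le> \<bar>y\<bar>" by (auto simp: closed_segment_eq_real_ivl split: if_splits)
        show "(f (($) z) has_vector_derivative f' (($) z) t) (at t within closed_segment 0 y)"
          using d[of "($) z" t] z K_subset ty y by (auto simp: Kv_def intro: has_vector_derivative_at_within)
        have t_a: "-a \<le> t \<and> t \<le> a" using ty y by linarith
        have "dist (z, t) (z, 0) < \<delta>" using ty y by (simp add: dist_Pair_Pair)
        then show "norm (f' (($) z) t - f' (($) z) 0) \<le> r"
          using \<delta>(2)[of "(z, 0)" "(z, t)"] z a t_a by (simp add: dist_norm)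
      qed auto
      then show ?thesis by simp
    qed
    let ?I = "\<lambda>g z. indicator Kv z *\<^sub>R (of_real (w (($) z)) * g (($) z) :: complex)"
    let ?g = "\<lambda>z. f z y - f z 0 - y *\<^sub>R f' z 0"
    have i: "integrable lborel (?I (\<lambda>z. f z y))" "integrable lborel (?I (\<lambda>z. f z 0))" "integrable lborel (?I (\<lambda>z. f' z 0))"
      by (intro integrable_wint c y cf'0; use e in simp)+
    have cg: "continuous_on Z ?g" by (intro continuous_intros c y cf'0; use e in simp)
    have "wint Z w (\<lambda>z. f z y) - wint Z w (\<lambda>z. f z 0) - y *\<^sub>R wint Z w (\<lambda>z. f' z 0) =
        (LINT z|lborel. ?I (\<lambda>z. f z y) z - ?I (\<lambda>z. f z 0) z - y *\<^sub>R ?I (\<lambda>z. f' z 0) z)"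
      unfolding wint_Kv
      by (simp only: Bochner_Integration.integral_diff[OF Bochner_Integration.integrable_diff[OF i(1,2)]
            integrable_scaleR_right[OF i(3)]] Bochner_Integration.integral_diff[OF i(1,2)] integral_scaleR_right)
    also have "\<dots> = (LINT z|lborel. ?I ?g z)"
      by (intro Bochner_Integration.integral_cong refl) (simp add: algebra_simps scaleR_conv_of_real)
    finally have eq: "wint Z w (\<lambda>z. f z y) - wint Z w (\<lambda>z. f z 0) - y *\<^sub>R wint Z w (\<lambda>z. f' z 0) = \<dots>" .
    have "norm (LINT z|lborel. ?I ?g z) \<le> (LINT z|lborel. norm (?I ?g z))"
      by (rule integral_norm_bound)
    also have "\<dots> \<le> (LINT z|lborel. (\<bar>y\<bar> * r) * (indicator Kv z *\<^sub>R \<bar>w (($) z)\<bar>))"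
    proof (rule integral_mono)
      show "integrable lborel (\<lambda>z. norm (?I ?g z))" by (intro integrable_norm integrable_wint cg)
      show "integrable lborel (\<lambda>z. (\<bar>y\<bar> * r) * (indicator Kv z *\<^sub>R \<bar>w (($) z)\<bar>))"
        by (intro integrable_mult_right iw)
      fix z :: "complex^'n"
      show "norm (?I ?g z) \<le> (\<bar>y\<bar> * r) * (indicator Kv z *\<^sub>R \<bar>w (($) z)\<bar>)"
      proof (cases "z \<in> Kv")
        case True
        then have "norm (?I ?g z) = \<bar>w (($) z)\<bar> * norm (?g (($) z))"
          by (simp add: norm_mult)
        also have "\<dots> \<le> \<bar>w (($) z)\<bar> * (\<bar>y\<bar> * r)"
          by (rule mult_left_mono[OF est[OF True]]) simp
        finally show ?thesis using True by (simp add: mult.commute)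
      qed simp
    qed
    also have "\<dots> = (\<bar>y\<bar> * r) * M" by (simp add: M_def)
    also have "\<dots> \<le> eps * \<bar>y\<bar>"
    proof -
      have "r * M \<le> eps" using eps M0 by (simp add: r_def field_simps)
      then show ?thesis using mult_left_mono[of "r * M" eps "\<bar>y\<bar>"] by (simp add: algebra_simps)
    qed
    finally show "norm (wint Z w (\<lambda>z. f z y) - wint Z w (\<lambda>z. f z 0) - (y - 0) *\<^sub>R wint Z w (\<lambda>z. f' z 0)) \<le> eps * norm (y - 0)"
      using eq by simp
  qed
qed

end

section \<open>Product domains and derivatives in base directions\<close>

definition prod_dom :: "('n \<Rightarrow> complex) set \<Rightarrow> (nat \<Rightarrow> complex) set \<Rightarrow> ('n + nat \<Rightarrow> complex) set" where
  "prod_dom Z U = {case_sum z y |z y. z \<in> Z \<and> y \<in> U}"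

lemma case_sum_in_prod_dom [simp]: "case_sum z y \<in> prod_dom Z U \<longleftrightarrow> z \<in> Z \<and> y \<in> U"
proof
  assume "case_sum z y \<in> prod_dom Z U"
  then obtain z' y' where e: "case_sum z y = case_sum z' y'" and m: "z' \<in> Z" "y' \<in> U"
    unfolding prod_dom_def by blast
  have "z \<alpha> = z' \<alpha>" "y i = y' i" for \<alpha> i
    using fun_cong[OF e, of "Inl \<alpha>"] fun_cong[OF e, of "Inr i"] by simp_all
  then have "z = z'" "y = y'" by auto
  with m show "z \<in> Z \<and> y \<in> U" by simp
qed (auto simp: prod_dom_def)

lemma copen_prod_dom:
  fixes Z :: "('n \<Rightarrow> complex) set"
  assumes "open Z" "copen {..<N} U"
  shows "copen (UNIV <+> {..<N}) (prod_dom Z U)"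
proof -
  obtain V where V: "open V" "U = coord_space {..<N} \<inter> V"
    using assms(2) unfolding copen_def openin_open by blast
  let ?a = "\<lambda>p::'n + nat \<Rightarrow> complex. (\<lambda>\<alpha>. p (Inl \<alpha>))" and ?b = "\<lambda>p::'n + nat \<Rightarrow> complex. (\<lambda>i. p (Inr i))"
  have "continuous_on UNIV ?a" "continuous_on UNIV ?b"
    by (rule continuous_on_coordinatewise_then_product, simp)+
  then have "open (?a -` Z \<inter> ?b -` V)"
    by (intro open_Int open_vimage assms V)
  moreover have "prod_dom Z U = coord_space (UNIV <+> {..<N}) \<inter> (?a -` Z \<inter> ?b -` V)"
  proof (intro equalityI subsetI)
    fix p assume "p \<in> prod_dom Z U"
    then obtain z y where p: "p = case_sum z y" "z \<in> Z" "y \<in> U" by (auto simp: prod_dom_def)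
    then have y: "y k = 0" if "k \<notin> {..<N}" for k using V that by (simp add: coord_space_def)
    have "p k = 0" if "k \<notin> UNIV <+> {..<N}" for k
      using that by (cases k) (auto simp: p(1) intro!: y)
    then have "p \<in> coord_space (UNIV <+> {..<N})" by (simp add: coord_space_def)
    with p V show "p \<in> coord_space (UNIV <+> {..<N}) \<inter> (?a -` Z \<inter> ?b -` V)" by simp
  next
    fix p assume p: "p \<in> coord_space (UNIV <+> {..<N}) \<inter> (?a -` Z \<inter> ?b -` V)"
    have "p (Inr i) = 0" if "i \<notin> {..<N}" for i
    proof -
      have "Inr i \<notin> UNIV <+> {..<N}" using that by auto
      moreover have "p \<in> coord_space (UNIV <+> {..<N})" using p by (rule IntD1)
      ultimately show ?thesis unfolding coord_space_def mem_Collect_eq by (elim allE impE)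
    qed
    then have "?b p \<in> U" using V p by (simp add: coord_space_def)
    moreover have "p = case_sum (?a p) (?b p)" by (rule ext) (auto split: sum.splits)
    ultimately show "p \<in> prod_dom Z U" using p unfolding prod_dom_def by blast
  qed
  ultimately show ?thesis unfolding copen_def openin_open by blast
qed

lemma line_in_case_sum:
  "line_in c (Inr i) (case_sum z y) t = case_sum z (line_in c i y t)"
  "line_in c (Inl \<alpha>) (case_sum z y) t = case_sum (line_in c \<alpha> z t) y"
  by (auto simp: line_in_def fun_eq_iff split: sum.splits)

lemma continuous_case_sum_line:
  "continuous_on S (\<lambda>x. case_sum (fst x) (line_in c i y (snd x)))"
proof (rule continuous_on_coordinatewise_then_product)
  fix k
  show "continuous_on S (\<lambda>x. case_sum (fst x) (line_in c i y (snd x)) k)"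
  proof (cases k)
    case (Inl \<alpha>)
    then show ?thesis by (simp add: continuous_on_product_then_coordinatewise continuous_on_fst continuous_on_id)
  next
    case (Inr j)
    then show ?thesis
      by (cases "j = i") (auto simp: line_in_def intro!: continuous_intros)
  qed
qed

lemma continuous_case_sum_const: "continuous_on S (\<lambda>z. case_sum z y)"
proof (rule continuous_on_coordinatewise_then_product)
  fix k
  show "continuous_on S (\<lambda>z. case_sum z y k)"
    by (cases k) (auto intro: continuous_on_product_then_coordinatewise continuous_on_id)
qed

lemma continuous_fibre:
  "continuous_on (prod_dom Z U) \<phi> \<Longrightarrow> y \<in> U \<Longrightarrow> continuous_on Z (\<lambda>z. \<phi> (case_sum z y))"
  by (rule continuous_on_compose2[OF _ continuous_case_sum_const]) auto

context weighted_chart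
begin

text \<open>The volume factor depends on the fibre coordinates only, so a derivative in a base
  direction falls on \<phi> alone.\<close>

lemma pd_wint:
  assumes U: "copen {..<N} U" and vol: "continuous_on Z vol"
    and \<phi>: "Ck (UNIV <+> {..<N}) (Suc m) (prod_dom Z U) \<phi>" and y: "y \<in> U" and i: "i < N" and c: "c \<in> {1, \<i>}"
  shows "((\<lambda>t. wint Z w (\<lambda>z. \<phi> (case_sum z (line_in c i y t)) * vol z)) has_vector_derivative
    wint Z w (\<lambda>z. pd c (Inr i) \<phi> (case_sum z y) * vol z)) (at 0)"
proof -
  have "\<forall>\<^sub>F t in nhds 0. line_in c i y t \<in> U" using copen_line[OF U y] i by simp
  then obtain e where e: "e > 0" "\<And>t. \<bar>t\<bar> < e \<Longrightarrow> line_in c i y t \<in> U"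
    unfolding eventually_nhds_metric by (auto simp: dist_real_def)
  have i': "Inr i \<in> UNIV <+> {..<N}" using i by auto
  have "((\<lambda>t. wint Z w (\<lambda>z. \<phi> (case_sum z (line_in c i y t)) * vol z)) has_vector_derivative
    wint Z w (\<lambda>z. pd c (Inr i) \<phi> (case_sum z (line_in c i y 0)) * vol z)) (at 0)"
  proof (rule wint_has_vector_derivative[OF e(1), where f = "\<lambda>z t. \<phi> (case_sum z (line_in c i y t)) * vol z"
        and f' = "\<lambda>z t. pd c (Inr i) \<phi> (case_sum z (line_in c i y t)) * vol z"])
    fix t :: real assume t: "\<bar>t\<bar> < e"
    show "continuous_on Z (\<lambda>z. \<phi> (case_sum z (line_in c i y t)) * vol z)"
      by (intro continuous_on_mult vol continuous_fibre[OF Ck_continuous[OF \<phi>] e(2)[OF t]])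
    fix z assume z: "z \<in> Z"
    have "line_in c (Inr i) (case_sum z y) t \<in> prod_dom Z U" using z e(2)[OF t] by (simp add: line_in_case_sum)
    from has_vector_derivative_mult_left[OF has_vector_derivative_line[OF \<phi> i' c this], of "vol z"]
    show "((\<lambda>t. \<phi> (case_sum z (line_in c i y t)) * vol z) has_vector_derivative
        pd c (Inr i) \<phi> (case_sum z (line_in c i y t)) * vol z) (at t)"
      by (simp add: line_in_case_sum)
  next
    show "continuous_on (Z \<times> {-e<..<e}) (\<lambda>x. pd c (Inr i) \<phi> (case_sum (fst x) (line_in c i y (snd x))) * vol (fst x))"
    proof (rule continuous_on_mult)
      show "continuous_on (Z \<times> {-e<..<e}) (\<lambda>x. pd c (Inr i) \<phi> (case_sum (fst x) (line_in c i y (snd x))))"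
        by (rule continuous_on_compose2[OF Ck_continuous[OF Ck_pd[OF \<phi> i' c]] continuous_case_sum_line]) (auto intro!: e)
      show "continuous_on (Z \<times> {-e<..<e}) (\<lambda>x. vol (fst x))"
        by (rule continuous_on_compose2[OF vol continuous_on_fst[OF continuous_on_id]]) auto
    qed
  qed
  then show ?thesis by simp
qed

end

section \<open>Frame, contraction and curvature on a single fibre\<close>

lemma has_frame_frame_X: "has_frame Inl (map (\<lambda>e. case_sum e (\<lambda>_. 0)) (frame_X :: ('n::finite \<Rightarrow> complex) list))"
  and length_frame_X: "length (frame_X :: ('n \<Rightarrow> complex) list) = 2 * CARD('n)"
proof -
  have "\<exists>l. distinct l \<and> set l = (UNIV :: 'n set)" using finite_distinct_list[OF finite[of "UNIV :: 'n set"]] by blast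
  then have l: "distinct (coord_list :: 'n list)" "set (coord_list :: 'n list) = UNIV"
    unfolding coord_list_def by (metis (mono_tags, lifting) someI_ex)+
  have u: "case_sum ((\<lambda>_. 0)(\<alpha> := c)) (\<lambda>_. 0) = unit_vec (Inl \<alpha>) c" for \<alpha> :: 'n and c
    by (rule ext) (auto simp: unit_vec_def split: sum.splits)
  have "unit_vec (Inl \<alpha>) c \<in> set (map (\<lambda>e. case_sum e (\<lambda>_. 0)) (frame_X :: ('n \<Rightarrow> complex) list))"
    if "c = 1 \<or> c = \<i>" for \<alpha> :: 'n and c
  proof -
    have "(\<lambda>_. 0)(\<alpha> := c) \<in> set frame_X" using that l(2) by (auto simp: frame_X_def)
    then show ?thesis unfolding u[symmetric] by simp
  qed
  then show "has_frame Inl (map (\<lambda>e. case_sum e (\<lambda>_. 0)) (frame_X :: ('n::finite \<Rightarrow> complex) list))"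
    by (simp only: has_frame_def) blast
  have "length (frame_X :: ('n \<Rightarrow> complex) list) = 2 * length (coord_list :: 'n list)"
    by (simp add: frame_X_def length_concat o_def sum_list_triv)
  then show "length (frame_X :: ('n \<Rightarrow> complex) list) = 2 * CARD('n)"
    using distinct_card[OF l(1)] l(2) by simp
qed

text \<open>In the inner product with a multiple of \<omega> one inverse metric cancels
  \<open>G\<close>, which exhibits the adjoint explicitly by Hermitian symmetry; taking
  \<open>f\<close> to be 1 gives uniqueness, as the definite description requires.\<close>

lemma Lambda11_eq:
  fixes G :: "complex^'n::finite^'n"
  assumes "hermitian_pd G"
  shows "Lambda11 G a = - \<i> * (\<Sum>\<alpha>\<in>UNIV. \<Sum>\<beta>\<in>UNIV. matrix_inv G $ \<beta> $ \<alpha> * a $ \<alpha> $ \<beta>)"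
proof -
  let ?c = "- \<i> * (\<Sum>\<alpha>\<in>UNIV. \<Sum>\<beta>\<in>UNIV. matrix_inv G $ \<beta> $ \<alpha> * a $ \<alpha> $ \<beta>)"
  have inv: "invertible G" using assms by (rule invertible_hermitian_pd)
  have herm: "cnj (matrix_inv G $ \<beta> $ \<alpha>) = matrix_inv G $ \<alpha> $ \<beta>" for \<alpha> \<beta>
    using cadj_matrix_inv[OF assms] by (simp add: cadj_def vec_eq_iff)
  have eq: "inner11 G (csm (f * \<i>) G) a = f * cnj ?c" for f
  proof -
    have "inner11 G (csm (f * \<i>) G) a = (\<Sum>\<alpha>\<in>UNIV. \<Sum>\<beta>\<in>UNIV. \<Sum>\<gamma>\<in>UNIV. \<Sum>\<delta>\<in>UNIV.
        (f * \<i>) * (matrix_inv G $ \<gamma> $ \<alpha> * G $ \<alpha> $ \<beta> * (matrix_inv G $ \<beta> $ \<delta> * cnj (a $ \<gamma> $ \<delta>))))"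
      unfolding inner11_def csm_def by (intro sum.cong refl) (simp add: mult.commute mult.left_commute)
    \<comment> \<open>The sum over \<alpha> is brought innermost, where \<open>matrix_inv G\<close>
      meets \<open>G\<close>.\<close>
    also have "\<dots> = (\<Sum>\<gamma>\<in>UNIV. \<Sum>\<delta>\<in>UNIV. \<Sum>\<beta>\<in>UNIV. \<Sum>\<alpha>\<in>UNIV.
        (f * \<i>) * (matrix_inv G $ \<gamma> $ \<alpha> * G $ \<alpha> $ \<beta> * (matrix_inv G $ \<beta> $ \<delta> * cnj (a $ \<gamma> $ \<delta>))))"
      by (subst sum.swap, subst (2) sum.swap, subst (1) sum.swap, subst (3) sum.swap, subst (2) sum.swap, subst (3) sum.swap)
        (rule sum.cong[OF refl], rule sum.cong[OF refl], rule sum.swap)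
    also have "\<dots> = (\<Sum>\<gamma>\<in>UNIV. \<Sum>\<delta>\<in>UNIV. \<Sum>\<beta>\<in>UNIV.
        (f * \<i>) * ((\<Sum>\<alpha>\<in>UNIV. matrix_inv G $ \<gamma> $ \<alpha> * G $ \<alpha> $ \<beta>) * (matrix_inv G $ \<beta> $ \<delta> * cnj (a $ \<gamma> $ \<delta>))))"
      by (simp only: sum_distrib_left sum_distrib_right)
    also have "\<dots> = (\<Sum>\<gamma>\<in>UNIV. \<Sum>\<delta>\<in>UNIV. (f * \<i>) * (matrix_inv G $ \<gamma> $ \<delta> * cnj (a $ \<gamma> $ \<delta>)))"
      unfolding matrix_inv_sums(1)[OF inv]
      by (simp add: if_distrib[of "\<lambda>c. c * _"] if_distrib[of "\<lambda>c. _ * c"] cong: if_cong)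
    also have "\<dots> = f * cnj ?c"
      by (simp add: herm sum_distrib_left mult.assoc)
    finally show ?thesis .
  qed
  show ?thesis
    unfolding Lambda11_def
  proof (rule the_equality)
    fix c assume "\<forall>f. inner11 G (csm (f * \<i>) G) a = f * cnj c"
    then have "inner11 G (csm (1 * \<i>) G) a = 1 * cnj c" by blast
    then show "c = ?c" unfolding eq by (simp only: mult_1_left complex_cnj_cancel_iff)
  qed (use eq in blast)
qed

text \<open>The factor \<i> cancels the -\<i> of \<open>Lambda11_eq\<close>. The curvature term of
  the vortex equation is thus the very contraction that occurs in
  \<open>trace_wedge_square_fibre\<close>.\<close>

lemma Lambda_mat_eq:
  fixes G :: "complex^'n::finite^'n" and Rm :: "'n \<Rightarrow> 'n \<Rightarrow> complex^'r^'r"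
  assumes "hermitian_pd G"
  shows "csm \<i> (Lambda_mat G Rm) = (\<Sum>\<alpha>\<in>UNIV. \<Sum>\<beta>\<in>UNIV. csm (matrix_inv G $ \<beta> $ \<alpha>) (Rm \<alpha> \<beta>))"
  by (simp add: vec_eq_iff csm_def Lambda_mat_def Lambda11_eq[OF assms] sum_component flip: mult.assoc)

lemma pd_fibre: "pd c (Inl \<alpha>) f (case_sum z y) = pd c \<alpha> (\<lambda>w. f (case_sum w y)) z"
  by (simp add: pd_def line_in_case_sum)

text \<open>Only derivatives in fibre directions occur, and they commute with fixing
  \<open>y\<close>. Openness of \<open>Z\<close> matters because \<open>H'\<close> is known only
  there.\<close>

lemma curv_coeff_fibre:
  fixes Z :: "('n \<Rightarrow> complex) set"
  assumes "open Z" "z \<in> Z" "\<And>w. w \<in> Z \<Longrightarrow> H' w = H (case_sum w y)"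
  shows "curv_coeff H' \<alpha> \<beta> z = curv_coeff H (Inl \<alpha>) (Inl \<beta>) (case_sum z y)"
proof -
  have Z: "copen UNIV Z" using assms(1) by (simp add: copen_def coord_space_def)
  have "conn H' \<alpha> w = conn H (Inl \<alpha>) (case_sum w y)" if "w \<in> Z" for w
    using mat_dd_cong(1)[OF Z that, of \<alpha> H' "\<lambda>w. H (case_sum w y)"] assms(3)
    by (simp add: conn_def mat_dd_def dd_def pd_fibre that)
  from mat_dd_cong(2)[OF Z assms(2) _ this, of \<beta>] show ?thesis
    by (simp add: curv_coeff_def mat_ddbar_def ddbar_def pd_fibre)
qed

lemma continuous_kaehler_pow:
  fixes G :: "'a::topological_space \<Rightarrow> complex^'n::finite^'n"
  assumes "\<And>\<alpha> \<beta>. continuous_on S (\<lambda>z. G z $ \<alpha> $ \<beta>)"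
  shows "continuous_on S (\<lambda>z. kaehler_pow \<iota> (G z) m L)"
proof -
  have "continuous_on S (\<lambda>z. wedge_pow (kaehler_form \<iota> (G z)) m L)"
  proof (induction m arbitrary: L)
    case (Suc m)
    have "continuous_on S (\<lambda>z. kaehler_form \<iota> (G z) l)" for l
      unfolding kaehler_form_def by (intro continuous_on_sum continuous_on_mult continuous_on_const assms)
    then show ?case
      unfolding wedge_pow.simps wedge_by_def
      by (intro continuous_on_sum continuous_on_scaleR continuous_on_const continuous_on_mult Suc.IH)
  qed simp
  then show ?thesis
    unfolding kaehler_pow_def by (intro continuous_on_divide continuous_on_const) auto
qed

lemma curvature_form_pair:
  "curvature_form I H p [x, y] = (\<Sum>k\<in>I. \<Sum>l\<in>I. csm (x k * cnj (y l) - y k * cnj (x l)) (curv_coeff H k l p))"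
  unfolding curvature_form_def
  by (intro sum.cong refl) (simp add: wedge_dzbar_dz curv_coeff_def csm_minus csm_minus_left[symmetric])

lemma form_deg_curvature_form: "form_deg 2 (curvature_form I H p)"
proof -
  have "wedge (dzbar l) (dz k) vs = 0" if "length vs \<noteq> 2" for k l and vs :: "('a \<Rightarrow> complex) list"
    using form_deg_wedge[OF form_deg_dzbar form_deg_dz, of l k] that by (simp add: form_deg_def)
  then show ?thesis
    unfolding form_deg_def curvature_form_def by simp
qed

lemma trace_curvature_form_base:
  fixes H :: "('n::finite + nat \<Rightarrow> complex) \<Rightarrow> complex^'r^'r"
  shows "trace (curvature_form (UNIV <+> {..<N}) H p [case_sum (\<lambda>_. 0) u, case_sum (\<lambda>_. 0) v]) =
    (\<Sum>i<N. \<Sum>j<N. wedge (dz i) (dzbar j) [u, v] * trace (curv_coeff H (Inr i) (Inr j) p))"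
  unfolding curvature_form_pair wedge_dz_dzbar by (simp add: sum.Plus trace_sum trace_csm)

text \<open>The closed support of the weight is compact because \<open>X\<close> is, and the chart
  carries it to a compact set of coordinates.\<close>

lemma weighted_chartI:
  fixes AX :: "('x::topological_space, 'n::finite) chart set"
  assumes "complex_manifold AX" "compact (UNIV :: 'x set)" "C \<in> AX"
    and "open P" "P \<subseteq> fst C" "continuous_on UNIV \<rho>" "closure {x. \<rho> x \<noteq> 0} \<subseteq> P"
  shows "weighted_chart (snd C ` P) (snd C ` closure {x. \<rho> x \<noteq> 0}) (\<lambda>z. \<rho> (chart_inv C z))"
proof -
  have op: "open (snd C ` fst C)" and hom: "homeomorphism (fst C) (snd C ` fst C) (snd C) (chart_inv C)"
    using assms(1,3) by (auto simp: complex_manifold_def copen_def coord_space_def)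
  have cc: "continuous_on (fst C) (snd C)" and ci: "continuous_on (snd C ` fst C) (chart_inv C)"
    and inv: "\<And>x. x \<in> fst C \<Longrightarrow> chart_inv C (snd C x) = x"
    using hom by (auto simp: homeomorphism_def)
  show ?thesis
  proof
    have "snd C ` P = snd C ` fst C \<inter> chart_inv C -` P"
      using assms(5) inv by (auto simp: image_iff)
    then show "open (snd C ` P)" using continuous_open_preimage[OF ci op assms(4)] by simp
    have "compact (closure {x. \<rho> x \<noteq> 0})" using compact_Int_closed[OF assms(2) closed_closure] by simp
    then show "compact (snd C ` closure {x. \<rho> x \<noteq> 0})"
      by (rule compact_continuous_image[rotated]) (rule continuous_on_subset[OF cc], use assms(5,7) in blast)
    show "snd C ` closure {x. \<rho> x \<noteq> 0} \<subseteq> snd C ` P" using assms(7) by blast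
    show "continuous_on (snd C ` P) (\<lambda>z. \<rho> (chart_inv C z))"
      by (rule continuous_on_compose2[OF assms(6) continuous_on_subset[OF ci]]) (use assms(5) in auto)
    fix z assume "z \<in> snd C ` P" "z \<notin> snd C ` closure {x. \<rho> x \<noteq> 0}"
    then obtain x where x: "x \<in> P" "z = snd C x" "x \<notin> closure {x. \<rho> x \<noteq> 0}" by blast
    then have "\<rho> x = 0" using closure_subset[of "{x. \<rho> x \<noteq> 0}"] by blast
    moreover have "chart_inv C z = x" using x inv assms(5) by auto
    ultimately show "\<rho> (chart_inv C z) = 0" by simp
  qed
qed

section \<open>Fibre integrals\<close>

text \<open>Continuity along one fixed fibre, which is what linearity of the integral over that
  fibre needs.\<close>

definition fcont :: "('n \<Rightarrow> complex) set \<Rightarrow> (nat \<Rightarrow> complex) \<Rightarrow> (('n + nat \<Rightarrow> complex) \<Rightarrow> complex) \<Rightarrow> bool" where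
  "fcont Z y \<phi> \<longleftrightarrow> continuous_on Z (\<lambda>z. \<phi> (case_sum z y))"

lemma fcont_intros:
  "fcont Z y \<phi> \<Longrightarrow> fcont Z y \<psi> \<Longrightarrow> fcont Z y (\<lambda>p. \<phi> p + \<psi> p)"
  "fcont Z y \<phi> \<Longrightarrow> fcont Z y \<psi> \<Longrightarrow> fcont Z y (\<lambda>p. \<phi> p * \<psi> p)"
  "fcont Z y (\<lambda>p. c)"
  by (simp_all add: fcont_def continuous_on_add continuous_on_mult)

lemma fcont_sum: "(\<And>i. i \<in> S \<Longrightarrow> fcont Z y (\<phi> i)) \<Longrightarrow> fcont Z y (\<lambda>p. \<Sum>i\<in>S. \<phi> i p)"
  by (simp add: fcont_def continuous_on_sum)

lemma fcont_Ck: "Ck I m (prod_dom Z U) \<phi> \<Longrightarrow> y \<in> U \<Longrightarrow> fcont Z y \<phi>"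
  unfolding fcont_def by (rule continuous_fibre[OF Ck_continuous])

lemma fcont_trace_mult:
  "(\<And>i j. fcont Z y (\<lambda>p. A p $ i $ j)) \<Longrightarrow> (\<And>i j. fcont Z y (\<lambda>p. B p $ i $ j)) \<Longrightarrow> fcont Z y (\<lambda>p. trace (A p ** B p))"
  unfolding trace_def matrix_matrix_mult_def by (auto intro!: fcont_sum fcont_intros)

text \<open>The setting over the ambient set \<open>U\<close> in which fibre integrals are computed
  and differentiated. Bundle metrics enter later, and the vortex equations only at one point of
  \<open>U\<close>.\<close>

locale local_family =
  fixes g :: "('x::topological_space, 'n::finite) chart \<Rightarrow> ('n \<Rightarrow> complex) \<Rightarrow> complex^'n^'n"
    and R :: "('x, 'n, 'a, 'r1::finite, 'r2::finite) local_rep" and N :: nat and U :: "(nat \<Rightarrow> complex) set"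
    and K :: "nat \<Rightarrow> ('n \<Rightarrow> complex) set" and dom :: "nat \<Rightarrow> ('n \<Rightarrow> complex) set"
  assumes dom: "\<And>k. dom k = snd (coord R k) ` piece R k"
    and wc: "\<And>k. k < pieces R \<Longrightarrow> weighted_chart (dom k) (K k) (\<lambda>z. weight R k (chart_inv (coord R k) z))"
    and g_cont: "\<And>k \<alpha> \<beta>. k < pieces R \<Longrightarrow> continuous_on (dom k) (\<lambda>z. g (coord R k) z $ \<alpha> $ \<beta>)"
    and g_pd: "\<And>k z. k < pieces R \<Longrightarrow> z \<in> dom k \<Longrightarrow> hermitian_pd (g (coord R k) z)"
    and U: "copen {..<N} U"
begin

abbreviation "frame \<equiv> map (\<lambda>e. case_sum e (\<lambda>_::nat. 0)) (frame_X :: ('n \<Rightarrow> complex) list)"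
abbreviation "base \<equiv> (\<lambda>u. case_sum (\<lambda>_::'n. 0) u :: 'n + nat \<Rightarrow> complex)"
abbreviation "coords \<equiv> UNIV <+> {..<N} :: ('n + nat) set"

definition vol :: "nat \<Rightarrow> ('n \<Rightarrow> complex) \<Rightarrow> complex" where
  "vol k z = kaehler_pow Inl (g (coord R k) z) CARD('n) frame"

text \<open>The common form of all fibre integrals below: on the frame, every integrand becomes a
  function times the volume factor.\<close>

definition fint :: "(nat \<Rightarrow> complex) \<Rightarrow> (nat \<Rightarrow> ('n + nat \<Rightarrow> complex) \<Rightarrow> complex) \<Rightarrow> complex" where
  "fint y \<phi> = (\<Sum>k<pieces R. wint (dom k) (\<lambda>z. weight R k (chart_inv (coord R k) z)) (\<lambda>z. \<phi> k (case_sum z y) * vol k z))"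

abbreviation "fibre_cont y \<phi> \<equiv> \<forall>k<pieces R. fcont (dom k) y (\<phi> k)"

lemma dom_open: "k < pieces R \<Longrightarrow> open (dom k)"
  using wc weighted_chart.open_Z by blast

lemma copen_dom: "k < pieces R \<Longrightarrow> copen coords (prod_dom (dom k) U)"
  by (rule copen_prod_dom[OF dom_open U])

lemma vol_cont: "k < pieces R \<Longrightarrow> continuous_on (dom k) (vol k)"
  unfolding vol_def by (rule continuous_kaehler_pow[OF g_cont])

lemma fint_eq:
  "fint y \<phi> = fibre_integral R (\<lambda>k p vs. \<phi> k p * omega_pow g R CARD('n) k p vs) y []"
  by (simp add: fint_def fibre_integral_def chart_integral_def wint_def dom vol_def omega_pow_def metric_at_def)

lemma fibre_integral_eq_fint:
  assumes "\<And>k z. k < pieces R \<Longrightarrow> z \<in> dom k \<Longrightarrow> \<eta> k (case_sum z y) (map base us @ frame) = \<phi> k (case_sum z y) * vol k z"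
  shows "fibre_integral R \<eta> y us = fint y \<phi>"
proof -
  have "fibre_integral R \<eta> y us = (\<Sum>k<pieces R. wint (dom k) (\<lambda>z. weight R k (chart_inv (coord R k) z))
      (\<lambda>z. \<eta> k (case_sum z y) (map base us @ frame)))"
    by (simp add: fibre_integral_def chart_integral_def wint_def dom)
  also have "\<dots> = fint y \<phi>"
    unfolding fint_def by (intro sum.cong refl weighted_chart.wint_cong[OF wc] assms) auto
  finally show ?thesis .
qed

lemma fint_cong:
  "(\<And>k z. k < pieces R \<Longrightarrow> z \<in> dom k \<Longrightarrow> \<phi> k (case_sum z y) = \<psi> k (case_sum z y)) \<Longrightarrow> fint y \<phi> = fint y \<psi>"
  unfolding fint_def by (intro sum.cong refl weighted_chart.wint_cong[OF wc]) auto

lemma fint_add: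
  assumes "fibre_cont y \<phi>" "fibre_cont y \<psi>"
  shows "fint y (\<lambda>k p. \<phi> k p + \<psi> k p) = fint y \<phi> + fint y \<psi>"
  unfolding fint_def sum.distrib[symmetric]
proof (intro sum.cong refl)
  fix k assume k: "k \<in> {..<pieces R}"
  then have "continuous_on (dom k) (\<lambda>z. \<phi> k (case_sum z y) * vol k z)" "continuous_on (dom k) (\<lambda>z. \<psi> k (case_sum z y) * vol k z)"
    using assms vol_cont by (auto simp: fcont_def intro!: continuous_on_mult)
  from weighted_chart.wint_add[OF wc this]
  show "wint (dom k) (\<lambda>z. weight R k (chart_inv (coord R k) z)) (\<lambda>z. (\<phi> k (case_sum z y) + \<psi> k (case_sum z y)) * vol k z) =
      wint (dom k) (\<lambda>z. weight R k (chart_inv (coord R k) z)) (\<lambda>z. \<phi> k (case_sum z y) * vol k z) +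
      wint (dom k) (\<lambda>z. weight R k (chart_inv (coord R k) z)) (\<lambda>z. \<psi> k (case_sum z y) * vol k z)"
    using k by (simp add: distrib_right)
qed

lemma fint_cmult: "fint y (\<lambda>k p. c * \<phi> k p) = c * fint y \<phi>"
  unfolding fint_def sum_distrib_left
  by (intro sum.cong refl) (simp add: weighted_chart.wint_cmult[OF wc, symmetric] mult.assoc)

lemma fint_zero: "fint y (\<lambda>k p. 0) = 0"
  using fint_cmult[of y 0 "\<lambda>k p. 0"] by simp

lemma fint_diff:
  assumes "fibre_cont y \<phi>" "fibre_cont y \<psi>"
  shows "fint y (\<lambda>k p. \<phi> k p - \<psi> k p) = fint y \<phi> - fint y \<psi>"
proof -
  have "fibre_cont y (\<lambda>k p. - 1 * \<psi> k p)"
    using assms(2) by (intro allI impI fcont_intros) simp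
  from fint_add[OF assms(1) this] show ?thesis unfolding fint_cmult by simp
qed

lemma fint_sum:
  assumes "\<And>i. i \<in> S \<Longrightarrow> fibre_cont y (\<phi> i)"
  shows "fint y (\<lambda>k p. \<Sum>i\<in>S. \<phi> i k p) = (\<Sum>i\<in>S. fint y (\<phi> i))"
  using assms
proof (induction S rule: infinite_finite_induct)
  case (insert i S)
  then have "fibre_cont y (\<lambda>k p. \<Sum>i\<in>S. \<phi> i k p)" by (auto intro!: fcont_sum)
  with insert show ?case by (simp add: fint_add)
qed (simp_all add: fint_zero)

lemma fint_lin:
  assumes "\<And>i j. i < N \<Longrightarrow> j < N \<Longrightarrow> fibre_cont y (\<phi> i j)"
  shows "fint y (\<lambda>k p. \<Sum>i<N. \<Sum>j<N. c i j * \<phi> i j k p) = (\<Sum>i<N. \<Sum>j<N. c i j * fint y (\<phi> i j))"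
proof -
  have *: "fcont (dom k) y (\<lambda>p. c i j * \<phi> i j k p)" if "i < N" "j < N" "k < pieces R" for i j k
    using assms[OF that(1,2)] that(3) by (intro fcont_intros) auto
  have "fint y (\<lambda>k p. \<Sum>i<N. \<Sum>j<N. c i j * \<phi> i j k p) = (\<Sum>i<N. fint y (\<lambda>k p. \<Sum>j<N. c i j * \<phi> i j k p))"
    by (rule fint_sum) (auto intro!: fcont_sum *)
  also have "\<dots> = (\<Sum>i<N. \<Sum>j<N. fint y (\<lambda>k p. c i j * \<phi> i j k p))"
    by (intro sum.cong refl fint_sum) (auto intro!: *)
  finally show ?thesis by (simp add: fint_cmult)
qed

lemma pd_fint:
  assumes \<phi>: "\<And>k. k < pieces R \<Longrightarrow> Ck coords (Suc m) (prod_dom (dom k) U) (\<phi> k)"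
    and y: "y \<in> U" and i: "i < N" and c: "c \<in> {1, \<i>}"
  shows "pd c i (\<lambda>y. fint y \<phi>) y = fint y (\<lambda>k. pd c (Inr i) (\<phi> k))"
  unfolding fint_def
  by (intro pd_eqI has_vector_derivative_sum)
    (auto intro!: weighted_chart.pd_wint[OF wc U vol_cont \<phi> y i c])

lemma dd_fint:
  assumes \<phi>: "\<And>k. k < pieces R \<Longrightarrow> Ck coords (Suc m) (prod_dom (dom k) U) (\<phi> k)" and y: "y \<in> U" and i: "i < N"
  shows "dd i (\<lambda>y. fint y \<phi>) y = fint y (\<lambda>k. dd (Inr i) (\<phi> k))"
    and "ddbar i (\<lambda>y. fint y \<phi>) y = fint y (\<lambda>k. ddbar (Inr i) (\<phi> k))"
proof -
  have c: "fibre_cont y (\<lambda>k. pd c (Inr i) (\<phi> k))" if "c \<in> {1, \<i>}" for c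
    using i by (intro allI impI fcont_Ck[OF Ck_pd[OF \<phi> _ that] y]) auto
  have lin: "fint y (\<lambda>k p. (1 / 2) * (pd 1 (Inr i) (\<phi> k) p + a * pd \<i> (Inr i) (\<phi> k) p)) =
      (fint y (\<lambda>k. pd 1 (Inr i) (\<phi> k)) + a * fint y (\<lambda>k. pd \<i> (Inr i) (\<phi> k))) / 2" for a
  proof -
    have "fibre_cont y (\<lambda>k p. a * pd \<i> (Inr i) (\<phi> k) p)" using c[of \<i>] by (auto intro!: fcont_intros)
    with c[of 1] show ?thesis unfolding fint_cmult by (subst fint_add) (simp_all add: fint_cmult)
  qed
  show "dd i (\<lambda>y. fint y \<phi>) y = fint y (\<lambda>k. dd (Inr i) (\<phi> k))"
    using lin[of "- \<i>"] by (simp add: dd_def[abs_def] pd_fint[OF \<phi> y i])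
  show "ddbar i (\<lambda>y. fint y \<phi>) y = fint y (\<lambda>k. ddbar (Inr i) (\<phi> k))"
    using lin[of "\<i>"] by (simp add: ddbar_def[abs_def] pd_fint[OF \<phi> y i])
qed

lemma dd_ddbar_fint:
  assumes \<phi>: "\<And>k. k < pieces R \<Longrightarrow> Ck coords (Suc (Suc m)) (prod_dom (dom k) U) (\<phi> k)" and y: "y \<in> U" and ij: "i < N" "j < N"
  shows "dd i (ddbar j (\<lambda>y. fint y \<phi>)) y = fint y (\<lambda>k. dd (Inr i) (ddbar (Inr j) (\<phi> k)))"
proof -
  \<comment> \<open>The inner derivative has to be identified on all of the open set
    \<open>U\<close>, not just at \<open>y\<close>, before it is differentiated again.\<close>
  have "dd i (ddbar j (\<lambda>y. fint y \<phi>)) y = dd i (\<lambda>y. fint y (\<lambda>k. ddbar (Inr j) (\<phi> k))) y"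
    using ij by (intro dd_cong(1)[OF U y] dd_fint(2)[OF \<phi>]) auto
  also have "\<dots> = fint y (\<lambda>k. dd (Inr i) (ddbar (Inr j) (\<phi> k)))"
    using ij by (intro dd_fint(1)[OF Ck_dd(2)[OF copen_dom \<phi>] y]) auto
  finally show ?thesis .
qed

lemma g_inv_cont: "k < pieces R \<Longrightarrow> fcont (dom k) y (\<lambda>p. matrix_inv (metric_at g R k p) $ \<beta> $ \<alpha>)"
proof -
  assume k: "k < pieces R"
  have "copen UNIV (dom k)" using dom_open[OF k] by (simp add: copen_def coord_space_def)
  then have "mCk UNIV 0 (dom k) (\<lambda>z. matrix_inv (g (coord R k) z))"
    using g_cont[OF k] invertible_hermitian_pd[OF g_pd[OF k]] by (intro mCk_matrix_inv) (auto simp: mCk_def)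
  then show ?thesis by (simp add: mCk_def fcont_def metric_at_def)
qed

context
  fixes H :: "nat \<Rightarrow> ('n + nat \<Rightarrow> complex) \<Rightarrow> complex^'r^'r" and y :: "nat \<Rightarrow> complex"
  assumes H: "\<And>k. k < pieces R \<Longrightarrow> mCk coords 2 (prod_dom (dom k) U) (H k)"
    and H_pd: "\<And>k p. k < pieces R \<Longrightarrow> p \<in> prod_dom (dom k) U \<Longrightarrow> hermitian_pd (H k p)"
    and y: "y \<in> U"
begin

lemma curv_coeff_cont:
  assumes "k < pieces R" "a \<in> coords" "b \<in> coords"
  shows "fcont (dom k) y (\<lambda>p. curv_coeff (H k) a b p $ r $ q)"
proof -
  have "mCk coords (Suc 0) (prod_dom (dom k) U) (conn (H k) a)"
    using H[OF assms(1)] by (intro mCk_conn copen_dom assms H_pd[OF assms(1)]) (simp_all add: numeral_2_eq_2)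
  then have "mCk coords 0 (prod_dom (dom k) U) (\<lambda>p. - mat_ddbar b (conn (H k) a) p)"
    by (intro mCk_minus mCk_dd copen_dom assms)
  then show ?thesis
    using fcont_Ck[OF mCk_D y] unfolding curv_coeff_def[abs_def] by blast
qed

lemma curv_density_cont:
  assumes "i < N" "j < N"
  shows "fibre_cont y (\<lambda>k p. curv_density (metric_at g R k p) (H k) i j p)"
  unfolding curv_density_def trace_sum trace_csm
  using assms by (intro allI impI fcont_sum fcont_intros g_inv_cont fcont_trace_mult curv_coeff_cont) auto

lemma trace_curv_coeff_cont:
  assumes "i < N" "j < N" "\<And>k r q. k < pieces R \<Longrightarrow> fcont (dom k) y (\<lambda>p. S k p $ r $ q)"
  shows "fibre_cont y (\<lambda>k p. trace (curv_coeff (H k) (Inr i) (Inr j) p ** S k p))"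
  using assms by (intro allI impI fcont_trace_mult curv_coeff_cont) auto

text \<open>\<open>S\<close> stands for the quadratic term of the vortex equation, so that both
  bundles are covered: \<Phi> times its adjoint for the first, minus the opposite product for the
  second. The scalar part of the equation contributes -\<tau> times the trace of the base curvature,
  which the second integral in \<open>chern_term\<close> cancels.\<close>

lemma chern_term_pair:
  assumes S: "\<And>k r q. k < pieces R \<Longrightarrow> fcont (dom k) y (\<lambda>p. S k p $ r $ q)"
    and vortex: "\<And>k z. k < pieces R \<Longrightarrow> z \<in> dom k \<Longrightarrow>
      (\<Sum>\<alpha>\<in>UNIV. \<Sum>\<beta>\<in>UNIV. csm (matrix_inv (g (coord R k) z) $ \<beta> $ \<alpha>) (curv_coeff (H k) (Inl \<alpha>) (Inl \<beta>) (case_sum z y))) =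
      mat (of_real \<tau>) - S k (case_sum z y)"
  shows "chern_term N g R H \<tau> y [u, v] = \<i> * (\<Sum>i<N. \<Sum>j<N. wedge (dz i) (dzbar j) [u, v] *
    (fint y (\<lambda>k p. curv_density (metric_at g R k p) (H k) i j p) +
     fint y (\<lambda>k p. trace (curv_coeff (H k) (Inr i) (Inr j) p ** S k p))))"
proof -
  define c where "c = (\<lambda>i j. wedge (dz i) (dzbar j) [u, v])"
  define X where "X = (\<lambda>i j k p. curv_density (metric_at g R k p) (H k) i j p)"
  define Y where "Y = (\<lambda>i j k p. trace (curv_coeff (H k) (Inr i) (Inr j) p ** S k p))"
  define T where "T = (\<lambda>i j k p. trace (curv_coeff (H k) (Inr i) (Inr j) p))"
  have cX: "fibre_cont y (X i j)" and cY: "fibre_cont y (Y i j)" and cT: "fibre_cont y (T i j)" if "i < N" "j < N" for i j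
  proof -
    show "fibre_cont y (X i j)" unfolding X_def by (rule curv_density_cont[OF that])
    show "fibre_cont y (Y i j)" unfolding Y_def by (rule trace_curv_coeff_cont[OF that S])
    have "fcont (dom k) y (\<lambda>p. mat 1 $ r $ q)" for k and r q :: 'r
      by (rule fcont_intros(3))
    then show "fibre_cont y (T i j)"
      using trace_curv_coeff_cont[OF that, of "\<lambda>k p. mat 1"] by (simp add: T_def)
  qed
  let ?\<Omega> = "\<lambda>k p. curvature_form coords (H k) p"
  \<comment> \<open>Types are nonempty, so the subtraction is not truncated and the power n-1 in the
    integrand becomes the volume form.\<close>
  have Suc_n: "Suc (CARD('n) - 1) = CARD('n)" by simp
  have "fibre_integral R (\<lambda>k p. wedge (\<lambda>us. trace (wedge_by (**) (?\<Omega> k p) (?\<Omega> k p) us)) (omega_pow g R (CARD('n) - 1) k p)) y [u, v] =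
      fint y (\<lambda>k p. \<Sum>i<N. \<Sum>j<N. (2 * \<i> * c i j) * (X i j k p - (of_real \<tau> * T i j k p - Y i j k p)))"
  proof (rule fibre_integral_eq_fint)
    fix k z assume k: "k < pieces R" and z: "z \<in> dom k"
    let ?p = "case_sum z y" and ?G = "g (coord R k) z"
    have inv: "invertible ?G" by (rule invertible_hermitian_pd[OF g_pd[OF k z]])
    have m: "metric_at g R k ?p = ?G" by (simp add: metric_at_def)
    have tr: "trace (curv_coeff (H k) (Inr i) (Inr j) ?p ** (mat (of_real \<tau>) - S k ?p)) = of_real \<tau> * T i j k ?p - Y i j k ?p" for i j
    proof -
      have "mat (of_real \<tau>) = csm (of_real \<tau>) (mat 1 :: complex^'r^'r)" by (simp add: csm_def mat_def vec_eq_iff)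
      then show ?thesis
        by (simp add: matrix_mult_diff trace_sub csm_mult_right trace_csm T_def Y_def)
    qed
    have "wedge (\<lambda>us. trace (wedge_by (**) (?\<Omega> k ?p) (?\<Omega> k ?p) us)) (kaehler_pow Inl ?G (CARD('n) - 1)) (base u # base v # frame) =
        2 * \<i> * (\<Sum>i<N. \<Sum>j<N. c i j * (X i j k ?p - (of_real \<tau> * T i j k ?p - Y i j k ?p))) * vol k z"
    proof -
      note t = trace_wedge_square_fibre[where \<Omega> = "?\<Omega> k ?p" and Rm = "\<lambda>a b. curv_coeff (H k) a b ?p" and N = N
          and m = "CARD('n) - 1" and u = u and v = v,
          OF curvature_form_pair[where I = coords and H = "H k" and p = ?p]
            form_deg_curvature_form has_frame_frame_X _ inv]
      show ?thesis
        unfolding c_def X_def curv_density_def m vol_def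
        by (rule t[unfolded vortex[OF k z] tr Suc_n]) auto
    qed
    then show "wedge (\<lambda>us. trace (wedge_by (**) (?\<Omega> k ?p) (?\<Omega> k ?p) us)) (omega_pow g R (CARD('n) - 1) k ?p) (map base [u, v] @ frame) =
        (\<Sum>i<N. \<Sum>j<N. (2 * \<i> * c i j) * (X i j k ?p - (of_real \<tau> * T i j k ?p - Y i j k ?p))) * vol k z"
      by (simp add: omega_pow_def m sum_distrib_left mult.assoc)
  qed
  also have "\<dots> = (\<Sum>i<N. \<Sum>j<N. (2 * \<i> * c i j) * (fint y (X i j) - (of_real \<tau> * fint y (T i j) - fint y (Y i j))))"
  proof -
    have cT': "fibre_cont y (\<lambda>k p. of_real \<tau> * T i j k p)" if "i < N" "j < N" for i j
      using cT[OF that] by (auto intro!: fcont_intros)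
    have cd: "fibre_cont y (\<lambda>k p. \<phi> k p - \<psi> k p)" if "fibre_cont y \<phi>" "fibre_cont y \<psi>" for \<phi> \<psi>
      using that by (auto simp: fcont_def intro!: continuous_on_diff)
    have "fint y (\<lambda>k p. X i j k p - (of_real \<tau> * T i j k p - Y i j k p)) =
        fint y (X i j) - (of_real \<tau> * fint y (T i j) - fint y (Y i j))" if "i < N" "j < N" for i j
      unfolding fint_diff[OF cX[OF that] cd[OF cT'[OF that] cY[OF that]]] fint_diff[OF cT'[OF that] cY[OF that]] fint_cmult ..
    moreover have "fibre_cont y (\<lambda>k p. X i j k p - (of_real \<tau> * T i j k p - Y i j k p))" if "i < N" "j < N" for i j
      by (rule cd[OF cX[OF that] cd[OF cT'[OF that] cY[OF that]]])
    ultimately show ?thesis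
      by (subst fint_lin) simp_all
  qed
  finally have 1: "fibre_integral R (\<lambda>k p. wedge (\<lambda>us. trace (wedge_by (**) (?\<Omega> k p) (?\<Omega> k p) us)) (omega_pow g R (CARD('n) - 1) k p)) y [u, v] =
    (\<Sum>i<N. \<Sum>j<N. (2 * \<i> * c i j) * (fint y (X i j) - (of_real \<tau> * fint y (T i j) - fint y (Y i j))))" .
  have "fibre_integral R (\<lambda>k p. wedge (\<lambda>us. trace (csm \<i> (?\<Omega> k p us))) (omega_pow g R CARD('n) k p)) y [u, v] =
      fint y (\<lambda>k p. \<Sum>i<N. \<Sum>j<N. (\<i> * c i j) * T i j k p)"
  proof (rule fibre_integral_eq_fint)
    fix k z assume k: "k < pieces R" and z: "z \<in> dom k"
    let ?p = "case_sum z y"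
    have deg: "form_deg 2 (\<lambda>us. trace (csm \<i> (?\<Omega> k ?p us)))"
      using form_deg_curvature_form[of coords "H k" ?p] by (simp add: form_deg_def)
    have ki: "kills (base w) (omega_pow g R CARD('n) k ?p)" for w
      unfolding omega_pow_def by (rule kills_kaehler_pow) simp
    show "wedge (\<lambda>us. trace (csm \<i> (?\<Omega> k ?p us))) (omega_pow g R CARD('n) k ?p) (map base [u, v] @ frame) =
        (\<Sum>i<N. \<Sum>j<N. (\<i> * c i j) * T i j k ?p) * vol k z"
      using wedge_base_pair[OF deg ki ki, of u v frame]
      by (simp add: trace_csm trace_curvature_form_base c_def T_def sum_distrib_left mult.assoc omega_pow_def metric_at_def vol_def)
  qed
  also have "\<dots> = (\<Sum>i<N. \<Sum>j<N. (\<i> * c i j) * fint y (T i j))"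
    by (rule fint_lin[OF cT])
  finally have 2: "fibre_integral R (\<lambda>k p. wedge (\<lambda>us. trace (csm \<i> (?\<Omega> k p us))) (omega_pow g R CARD('n) k p)) y [u, v] =
      (\<Sum>i<N. \<Sum>j<N. (\<i> * c i j) * fint y (T i j))" .
  \<comment> \<open>The factor 1/2 meets the 2 of \<open>trace_wedge_square_fibre\<close>, and the
    multiples of \<open>T\<close> cancel.\<close>
  have "chern_term N g R H \<tau> y [u, v] = \<i> * (\<Sum>i<N. \<Sum>j<N. c i j * (fint y (X i j) + fint y (Y i j)))"
    unfolding chern_term_def Let_def 1 2 sum_distrib_left sum.distrib[symmetric]
    by (intro sum.cong refl) (simp add: field_simps)
  then show ?thesis by (simp add: c_def X_def Y_def)
qed

text \<open>Forms are compared on lists of every length. Both integrands have degree 2n+2, while the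
  frame supplies 2n vectors, so exactly two base vectors are required.\<close>

lemma chern_term_other:
  assumes "length vs \<noteq> 2"
  shows "chern_term N g R H \<tau> y vs = 0"
proof -
  let ?\<Omega> = "\<lambda>k p. curvature_form coords (H k) p"
  have len: "length (map base vs @ frame) \<noteq> 4 + (CARD('n) - 1) * 2" "length (map base vs @ frame) \<noteq> 2 + CARD('n) * 2"
  proof -
    have "CARD('n) > 0" by simp
    then show "length (map base vs @ frame) \<noteq> 4 + (CARD('n) - 1) * 2" "length (map base vs @ frame) \<noteq> 2 + CARD('n) * 2"
      unfolding length_append length_map length_frame_X using assms by linarith+
  qed
  have om: "form_deg (m * 2) (omega_pow g R m k p)" for m k p
    using form_deg_wedge_pow[OF form_deg_kaehler_form] by (simp add: omega_pow_def kaehler_pow_def[abs_def] form_deg_def)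
  have d: "form_deg (2 + 2) (wedge_by (**) (?\<Omega> k p) (?\<Omega> k p))" for k p
    by (intro form_deg_wedge_by form_deg_curvature_form matrix_mult_zero_left matrix_mult_zero_right)
  have d1: "form_deg 4 (\<lambda>us. trace (wedge_by (**) (?\<Omega> k p) (?\<Omega> k p) us))" for k p
    using d[of k p] by (simp add: form_deg_def)
  have d2: "form_deg 2 (\<lambda>us. trace (csm \<i> (?\<Omega> k p us)))" for k p
    using form_deg_curvature_form[of coords "H k" p] by (simp add: form_deg_def)
  have "fibre_integral R (\<lambda>k p. wedge (\<lambda>us. trace (wedge_by (**) (?\<Omega> k p) (?\<Omega> k p) us)) (omega_pow g R (CARD('n) - 1) k p)) y vs = fint y (\<lambda>k p. 0)"
    using form_deg_wedge[OF d1 om] len(1) by (intro fibre_integral_eq_fint) (simp add: form_deg_def)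
  moreover have "fibre_integral R (\<lambda>k p. wedge (\<lambda>us. trace (csm \<i> (?\<Omega> k p us))) (omega_pow g R CARD('n) k p)) y vs = fint y (\<lambda>k p. 0)"
    using form_deg_wedge[OF d2 om] len(2) by (intro fibre_integral_eq_fint) (simp add: form_deg_def)
  ultimately show ?thesis by (simp add: chern_term_def Let_def fint_zero)
qed

end

end

text \<open>Moves the equations from the trivialization on \<open>X\<close> to the extended
  matrices, which agree with the given data on this fibre. The double minus fits the second equation
  to the pattern of \<open>chern_term_pair\<close>.\<close>

lemma vortex_fibre:
  fixes H1 :: "('n::finite + nat \<Rightarrow> complex) \<Rightarrow> complex^'r1^'r1" and H2 :: "('n + nat \<Rightarrow> complex) \<Rightarrow> complex^'r2^'r2"
    and F :: "('n + nat \<Rightarrow> complex) \<Rightarrow> complex^'r2^'r1"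
  assumes "coupled_vortex AX g W h1 h2 \<Phi> \<tau>1 \<tau>2 s" "C \<in> AX" "P \<subseteq> fst C" "open (snd C ` P)"
    and inv: "\<And>x. x \<in> P \<Longrightarrow> chart_inv C (snd C x) = x"
    and rep: "\<And>x. x \<in> P \<Longrightarrow> (x, s) \<in> W a \<and> H1 (case_sum (snd C x) y) = h1 a (x, s) \<and>
      H2 (case_sum (snd C x) y) = h2 a (x, s) \<and> F (case_sum (snd C x) y) = \<Phi> a (x, s)"
    and z: "z \<in> snd C ` P" and G: "hermitian_pd (g C z)"
  defines "p \<equiv> case_sum z y"
  defines "\<Psi> \<equiv> metric_adj (H1 p) (H2 p) (F p)"
  shows "(\<Sum>\<alpha>\<in>UNIV. \<Sum>\<beta>\<in>UNIV. csm (matrix_inv (g C z) $ \<beta> $ \<alpha>) (curv_coeff H1 (Inl \<alpha>) (Inl \<beta>) p)) =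
      mat (of_real \<tau>1) - F p ** \<Psi>"
    and "(\<Sum>\<alpha>\<in>UNIV. \<Sum>\<beta>\<in>UNIV. csm (matrix_inv (g C z) $ \<beta> $ \<alpha>) (curv_coeff H2 (Inl \<alpha>) (Inl \<beta>) p)) =
      mat (of_real \<tau>2) - - (\<Psi> ** F p)"
proof -
  obtain x where x: "x \<in> P" "z = snd C x" using z by blast
  note r = rep[OF x(1), folded x(2), folded p_def]
  have "h1 a (chart_inv C w, s) = H1 (case_sum w y)" "h2 a (chart_inv C w, s) = H2 (case_sum w y)"
    if "w \<in> snd C ` P" for w using that rep inv by auto
  then have c: "curv_coeff (\<lambda>w. h1 a (chart_inv C w, s)) \<alpha> \<beta> z = curv_coeff H1 (Inl \<alpha>) (Inl \<beta>) p"
    "curv_coeff (\<lambda>w. h2 a (chart_inv C w, s)) \<alpha> \<beta> z = curv_coeff H2 (Inl \<alpha>) (Inl \<beta>) p" for \<alpha> \<beta>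
    unfolding p_def by (intro curv_coeff_fibre[OF assms(4) z]; simp)+
  have "csm \<i> (Lambda_mat (g C z) (\<lambda>\<alpha> \<beta>. curv_coeff H1 (Inl \<alpha>) (Inl \<beta>) p)) + F p ** \<Psi> = mat (of_real \<tau>1) \<and>
      csm \<i> (Lambda_mat (g C z) (\<lambda>\<alpha> \<beta>. curv_coeff H2 (Inl \<alpha>) (Inl \<beta>) p)) - \<Psi> ** F p = mat (of_real \<tau>2)"
    using assms(1)[unfolded coupled_vortex_def, rule_format, OF assms(2) subsetD[OF assms(3) x(1)], of a] r
    unfolding Let_def x(2)[symmetric] c \<Psi>_def by simp
  then show "(\<Sum>\<alpha>\<in>UNIV. \<Sum>\<beta>\<in>UNIV. csm (matrix_inv (g C z) $ \<beta> $ \<alpha>) (curv_coeff H1 (Inl \<alpha>) (Inl \<beta>) p)) =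
      mat (of_real \<tau>1) - F p ** \<Psi>"
    "(\<Sum>\<alpha>\<in>UNIV. \<Sum>\<beta>\<in>UNIV. csm (matrix_inv (g C z) $ \<beta> $ \<alpha>) (curv_coeff H2 (Inl \<alpha>) (Inl \<beta>) p)) =
      mat (of_real \<tau>2) - - (\<Psi> ** F p)"
    unfolding Lambda_mat_eq[OF G] by (auto simp: algebra_simps)
qed

section \<open>The identity over one point of the base\<close>

context local_family
begin

text \<open>Regularity, positivity and holomorphy are assumed over all of \<open>U\<close>, as
  differentiating \<open>hom_norm\<close> demands; the equations \<open>v1\<close> and
  \<open>v2\<close> are algebraic input over the single point \<open>y\<close>.\<close>

lemma vortex_moduli_identity:
  assumes y: "y \<in> U"
    and H1: "\<And>k. k < pieces R \<Longrightarrow> mCk coords 2 (prod_dom (dom k) U) (met1 R k)"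
    and H2: "\<And>k. k < pieces R \<Longrightarrow> mCk coords 2 (prod_dom (dom k) U) (met2 R k)"
    and F: "\<And>k. k < pieces R \<Longrightarrow> mCk coords 2 (prod_dom (dom k) U) (hmat R k)"
    and pd1: "\<And>k p. k < pieces R \<Longrightarrow> p \<in> prod_dom (dom k) U \<Longrightarrow> hermitian_pd (met1 R k p)"
    and pd2: "\<And>k p. k < pieces R \<Longrightarrow> p \<in> prod_dom (dom k) U \<Longrightarrow> hermitian_pd (met2 R k p)"
    and hol: "\<And>k p a. k < pieces R \<Longrightarrow> p \<in> prod_dom (dom k) U \<Longrightarrow> a \<in> coords \<Longrightarrow> mat_ddbar a (hmat R k) p = 0"
  defines "\<Psi> \<equiv> (\<lambda>k p. metric_adj (met1 R k p) (met2 R k p) (hmat R k p))"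
  assumes v1: "\<And>k z. k < pieces R \<Longrightarrow> z \<in> dom k \<Longrightarrow>
      (\<Sum>\<alpha>\<in>UNIV. \<Sum>\<beta>\<in>UNIV. csm (matrix_inv (g (coord R k) z) $ \<beta> $ \<alpha>) (curv_coeff (met1 R k) (Inl \<alpha>) (Inl \<beta>) (case_sum z y))) =
      mat (of_real \<tau>1) - hmat R k (case_sum z y) ** \<Psi> k (case_sum z y)"
    and v2: "\<And>k z. k < pieces R \<Longrightarrow> z \<in> dom k \<Longrightarrow>
      (\<Sum>\<alpha>\<in>UNIV. \<Sum>\<beta>\<in>UNIV. csm (matrix_inv (g (coord R k) z) $ \<beta> $ \<alpha>) (curv_coeff (met2 R k) (Inl \<alpha>) (Inl \<beta>) (case_sum z y))) =
      mat (of_real \<tau>2) - - (\<Psi> k (case_sum z y) ** hmat R k (case_sum z y))"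
  shows "vortex_moduli_form N g R y vs =
    chern_term N g R (met1 R) \<tau>1 y vs + chern_term N g R (met2 R) \<tau>2 y vs + \<i> * del_delbar N (hom_norm g R) y vs"
proof (cases "length vs = 2")
  case False
  have "wedge (dz i) (dzbar j) vs = 0" for i j
    using form_deg_wedge[OF form_deg_dz form_deg_dzbar, of i j] False by (simp add: form_deg_def)
  then show ?thesis
    using chern_term_other[OF H1 pd1 y False, of \<tau>1] chern_term_other[OF H2 pd2 y False, of \<tau>2]
    by (simp add: vortex_moduli_form_def del_delbar_def)
next
  case True
  then obtain u v where vs: "vs = [u, v]" by (auto simp: length_Suc_conv numeral_2_eq_2)
  let ?D = "\<lambda>k. prod_dom (dom k) U"
  have b: "mCk coords 2 (?D k) (\<lambda>p. matrix_inv (met2 R k p))" if "k < pieces R" for k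
    by (rule mCk_matrix_inv[OF copen_dom[OF that] invertible_hermitian_pd[OF pd2[OF that]] H2[OF that]])
  have madj: "mCk coords m (?D k) (\<lambda>p. metric_adj (met1 R k p) (met2 R k p) (A p))"
    if k: "k < pieces R" and A: "mCk coords m (?D k) A" and m: "m \<le> 2" for k m and A :: "_ \<Rightarrow> complex^'r2^'r1"
    unfolding metric_adj_def
    by (intro mCk_mult mCk_cadj copen_dom[OF k] A mCk_mono[OF b[OF k] m] mCk_mono[OF H1[OF k] m])
  have \<Psi>: "mCk coords 2 (?D k) (\<Psi> k)" if "k < pieces R" for k
    unfolding \<Psi>_def by (rule madj[OF that F[OF that]]) simp
  have hc: "mCk coords 1 (?D k) (hom_cov (met1 R k) (met2 R k) (hmat R k) (Inr i))" if k: "k < pieces R" and i: "i < N" for k i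
  proof -
    note c = copen_dom[OF k]
    have i': "Inr i \<in> coords" using i by auto
    have "mCk coords 1 (?D k) (conn (met1 R k) (Inr i))" "mCk coords 1 (?D k) (conn (met2 R k) (Inr i))"
      by (rule mCk_conn[OF c pd1[OF k] _ i'] mCk_conn[OF c pd2[OF k] _ i'],
          use H1[OF k] H2[OF k] in \<open>simp_all add: numeral_2_eq_2\<close>)+
    moreover have "mCk coords 1 (?D k) (mat_dd (Inr i) (hmat R k))"
      using F[OF k] by (intro mCk_dd c i') (simp add: numeral_2_eq_2)
    moreover have "mCk coords 1 (?D k) (hmat R k)" by (rule mCk_mono[OF F[OF k]]) simp
    ultimately show ?thesis
      unfolding hom_cov_def[abs_def] by (intro mCk_diff mCk_add mCk_mult c)
  qed
  have ch: "fibre_cont y (hom_density R i j)" if "i < N" "j < N" for i j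
  proof (intro allI impI)
    fix k assume k: "k < pieces R"
    have "Ck coords 1 (?D k) (hom_density R i j k)"
      unfolding hom_density_def[abs_def]
      by (intro Ck_trace mCk_mult copen_dom[OF k] hc[OF k] madj[OF k] that) simp
    then show "fcont (dom k) y (hom_density R i j k)" by (rule fcont_Ck[OF _ y])
  qed
  define S1 where "S1 = (\<lambda>k p. hmat R k p ** \<Psi> k p)"
  define S2 where "S2 = (\<lambda>k p. \<Psi> k p ** hmat R k p)"
  have S1: "fcont (dom k) y (\<lambda>p. S1 k p $ r $ q)" if "k < pieces R" for k r q
    unfolding S1_def by (rule fcont_Ck[OF mCk_D[OF mCk_mult[OF copen_dom[OF that] F[OF that] \<Psi>[OF that]]] y])
  have S2: "fcont (dom k) y (\<lambda>p. S2 k p $ r $ q)" if "k < pieces R" for k r q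
    unfolding S2_def by (rule fcont_Ck[OF mCk_D[OF mCk_mult[OF copen_dom[OF that] \<Psi>[OF that] F[OF that]]] y])
  have S2': "fcont (dom k) y (\<lambda>p. (- S2 k p) $ r $ q)" if "k < pieces R" for k r q
    using fcont_intros(2)[OF fcont_intros(3)[where c = "- 1"] S2[OF that]] by simp
  \<comment> \<open>\<open>h\<close> is the homomorphism part of the moduli form and
    \<open>c1\<close>, \<open>c2\<close> are its curvature parts. \<open>t1\<close> and
    \<open>t2\<close> pair the base curvature with the quadratic terms of the vortex
    equations.\<close>
  define h where "h = (\<lambda>i j. fint y (hom_density R i j))"
  define c1 where "c1 = (\<lambda>i j. fint y (\<lambda>k p. curv_density (metric_at g R k p) (met1 R k) i j p))"
  define c2 where "c2 = (\<lambda>i j. fint y (\<lambda>k p. curv_density (metric_at g R k p) (met2 R k) i j p))"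
  define t1 where "t1 = (\<lambda>i j. fint y (\<lambda>k p. trace (curv_coeff (met1 R k) (Inr i) (Inr j) p ** S1 k p)))"
  define t2 where "t2 = (\<lambda>i j. fint y (\<lambda>k p. trace (curv_coeff (met2 R k) (Inr i) (Inr j) p ** S2 k p)))"
  define w where "w = (\<lambda>i j. wedge (dz i) (dzbar j) [u, v])"
  have G: "G_VM g R i j y = h i j + c1 i j + c2 i j" for i j
    by (simp add: G_VM_def h_def c1_def c2_def fint_eq)
  have C1: "chern_term N g R (met1 R) \<tau>1 y [u, v] = \<i> * (\<Sum>i<N. \<Sum>j<N. w i j * (c1 i j + t1 i j))"
    unfolding w_def c1_def t1_def by (rule chern_term_pair[OF H1 pd1 y S1]) (simp_all add: v1 S1_def)
  have "chern_term N g R (met2 R) \<tau>2 y [u, v] = \<i> * (\<Sum>i<N. \<Sum>j<N. w i j * (c2 i j +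
      fint y (\<lambda>k p. trace (curv_coeff (met2 R k) (Inr i) (Inr j) p ** - S2 k p))))"
    unfolding w_def c2_def by (rule chern_term_pair[OF H2 pd2 y S2']) (simp_all add: v2 S2_def)
  moreover have "fint y (\<lambda>k p. trace (curv_coeff (met2 R k) (Inr i) (Inr j) p ** - S2 k p)) = - t2 i j" for i j
    unfolding t2_def matrix_mult_minus trace_minus
    using fint_cmult[of y "- 1" "\<lambda>k p. trace (curv_coeff (met2 R k) (Inr i) (Inr j) p ** S2 k p)"] by simp
  ultimately have C2: "chern_term N g R (met2 R) \<tau>2 y [u, v] = \<i> * (\<Sum>i<N. \<Sum>j<N. w i j * (c2 i j - t2 i j))"
    by simp
  have hn: "hom_norm g R = (\<lambda>y. fint y (\<lambda>k p. trace (S1 k p)))"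
    by (rule ext) (simp add: hom_norm_def fint_eq S1_def \<Psi>_def)
  have D: "dd i (ddbar j (hom_norm g R)) y = h i j + t2 i j - t1 i j" if ij: "i < N" "j < N" for i j
  proof -
    have "dd i (ddbar j (hom_norm g R)) y = fint y (\<lambda>k. dd (Inr i) (ddbar (Inr j) (\<lambda>p. trace (S1 k p))))"
      unfolding hn
    proof (rule dd_ddbar_fint[OF _ y ij])
      fix k assume k: "k < pieces R"
      show "Ck coords (Suc (Suc 0)) (?D k) (\<lambda>p. trace (S1 k p))"
        unfolding S1_def numeral_2_eq_2[symmetric] by (intro Ck_trace mCk_mult copen_dom F \<Psi> k)
    qed
    also have "\<dots> = fint y (\<lambda>k p. hom_density R i j k p + trace (curv_coeff (met2 R k) (Inr i) (Inr j) p ** S2 k p) -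
        trace (curv_coeff (met1 R k) (Inr i) (Inr j) p ** S1 k p))"
    proof (rule fint_cong)
      fix k z assume k: "k < pieces R" and z: "z \<in> dom k"
      have "case_sum z y \<in> ?D k" "Inr i \<in> coords" "Inr j \<in> coords" using z y ij by auto
      from dd_ddbar_hom_norm[OF copen_dom[OF k] H1[OF k] H2[OF k] F[OF k] pd1[OF k] pd2[OF k] hol[OF k] this(2,3,1)]
      show "dd (Inr i) (ddbar (Inr j) (\<lambda>p. trace (S1 k p))) (case_sum z y) = hom_density R i j k (case_sum z y) +
          trace (curv_coeff (met2 R k) (Inr i) (Inr j) (case_sum z y) ** S2 k (case_sum z y)) -
          trace (curv_coeff (met1 R k) (Inr i) (Inr j) (case_sum z y) ** S1 k (case_sum z y))"
        by (simp add: S1_def S2_def \<Psi>_def hom_density_def)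
    qed
    also have "\<dots> = h i j + t2 i j - t1 i j"
    proof -
      note t = trace_curv_coeff_cont[OF H1 pd1 y ij S1] trace_curv_coeff_cont[OF H2 pd2 y ij S2]
      have "fibre_cont y (\<lambda>k p. hom_density R i j k p + trace (curv_coeff (met2 R k) (Inr i) (Inr j) p ** S2 k p))"
        using ch[OF ij] t(2) by (auto intro!: fcont_intros)
      from fint_diff[OF this t(1)] fint_add[OF ch[OF ij] t(2)] show ?thesis
        by (simp add: h_def t1_def t2_def)
    qed
    finally show ?thesis .
  qed
  have "vortex_moduli_form N g R y vs = (\<Sum>i<N. \<Sum>j<N. \<i> * (w i j * (h i j + c1 i j + c2 i j)))"
    by (simp add: vortex_moduli_form_def vs G w_def sum_distrib_left mult.commute)
  \<comment> \<open>\<open>t1\<close> and \<open>t2\<close> come with one sign from the two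
    curvature integrals and with the other from the second derivative \<open>D\<close>.\<close>
  also have "\<dots> = (\<Sum>i<N. \<Sum>j<N. \<i> * (w i j * (c1 i j + t1 i j)) + \<i> * (w i j * (c2 i j - t2 i j)) +
      \<i> * (w i j * (h i j + t2 i j - t1 i j)))"
    by (intro sum.cong refl) (simp add: algebra_simps)
  also have "\<dots> = chern_term N g R (met1 R) \<tau>1 y vs + chern_term N g R (met2 R) \<tau>2 y vs + \<i> * del_delbar N (hom_norm g R) y vs"
    unfolding vs C1 C2 del_delbar_def by (simp add: D w_def sum.distrib sum_distrib_left mult.commute)
  finally show ?thesis .
qed

end

theorem proposition7p1:
  fixes AX :: "('x::t2_space, 'n::finite) chart set"
    and g :: "('x, 'n) chart \<Rightarrow> ('n \<Rightarrow> complex) \<Rightarrow> complex^'n^'n"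
    and AS :: "('s::t2_space) schart set"
    and W :: "'a \<Rightarrow> ('x \<times> 's) set"
    and T1 :: "'a \<Rightarrow> 'a \<Rightarrow> 'x \<times> 's \<Rightarrow> complex^'r1^'r1"
    and T2 :: "'a \<Rightarrow> 'a \<Rightarrow> 'x \<times> 's \<Rightarrow> complex^'r2^'r2"
    and \<Phi> :: "'a \<Rightarrow> 'x \<times> 's \<Rightarrow> complex^'r2^'r1"
    and h1 :: "'a \<Rightarrow> 'x \<times> 's \<Rightarrow> complex^'r1^'r1"
    and h2 :: "'a \<Rightarrow> 'x \<times> 's \<Rightarrow> complex^'r2^'r2"
    and \<tau>1 \<tau>2 :: real
    and R :: "('x, 'n, 'a, 'r1, 'r2) local_rep"
    and N :: nat and D :: "'s set" and \<kappa> :: "'s \<Rightarrow> nat \<Rightarrow> complex"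
    and U :: "(nat \<Rightarrow> complex) set" and s :: 's
  assumes "complex_manifold AX" and "compact (UNIV :: 'x set)" and "connected (UNIV :: 'x set)"
    and "kaehler_metric AX g" and "total_volume AX g = of_real (2 * pi)"
    and "reduced_complex_space AS"
    and "hol_bundle (holo_XS AX AS) W T1" and "hol_bundle (holo_XS AX AS) W T2"
    and "hol_hom (holo_XS AX AS) W T1 T2 \<Phi>"
    and "stable_family AX g W T1 T2 \<Phi> (\<tau>1 - \<tau>2)"
    and "hermitian_metric (smooth_XS AX AS) W T1 h1"
    and "hermitian_metric (smooth_XS AX AS) W T2 h2"
    and "\<forall>s. coupled_vortex AX g W h1 h2 \<Phi> \<tau>1 \<tau>2 s"
    and "(N, D, \<kappa>) \<in> AS"
    and "represents_family AX (N, D, \<kappa>) U W h1 h2 \<Phi> R"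
    and "s \<in> D" and "\<kappa> s \<in> U"
  shows "vortex_moduli_form N g R (\<kappa> s) =
    (\<lambda>vs. chern_term N g R (met1 R) \<tau>1 (\<kappa> s) vs + chern_term N g R (met2 R) \<tau>2 (\<kappa> s) vs +
          \<i> * del_delbar N (hom_norm g R) (\<kappa> s) vs)"
proof -
  let ?dom = "\<lambda>k. snd (coord R k) ` piece R k"
  let ?K = "\<lambda>k. snd (coord R k) ` closure {x. weight R k x \<noteq> 0}"
  note km = assms(4)[unfolded kaehler_metric_def]
  note rf = assms(15)[unfolded represents_family_def prod.case]
  have pu: "partition_of_unity AX (pieces R) (coord R) (piece R) (weight R)" and U: "copen {..<N} U"
    using rf[THEN conjunct1] rf[THEN conjunct2, THEN conjunct1] by simp_all
  have C: "coord R k \<in> AX" "open (piece R k)" "piece R k \<subseteq> fst (coord R k)" "continuous_on UNIV (weight R k)"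
    "closure {x. weight R k x \<noteq> 0} \<subseteq> piece R k" if "k < pieces R" for k
    using pu that by (auto simp: partition_of_unity_def)
  have wc: "weighted_chart (?dom k) (?K k) (\<lambda>z. weight R k (chart_inv (coord R k) z))" if "k < pieces R" for k
    by (rule weighted_chartI[OF assms(1,2) C[OF that]])
  have sub: "?dom k \<subseteq> snd (coord R k) ` fst (coord R k)" if "k < pieces R" for k
    using C(3)[OF that] by blast
  have g: "hermitian_pd (g (coord R k) z)" if "k < pieces R" "z \<in> ?dom k" for k z
    by (rule km[THEN conjunct2, THEN conjunct1, THEN bspec, OF C(1)[OF that(1)], THEN bspec,
          OF subsetD[OF sub[OF that(1)] that(2)]])
  have gc: "continuous_on (?dom k) (\<lambda>z. g (coord R k) z $ \<alpha> $ \<beta>)" if "k < pieces R" for k \<alpha> \<beta>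
  proof -
    have "smooth UNIV (snd (coord R k) ` fst (coord R k)) (\<lambda>z. g (coord R k) z $ \<alpha> $ \<beta>)"
      by (rule km[THEN conjunct1, THEN bspec, OF C(1)[OF that], THEN spec, THEN spec])
    then have "Ck UNIV 0 (snd (coord R k) ` fst (coord R k)) (\<lambda>z. g (coord R k) z $ \<alpha> $ \<beta>)"
      unfolding smooth_def by (rule spec)
    then show ?thesis by (rule continuous_on_subset[OF Ck_continuous sub[OF that]])
  qed
  interpret local_family g R N U ?K ?dom
    by (rule local_family.intro) (rule refl, fact wc, fact gc, fact g, rule U)
  \<comment> \<open>Over a point of \<open>S\<close> the extended matrices are the given ones; this
    makes the vortex equations available at \<kappa> s.\<close>
  have rep: "(x, s) \<in> W (triv R k) \<and> met1 R k (case_sum (snd (coord R k) x) (\<kappa> s)) = h1 (triv R k) (x, s) \<and>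
      met2 R k (case_sum (snd (coord R k) x) (\<kappa> s)) = h2 (triv R k) (x, s) \<and>
      hmat R k (case_sum (snd (coord R k) x) (\<kappa> s)) = \<Phi> (triv R k) (x, s)"
    if "k < pieces R" "x \<in> piece R k" for k x
    by (rule rf[THEN conjunct2, THEN conjunct2, THEN spec, THEN mp, OF that(1), THEN conjunct1, THEN bspec, OF that(2),
          THEN bspec, OF assms(16), THEN mp, OF assms(17), unfolded Let_def])
  have reg: "(\<forall>i j. smooth coords (prod_dom (?dom k) U) (\<lambda>p. met1 R k p $ i $ j)) \<and>
      (\<forall>p\<in>prod_dom (?dom k) U. hermitian_pd (met1 R k p)) \<and>
      (\<forall>i j. smooth coords (prod_dom (?dom k) U) (\<lambda>p. met2 R k p $ i $ j)) \<and>
      (\<forall>p\<in>prod_dom (?dom k) U. hermitian_pd (met2 R k p)) \<and>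
      (\<forall>i j. hol coords (prod_dom (?dom k) U) (\<lambda>p. hmat R k p $ i $ j))" if "k < pieces R" for k
    unfolding prod_dom_def
    by (rule rf[THEN conjunct2, THEN conjunct2, THEN spec, THEN mp, OF that, THEN conjunct2, unfolded Let_def])
  have inv: "chart_inv (coord R k) (snd (coord R k) x) = x" if "k < pieces R" "x \<in> piece R k" for k x
  proof -
    have "homeomorphism (fst (coord R k)) (snd (coord R k) ` fst (coord R k)) (snd (coord R k)) (chart_inv (coord R k))"
      using assms(1) C(1)[OF that(1)] by (simp add: complex_manifold_def)
    then show ?thesis using subsetD[OF C(3)[OF that(1)] that(2)] by (simp add: homeomorphism_def)
  qed
  have v: "coupled_vortex AX g W h1 h2 \<Phi> \<tau>1 \<tau>2 s" by (rule assms(13)[THEN spec])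
  show ?thesis
  proof (rule ext, rule vortex_moduli_identity[OF assms(17)])
    fix k assume k: "k < pieces R"
    show "mCk coords 2 (prod_dom (?dom k) U) (met1 R k)" "mCk coords 2 (prod_dom (?dom k) U) (met2 R k)"
      "mCk coords 2 (prod_dom (?dom k) U) (hmat R k)"
      using reg[OF k] by (simp_all add: mCk_def smooth_def hol_def)
    fix p assume p: "p \<in> prod_dom (?dom k) U"
    show "hermitian_pd (met1 R k p)" "hermitian_pd (met2 R k p)" using reg[OF k] p by simp_all
    fix a :: "'n + nat" assume "a \<in> coords"
    then show "mat_ddbar a (hmat R k) p = 0"
      using reg[OF k] p by (simp add: hol_def mat_ddbar_def vec_eq_iff)
  next
    fix k z assume k: "k < pieces R" and z: "z \<in> ?dom k"
    note vf = vortex_fibre[OF v C(1)[OF k] C(3)[OF k] dom_open[OF k] inv[OF k] rep[OF k] z g[OF k z]]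
    show "(\<Sum>\<alpha>\<in>UNIV. \<Sum>\<beta>\<in>UNIV. csm (matrix_inv (g (coord R k) z) $ \<beta> $ \<alpha>) (curv_coeff (met1 R k) (Inl \<alpha>) (Inl \<beta>) (case_sum z (\<kappa> s)))) =
      mat (of_real \<tau>1) - hmat R k (case_sum z (\<kappa> s)) ** metric_adj (met1 R k (case_sum z (\<kappa> s))) (met2 R k (case_sum z (\<kappa> s))) (hmat R k (case_sum z (\<kappa> s)))"
      by (rule vf(1))
    show "(\<Sum>\<alpha>\<in>UNIV. \<Sum>\<beta>\<in>UNIV. csm (matrix_inv (g (coord R k) z) $ \<beta> $ \<alpha>) (curv_coeff (met2 R k) (Inl \<alpha>) (Inl \<beta>) (case_sum z (\<kappa> s)))) =
      mat (of_real \<tau>2) - - (metric_adj (met1 R k (case_sum z (\<kappa> s))) (met2 R k (case_sum z (\<kappa> s))) (hmat R k (case_sum z (\<kappa> s))) ** hmat R k (case_sum z (\<kappa> s)))"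
      by (rule vf(2))
  qed
qed

end
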